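(* Let $f_1,\dots,f_r\in\mathbb C[z_1,z_2]\setminus\mathbb C$ be degree-one polynomials. Suppose $A=\{f_1f_2\cdots f_r=0\}$ is a central essential indecomposable hyperplane arrangement in $\mathbb C^2$. Let $\alpha,\beta\in C_c^\infty(\mathbb C)$ be such that $\alpha,\beta\ge0$ and there exists a neighborhood $D$ of $0\in\mathbb C$ with $\alpha|_D=\beta|_D\equiv1$. Let $\varphi\in C_c^\infty(\mathbb C^2)$ be given by $\varphi(z_1,z_2):=\alpha(z_1)\beta(z_2)$ for all $(z_1,z_2)\in\mathbb C^2$. Then for all $\mathbf a=(a_1,\dots,a_r)\in\mathbb N_{>0}^r$, with $d:=\sum_{i=1}^ra_i$ and $\mathbf f^{\mathbf a}:=f_1^{a_1}\cdots f_r^{a_r}$, the order of $-2/d$ as a pole of $Z_{\mathbf f^{\mathbf a},\varphi}(s)$ is not greater than $2$. Moreover, if $-2/d$ is not an order two pole of $Z_{\mathbf f^{\mathbf a},\varphi}(s)$, then it is an order one pole, with a positive residue if $\max\{a_i\}_{i=1}^r\le d/2$, and with a negative residue if $\max\{a_i\}_{i=1}^r>d/2$.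
   Context: $C_c^\infty(\mathbb C^k)$ is the space of compactly supported complex-valued $C^\infty$ functions on $\mathbb C^k$ (smooth in the real sense). Hyperplane arrangements: let $A=\{f=0\}=\bigcup_iV_i\subseteq\mathbb C^n$ be a finite union of hyperplanes. $A$ is central if $\mathbf 0\in V_i$ for all $i$; essential if $\bigcap_iV_i=\{\mathbf 0\}$; decomposable if, after a linear coordinate change, $f$ can be written as the product of two non-constant polynomials in two disjoint sets of variables; indecomposable otherwise. Archimedean zeta function: for $f\in\mathbb C[z_1,z_2]\setminus\mathbb C$ and $\varphi\in C_c^\infty(\mathbb C^2)$, $Z_{f,\varphi}(s)$ is the meromorphic extension to $\mathbb C$ of the function $s\mapsto\int_{\mathbb C^2}|f|^{2s}\varphi\,\mathrm d\mathbf z$ on $\{s\in\mathbb C\mid\mathrm{Re}\,s>0\}$, where $\mathrm d\mathbf z=(\frac{\sqrt{-1}}2)^2\mathrm dz_1\wedge\mathrm d\bar z_1\wedge\mathrm dz_2\wedge\mathrm d\bar z_2$ (Lebesgue measure).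
   Formalization: The f_i are assumed to define pairwise distinct lines; if proportional f_i were allowed the sign claim fails, e.g. f=(x,x,y,x+y), a=(2,2,1,1): max a_i=2≤d/2=3, but f^a=x^4y(x+y) has a simple pole at -1/3 with negative residue. *)

theory Defs
  imports "HOL-Complex_Analysis.Complex_Analysis" "HOL-Library.Poly_Mapping"
begin

text \<open>Polynomials with complex coefficients in variables indexed by a finite type: finitely
  supported maps from exponent vectors to coefficients, with the convolution product of
  \<^theory>\<open>HOL-Library.Poly_Mapping\<close>. So \<open>2 mpoly\<close> is the ring of complex polynomials in two
  variables, and the affine space is \<^typ>\<open>complex^2\<close>.\<close>

type_synonym 'n mpoly = "('n \<Rightarrow>\<^sub>0 nat) \<Rightarrow>\<^sub>0 complex"

definition mpoly_eval :: "'n::finite mpoly \<Rightarrow> complex^'n \<Rightarrow> complex" where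
  "mpoly_eval p z =
     (\<Sum>m\<in>Poly_Mapping.keys p. Poly_Mapping.lookup p m * (\<Prod>i\<in>UNIV. z $ i ^ Poly_Mapping.lookup m i))"

definition mpoly_vars :: "'n::finite mpoly \<Rightarrow> 'n set" where
  "mpoly_vars p = (\<Union>m\<in>Poly_Mapping.keys p. Poly_Mapping.keys m)"

text \<open>The zero polynomial gets degree 0, so positive total degree means non-constant.\<close>

definition mpoly_total_degree :: "'n::finite mpoly \<Rightarrow> nat" where
  "mpoly_total_degree p =
     Max (insert 0 ((\<lambda>m. \<Sum>i\<in>UNIV. Poly_Mapping.lookup m i) ` Poly_Mapping.keys p))"

definition zero_locus :: "'n::finite mpoly \<Rightarrow> (complex^'n) set" where
  "zero_locus p = {z. mpoly_eval p z = 0}"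

definition central_arrangement :: "(complex^'n::finite) set set \<Rightarrow> bool" where
  "central_arrangement \<V> \<longleftrightarrow> (\<forall>V\<in>\<V>. 0 \<in> V)"

definition essential_arrangement :: "(complex^'n::finite) set set \<Rightarrow> bool" where
  "essential_arrangement \<V> \<longleftrightarrow> \<Inter>\<V> = {0}"

text \<open>Decomposability of the arrangement \<open>{f = 0}\<close>, as a property of the defining polynomial.
  The linear coordinate change is \<open>z = M w\<close>. Since the field is infinite, the equality of
  polynomial functions below is equality of polynomials in \<open>w\<close>.\<close>

definition decomposable :: "'n::finite mpoly \<Rightarrow> bool" where
  "decomposable f \<longleftrightarrow>
     (\<exists>(M :: complex^'n^'n) g h. invertible M \<and>
        mpoly_total_degree g > 0 \<and> mpoly_total_degree h > 0 \<and>
        mpoly_vars g \<inter> mpoly_vars h = {} \<and>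
        (\<forall>w. mpoly_eval f (M *v w) = mpoly_eval (g * h) w))"

text \<open>Smoothness is in the real sense: \<^const>\<open>frechet_derivative\<close> is real-linear. In finite
  dimension, continuity of all iterated directional derivatives is the usual \<open>C^k\<close> condition.\<close>

primrec C_k :: "nat \<Rightarrow> ('a::euclidean_space \<Rightarrow> 'b::real_normed_vector) \<Rightarrow> bool" where
  "C_k 0 f \<longleftrightarrow> continuous_on UNIV f"
| "C_k (Suc k) f \<longleftrightarrow>
     (\<forall>x. f differentiable (at x)) \<and> (\<forall>v. C_k k (\<lambda>x. frechet_derivative f (at x) v))"

definition Cc_infinity :: "('a::euclidean_space \<Rightarrow> complex) set" where
  "Cc_infinity = {f. (\<forall>k. C_k k f) \<and> compact (closure {x. f x \<noteq> 0})}"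

text \<open>The form \<open>(i/2)^n dz_1 \<and> d(cnj z_1) \<and> ... \<and> dz_n \<and> d(cnj z_n)\<close> is Lebesgue measure
  on the underlying real space, i.e. \<^const>\<open>lborel\<close> on \<^typ>\<open>complex^'n\<close>.\<close>

definition zeta_integral :: "'n::finite mpoly \<Rightarrow> (complex^'n \<Rightarrow> complex) \<Rightarrow> complex \<Rightarrow> complex" where
  "zeta_integral f \<phi> s =
     integral\<^sup>L lborel (\<lambda>z. of_real (cmod (mpoly_eval f z)) powr (2 * s) * \<phi> z)"

text \<open>A meromorphic function is only determined up to its values on a discrete set;
  \<^const>\<open>nicely_meromorphic_on\<close> fixes these values (no removable singularities, value 0 at poles),
  so that the extension is unique as a function.\<close>

definition arch_zeta :: "'n::finite mpoly \<Rightarrow> (complex^'n \<Rightarrow> complex) \<Rightarrow> complex \<Rightarrow> complex" where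
  "arch_zeta f \<phi> =
     (THE Z. Z nicely_meromorphic_on UNIV \<and> (\<forall>s. Re s > 0 \<longrightarrow> Z s = zeta_integral f \<phi> s))"

lemma nicely_meromorphic_extension_unique:
  assumes Z: "Z nicely_meromorphic_on UNIV" "\<And>s. Re s > 0 \<Longrightarrow> Z s = F s"
    and W: "W nicely_meromorphic_on UNIV" "\<And>s. Re s > 0 \<Longrightarrow> W s = F s"
  shows "Z = W"
proof
  fix z
  define h where "h = remove_sings (\<lambda>s. Z s - W s)"
  have mZ: "Z meromorphic_on UNIV" and mW: "W meromorphic_on UNIV"
    using Z(1) W(1) by (auto simp: nicely_meromorphic_on_def)
  have m: "(\<lambda>s. Z s - W s) meromorphic_on UNIV"
    using mZ mW by (intro meromorphic_intros)
  have hn: "h nicely_meromorphic_on UNIV"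
    unfolding h_def by (rule remove_sings_nicely_meromorphic[OF m])
  have ev1: "\<forall>\<^sub>F s in at 1. Re s > 0"
    by (rule eventually_at_in_open'[of "{s. Re s > 0}", simplified]) (simp_all add: open_halfspace_Re_gt)
  have eh: "\<forall>\<^sub>F s in at x. h s = Z s - W s" for x
    unfolding h_def by (rule eventually_remove_sings_eq_at) (use m in \<open>auto intro: meromorphic_on_isolated_singularity meromorphic_on_subset\<close>)
  have "\<forall>\<^sub>F s in at 1. h s = 0"
    using ev1 eh[of 1] by eventually_elim (simp add: Z(2) W(2))
  hence "frequently (\<lambda>s. h s = 0) (at 1)"
    by (rule eventually_frequently[rotated]) simp
  hence h0: "h x = 0" for x
    using frequently_eq_meromorphic_imp_constant[of h 0 1 UNIV] hn by auto
  have ev: "\<forall>\<^sub>F s in at z. Z s = W s"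
    using eh[of z] by eventually_elim (simp add: h0)
  have pole: "is_pole Z z \<longleftrightarrow> is_pole W z"
    by (rule is_pole_cong[OF ev refl])
  show "Z z = W z"
  proof (cases "is_pole Z z")
    case True
    thus ?thesis using Z(1) W(1) pole
      by (metis UNIV_I nicely_meromorphic_on_def not_tendsto_and_filterlim_at_infinity
          trivial_limit_at is_pole_def)
  next
    case False
    hence "Z \<midarrow>z\<rightarrow> Z z" "W \<midarrow>z\<rightarrow> W z"
      using Z(1) W(1) pole by (auto simp: nicely_meromorphic_on_def)
    moreover have "W \<midarrow>z\<rightarrow> Z z"
      using calculation(1) tendsto_cong[OF ev] by blast
    ultimately show ?thesis
      by (meson LIM_unique)
  qed
qed

lemma arch_zeta_eqI:
  assumes "Z nicely_meromorphic_on UNIV" "\<And>s. Re s > 0 \<Longrightarrow> Z s = zeta_integral f \<phi> s"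
  shows "arch_zeta f \<phi> = Z"
  unfolding arch_zeta_def
  using assms nicely_meromorphic_extension_unique by (intro the_equality) blast+

text \<open>\<^const>\<open>zorder\<close> is minus the pole order at a pole; points that are not poles get order 0.\<close>

definition pole_order :: "(complex \<Rightarrow> complex) \<Rightarrow> complex \<Rightarrow> nat" where
  "pole_order g p = (if is_pole g p then nat (- zorder g p) else 0)"

end

theory Submission
  imports Defs
begin

text \<open>
  After the substitution \<open>z = 2 w\<close> the test function \<open>\<phi>\<close> may be replaced by \<open>\<phi>(z) - \<phi>(2 z)\<close>,
  at the price of a factor \<open>1 - 4 powr -(d s + 2)\<close>, which has a simple zero at \<open>s = -2/d\<close>.
  The new test function is a sum of two terms, one supported away from \<open>z\<^sub>1 = 0\<close> and the other away
  from \<open>z\<^sub>2 = 0\<close>. On such a term, integration by parts along the other coordinate gains factors of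
  the defining polynomial and continues the integral, with poles only where \<open>a\<^sub>i s\<close> is a negative
  integer. At \<open>-2/d\<close> this contributes at most one further simple pole, because at least three lines
  pass through the origin. Hence the pole order is at most \<open>2\<close>.

  The sign is read off from real \<open>s\<close> decreasing to \<open>-2/d\<close>. If no \<open>a\<^sub>i\<close> exceeds \<open>d/2\<close>, the integral
  converges for \<open>s > -2/d\<close> and, being positive and homogeneous near the origin, grows at least like
  \<open>1/(d s + 2)\<close>. If \<open>a\<^sub>1 > d/2\<close>, put \<open>b = d - a\<^sub>1\<close> and scale the other forms \<open>l\<^sub>i\<close> so that they agree
  on the line \<open>l\<^sub>1 = 0\<close>. For \<open>s < 0\<close> the weighted inequality of arithmetic and geometric means bounds
  the integrand by the mean, with weights \<open>a\<^sub>i/b\<close>, of the functions \<open>\<bar>l\<^sub>1\<bar> powr (2 a\<^sub>1 s) * \<bar>l\<^sub>i\<bar> powr (2 b s)\<close>.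
  Each of these involves only two lines and its zeta function has no pole at \<open>-2/d\<close>. The difference
  of the two sides is nonnegative and vanishes to second order on \<open>l\<^sub>1 = 0\<close>, so its integral
  converges for \<open>s > -2/d\<close> and grows at least like \<open>1/(d s + 2)\<close>: the residue is negative.
\<close>

text \<open>The dilation stands in for a resolution of the origin: away from it the lines do not
  meet, and its own contribution is isolated in one explicit factor. The factors lost in
  integrations by parts are collected in reciprocal Gamma functions. Those that can vanish at
  \<open>-2/d\<close> have the form \<open>a i * s + 1\<close>, and no two vanish there together,
  since \<open>a i + a l < d\<close> for distinct lines.

  The obstacle for the sign is an exponent above \<open>d/2\<close>: the integral then diverges
  already at \<open>s = -1/a1\<close>, to the right of \<open>-2/d\<close>, so positivity of the
  integrand says nothing directly about the continuation. A function with two lines can be continued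
  by hand, because one may differentiate in a direction along which the second form is constant.
  Agreement to second order on the dominant line raises the exponent there by two, which suffices
  because \<open>a1 < d\<close>. The defect in the inequality of means is nonzero only if two
  different normalised forms remain, so the third line is used here as well.\<close>

no_notation fps_nth (infixl \<open>$\<close> 75)

section \<open>Integration\<close>

lemma lborel_scale_density:
  fixes t :: real
  assumes "t > 0"
  shows "lborel = density (distr lborel borel (\<lambda>x::'a::euclidean_space. t *\<^sub>R x)) (\<lambda>_. ennreal (t ^ DIM('a)))"
  using lborel_affine[of t "0::'a"] assms by simp

lemma integral_lborel_scale:
  fixes f :: "'a::euclidean_space \<Rightarrow> 'b::{banach, second_countable_topology}"
  assumes t: "t > 0" and f [measurable]: "f \<in> borel_measurable borel"
  shows "(\<integral>x. f x \<partial>lborel) = (t ^ DIM('a)) *\<^sub>R (\<integral>x. f (t *\<^sub>R x) \<partial>lborel)"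
proof -
  have "(\<integral>x. f x \<partial>lborel) = (\<integral>x. f x \<partial>(density (distr lborel borel (\<lambda>x::'a. t *\<^sub>R x)) (\<lambda>_. ennreal (t ^ DIM('a)))))"
    using lborel_scale_density[OF t, where 'a='a] by simp
  also have "\<dots> = (\<integral>x. (t ^ DIM('a)) *\<^sub>R f (t *\<^sub>R x) \<partial>lborel)"
    using t by (subst integral_density) (auto simp: integral_distr)
  finally show ?thesis by simp
qed

lemma integrable_bounded_support:
  fixes f :: "'a::euclidean_space \<Rightarrow> 'b::{banach, second_countable_topology}"
  assumes [measurable]: "f \<in> borel_measurable borel"
    and "\<And>z. norm (f z) \<le> C" "\<And>z. norm z > R \<Longrightarrow> f z = 0"
  shows "integrable lborel f"
proof (rule Bochner_Integration.integrable_bound[where f="\<lambda>z. C * indicator (cball 0 R) z"])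
  have "emeasure lborel (cball (0::'a) R) < \<infinity>"
    by (rule emeasure_bounded_finite) simp
  thus "integrable lborel (\<lambda>z::'a. C * indicator (cball 0 R) z)"
    by (intro integrable_mult_right integrable_real_indicator) auto
  show "AE z in lborel. norm (f z) \<le> norm (C * indicator (cball 0 R) z)"
  proof (rule AE_I2)
    fix z show "norm (f z) \<le> norm (C * indicator (cball 0 R) z)"
      using assms(2)[of z] assms(3)[of z] order_trans[OF norm_ge_zero assms(2)[of z]]
      by (auto simp: indicator_def)
  qed
qed auto

text \<open>Differentiate the translation invariance of the integral.\<close>

lemma integral_directional_derivative_eq_0:
  fixes G :: "'a::euclidean_space \<Rightarrow> complex"
  assumes cont: "continuous_on UNIV G"
    and supp: "\<And>z. norm z > R \<Longrightarrow> G z = 0"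
    and der: "\<And>z. ((\<lambda>t. G (z + t *\<^sub>R v)) has_vector_derivative G' z) (at 0)"
    and bd: "\<And>z. norm (G' z) \<le> C"
  shows "G' \<in> borel_measurable borel \<and> integral\<^sup>L lborel G' = 0"
proof -
  define \<delta> where "\<delta> n = inverse (real (Suc n))" for n
  define D where "D n z = (G (z + \<delta> n *\<^sub>R v) - G z) /\<^sub>R \<delta> n" for n z
  have dpos: "\<delta> n > 0" for n by (simp add: \<delta>_def)
  have dle: "\<delta> n \<le> 1" for n by (simp add: \<delta>_def inverse_le_1_iff)
  have [measurable]: "G \<in> borel_measurable borel"
    using cont by (rule borel_measurable_continuous_onI)
  have Dm [measurable]: "D n \<in> borel_measurable borel" for n
    unfolding D_def by measurable
  have dlim: "\<delta> \<longlonglongrightarrow> 0" unfolding \<delta>_def by (rule LIMSEQ_inverse_real_of_nat)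
  have Dlim: "(\<lambda>n. D n z) \<longlonglongrightarrow> G' z" for z
  proof -
    have "((\<lambda>t. (G (z + t *\<^sub>R v) - G z) /\<^sub>R t) \<longlongrightarrow> G' z) (at 0)"
    proof -
      have "((\<lambda>h. norm (G (z + h *\<^sub>R v) - G z - h *\<^sub>R G' z) / norm h) \<longlongrightarrow> 0) (at 0)"
        using der[of z] by (simp add: has_vector_derivative_def has_derivative_at)
      hence "((\<lambda>h. norm ((G (z + h *\<^sub>R v) - G z) /\<^sub>R h - G' z)) \<longlongrightarrow> 0) (at 0)"
      proof (rule Lim_transform_eventually)
        show "\<forall>\<^sub>F h in at 0. norm (G (z + h *\<^sub>R v) - G z - h *\<^sub>R G' z) / norm h
            = norm ((G (z + h *\<^sub>R v) - G z) /\<^sub>R h - G' z)"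
        proof -
          have *: "norm (G (z + h *\<^sub>R v) - G z - h *\<^sub>R G' z) / norm h
            = norm ((G (z + h *\<^sub>R v) - G z) /\<^sub>R h - G' z)" if h: "h \<noteq> 0" for h
          proof -
          have "(G (z + h *\<^sub>R v) - G z) /\<^sub>R h - G' z = (G (z + h *\<^sub>R v) - G z - h *\<^sub>R G' z) /\<^sub>R h"
            using h by (simp add: scaleR_diff_right)
          thus "norm (G (z + h *\<^sub>R v) - G z - h *\<^sub>R G' z) / norm h
            = norm ((G (z + h *\<^sub>R v) - G z) /\<^sub>R h - G' z)"
            by (simp add: divide_inverse mult.commute)
          qed
          show ?thesis unfolding eventually_at_filter by (rule always_eventually) (intro allI impI *)
        qed
      qed
      thus ?thesis unfolding tendsto_norm_zero_iff by (rule LIM_zero_cancel)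
    qed
    moreover have "filterlim \<delta> (at 0) sequentially"
      unfolding filterlim_at
      using dlim dpos by (auto intro!: always_eventually simp: less_imp_neq[OF dpos, symmetric])
    ultimately show ?thesis unfolding D_def by (rule filterlim_compose)
  qed
  \<comment> \<open>\<open>G'\<close> is not assumed continuous; it inherits measurability as the
    pointwise limit of the difference quotients \<open>D n\<close>.\<close>
  have G'm [measurable]: "G' \<in> borel_measurable borel"
    by (rule borel_measurable_LIMSEQ_metric[OF Dm Dlim])
  have der': "((\<lambda>t. G (z + t *\<^sub>R v)) has_vector_derivative G' (z + t *\<^sub>R v)) (at t within S)" for z t S
  proof -
    have "((\<lambda>u. G ((z + t *\<^sub>R v) + u *\<^sub>R v)) has_vector_derivative G' (z + t *\<^sub>R v)) (at (t - t))"
      using der[of "z + t *\<^sub>R v"] by simp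
    hence "(((\<lambda>u. G ((z + t *\<^sub>R v) + u *\<^sub>R v)) \<circ> (\<lambda>u. u - t)) has_vector_derivative (1 *\<^sub>R G' (z + t *\<^sub>R v))) (at t)"
      by (intro vector_diff_chain_at) (auto intro!: derivative_eq_intros)
    thus ?thesis by (auto simp: o_def algebra_simps intro: has_vector_derivative_at_within)
  qed
  \<comment> \<open>The mean value inequality along the segment turns the bound on \<open>G'\<close>
    into one on all difference quotients, which is the majorant for dominated convergence.\<close>
  have lip: "norm (G (z + t *\<^sub>R v) - G z) \<le> C * t" if "t > 0" for z t
  proof -
    have "norm (G (z + t *\<^sub>R v) - G (z + 0 *\<^sub>R v)) \<le> C * norm (t - 0)"
    proof (rule differentiable_bound[where S="{0..t}" and f'="\<lambda>x h. h *\<^sub>R G' (z + x *\<^sub>R v)"])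
      show "((\<lambda>t. G (z + t *\<^sub>R v)) has_derivative (\<lambda>h. h *\<^sub>R G' (z + x *\<^sub>R v))) (at x within {0..t})" for x
        using der'[of z x "{0..t}"] by (simp add: has_vector_derivative_def)
      show "onorm (\<lambda>h. h *\<^sub>R G' (z + x *\<^sub>R v)) \<le> C" for x
      proof (rule onorm_le)
        fix h :: real
        show "norm (h *\<^sub>R G' (z + x *\<^sub>R v)) \<le> C * norm h"
          using mult_right_mono[OF bd[of "z + x *\<^sub>R v"], of "norm h"] by (simp add: mult.commute)
      qed
    qed (use that in auto)
    thus ?thesis using that by simp
  qed
  have C0: "C \<ge> 0" using bd order_trans norm_ge_zero by blast
  have Dbd: "norm (D n z) \<le> C" for n z
    using lip[OF dpos, of z n] dpos[of n] by (simp add: D_def divide_simps mult.commute)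
  define R' where "R' = R + norm v"
  have D0: "D n z = 0" if "norm z > R'" for n z
  proof -
    have "norm (z + \<delta> n *\<^sub>R v) \<ge> norm z - norm (\<delta> n *\<^sub>R v)"
      using norm_triangle_ineq4[of "z + \<delta> n *\<^sub>R v" "\<delta> n *\<^sub>R v"] by simp
    moreover have "norm (\<delta> n *\<^sub>R v) \<le> norm v"
      using dle[of n] dpos[of n] by (simp add: mult_left_le_one_le)
    ultimately have "norm (z + \<delta> n *\<^sub>R v) > R" "norm z > R" using that norm_ge_zero[of v] unfolding R'_def by linarith+
    thus ?thesis by (simp add: D_def supp)
  qed
  have Glip: "norm (G z) \<le> B" if "B = Sup ((\<lambda>z. norm (G z)) ` cball 0 \<bar>R\<bar>)" for z B
  proof -
    have "compact ((\<lambda>z. norm (G z)) ` cball 0 \<bar>R\<bar>)"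
      by (intro compact_continuous_image continuous_intros continuous_on_subset[OF cont]) auto
    hence bdd: "bdd_above ((\<lambda>z. norm (G z)) ` cball 0 \<bar>R\<bar>)"
      by (intro bounded_imp_bdd_above compact_imp_bounded)
    show ?thesis
    proof (cases "norm z > \<bar>R\<bar>")
      case True
      have "norm (G 0) \<le> B" unfolding that by (rule cSup_upper) (use bdd in auto)
      moreover have "G z = 0" using True by (intro supp) auto
      ultimately show ?thesis using norm_ge_zero[of "G 0"] by (simp del: norm_ge_zero)
    next
      case False
      thus ?thesis unfolding that by (intro cSup_upper) (use bdd in auto)
    qed
  qed
  have Gint: "integrable lborel G"
    by (rule integrable_bounded_support[OF _ Glip[OF refl] supp]) auto
  have tr: "distr lborel borel ((+) w) = (lborel :: 'a measure)" for w by (rule lborel_distr_plus)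
  have Gt: "integrable lborel (\<lambda>z. G (z + w))" "(\<integral>z. G (z + w) \<partial>lborel) = (\<integral>z. G z \<partial>lborel)" for w
  proof -
    have "integrable (distr lborel borel ((+) w)) G" using Gint tr by simp
    thus "integrable lborel (\<lambda>z. G (z + w))"
      by (subst (asm) integrable_distr_eq) (auto simp: add.commute)
    have "(\<integral>z. G z \<partial>lborel) = (\<integral>z. G z \<partial>(distr lborel borel ((+) w)))" by (simp add: tr)
    also have "\<dots> = (\<integral>z. G (z + w) \<partial>lborel)"
      by (subst integral_distr) (auto simp: add.commute)
    finally show "(\<integral>z. G (z + w) \<partial>lborel) = (\<integral>z. G z \<partial>lborel)" ..
  qed
  have "(\<integral>z. D n z \<partial>lborel) = 0" for n
    unfolding D_def using Gt Gint by (simp)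
  moreover have "(\<lambda>n. \<integral>z. D n z \<partial>lborel) \<longlonglongrightarrow> (\<integral>z. G' z \<partial>lborel)"
  proof (rule integral_dominated_convergence[where w="\<lambda>z. C * indicator (cball 0 R') z"])
    have "emeasure lborel (cball (0::'a) R') < \<infinity>"
      by (rule emeasure_bounded_finite) simp
    thus "integrable lborel (\<lambda>z::'a. C * indicator (cball 0 R') z)"
      by (intro integrable_mult_right integrable_real_indicator) auto
    show "AE z in lborel. norm (D n z) \<le> C * indicator (cball 0 R') z" for n
      using Dbd D0 C0 by (intro AE_I2) (force simp: indicator_def)
  qed (use Dlim in auto)
  ultimately show ?thesis using LIMSEQ_unique by (auto simp: LIMSEQ_const_iff)
qed

section \<open>Integrals depending holomorphically on a parameter\<close>

text \<open>A locally uniform integrable majorant of \<open>f\<close> is enough: Cauchy's inequality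
  on a smaller disc turns it into a majorant of the derivative in the parameter, hence of the
  difference quotients, and dominated convergence applies.\<close>

lemma holomorphic_on_integral:
  fixes f :: "complex \<Rightarrow> 'a \<Rightarrow> complex"
  assumes S: "open S"
    and meas: "\<And>s. s \<in> S \<Longrightarrow> f s \<in> borel_measurable M"
    and hol: "\<And>x. x \<in> space M \<Longrightarrow> (\<lambda>s. f s x) holomorphic_on S"
    and dom: "\<And>s. s \<in> S \<Longrightarrow> \<exists>r>0. \<exists>g. integrable M g \<and> (AE x in M. \<forall>t\<in>ball s r \<inter> S. norm (f t x) \<le> g x)"
  shows "(\<lambda>s. \<integral>x. f s x \<partial>M) holomorphic_on S"
proof -
  have "\<exists>D. ((\<lambda>s. \<integral>x. f s x \<partial>M) has_field_derivative D) (at s)" if s: "s \<in> S" for s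
  proof -
    obtain r g where r: "r > 0" and g: "integrable M g"
      and AE: "AE x in M. \<forall>t\<in>ball s r \<inter> S. norm (f t x) \<le> g x" using dom[OF s] by blast
    obtain r' where r': "r' > 0" "ball s r' \<subseteq> S" using S s openE by blast
    \<comment> \<open>Half the available radius: a point of \<open>ball s \<rho>\<close> is the
      centre of discs of any radius below \<open>\<rho>\<close> inside
      \<open>ball s (2 * \<rho>)\<close>, where the majorant holds.\<close>
    define \<rho> where "\<rho> = min r r' / 2"
    have \<rho>: "\<rho> > 0" using r r' by (simp add: \<rho>_def)
    have sub: "ball s (2 * \<rho>) \<subseteq> ball s r \<inter> S" using r' by (auto simp: \<rho>_def)
    have int: "integrable M (f t)" if "t \<in> ball s (2 * \<rho>)" for t
    proof (rule Bochner_Integration.integrable_bound[OF g])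
      have t: "t \<in> ball s r \<inter> S" using that sub by blast
      show "f t \<in> borel_measurable M" using meas t by blast
      show "AE x in M. norm (f t x) \<le> norm (g x)"
        using AE by eventually_elim (use t in \<open>auto intro: order_trans[OF _ abs_ge_self]\<close>)
    qed
    define f' where "f' x = deriv (\<lambda>s. f s x) s" for x
    have lip: "AE x in M. \<forall>t\<in>ball s \<rho>. norm (f t x - f s x) \<le> g x / \<rho> * norm (t - s)"
      using AE AE_space
    proof eventually_elim
      case (elim x)
      show ?case
      proof
        fix t assume t: "t \<in> ball s \<rho>"
        have holx: "(\<lambda>s. f s x) holomorphic_on ball s (2 * \<rho>)"
          using hol[OF elim(2)] sub by (blast intro: holomorphic_on_subset)
        show "norm (f t x - f s x) \<le> g x / \<rho> * norm (t - s)"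
        proof (rule field_differentiable_bound[of "ball s \<rho>" "\<lambda>s. f s x" "deriv (\<lambda>s. f s x)"])
          fix z assume z: "z \<in> ball s \<rho>"
          have zz: "cball z (\<rho>' ) \<subseteq> ball s (2*\<rho>)" if "\<rho>' < \<rho>" for \<rho>'
            using z that dist_triangle[of s _ z] by (auto simp: dist_commute) (smt (verit) dist_triangle dist_commute)
          show "((\<lambda>s. f s x) has_field_derivative deriv (\<lambda>s. f s x) z) (at z within ball s \<rho>)"
          proof -
            have "z \<in> ball s (2 * \<rho>)" using z \<rho> by auto
            thus ?thesis
              using holomorphic_derivI[OF holx, of z] by (auto intro: has_field_derivative_at_within)
          qed
          have zs: "ball z \<rho> \<subseteq> ball s (2*\<rho>)"
            using z by (auto) (smt (verit) dist_triangle dist_commute)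
          have "norm ((deriv ^^ 1) (\<lambda>s. f s x) z) \<le> fact 1 * g x / \<rho>' ^ 1" if "0 < \<rho>'" "\<rho>' < \<rho>" for \<rho>'
          proof (rule Cauchy_inequality)
            show "(\<lambda>s. f s x) holomorphic_on ball z \<rho>'"
              by (rule holomorphic_on_subset[OF holx]) (use zz[OF that(2)] in force)
            show "continuous_on (cball z \<rho>') (\<lambda>s. f s x)"
              by (rule holomorphic_on_imp_continuous_on, rule holomorphic_on_subset[OF holx zz[OF that(2)]])
            fix w assume "norm (z - w) = \<rho>'"
            hence "w \<in> cball z \<rho>'" by (simp add: dist_norm)
            thus "norm (f w x) \<le> g x" using elim(1) sub zz[OF that(2)] by blast
          qed (use that in auto)
          hence *: "norm (deriv (\<lambda>s. f s x) z) * \<rho>' \<le> g x" if "0 < \<rho>'" "\<rho>' < \<rho>" for \<rho>'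
            using that by (force simp: field_simps)
          have "norm (deriv (\<lambda>s. f s x) z) * \<rho> \<le> g x"
          proof (rule tendsto_upperbound)
            show "((\<lambda>\<rho>'. norm (deriv (\<lambda>s. f s x) z) * \<rho>') \<longlongrightarrow> norm (deriv (\<lambda>s. f s x) z) * \<rho>) (at_left \<rho>)"
              by (intro tendsto_intros)
            show "\<forall>\<^sub>F \<rho>' in at_left \<rho>. norm (deriv (\<lambda>s. f s x) z) * \<rho>' \<le> g x"
              using eventually_at_left_real[OF \<rho>] by eventually_elim (use * in auto)
          qed auto
          thus "norm (deriv (\<lambda>s. f s x) z) \<le> g x / \<rho>" using \<rho> by (simp add: field_simps)
        qed (use t \<rho> in auto)
      qed
    qed
    have hd: "((\<lambda>s. f s x) has_field_derivative f' x) (at s)" if "x \<in> space M" for x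
      unfolding f'_def using holomorphic_derivI[OF hol[OF that] S s] .
    have "((\<lambda>s. \<integral>x. f s x \<partial>M) has_field_derivative (\<integral>x. f' x \<partial>M)) (at s within ball s \<rho>)"
      unfolding has_field_derivative_iff tendsto_at_iff_sequentially
    proof (intro allI impI)
      fix X :: "nat \<Rightarrow> complex" assume X: "\<forall>i. X i \<in> ball s \<rho> - {s}" "X \<longlonglongrightarrow> s"
      have X2: "X i \<in> ball s (2*\<rho>)" for i using X(1)[rule_format, of i] \<rho> by auto
      have ss: "s \<in> ball s (2*\<rho>)" using \<rho> by simp
      have XS: "X i \<in> S" for i using X2[of i] sub by blast
      have lim: "(\<lambda>i. (f (X i) x - f s x) / (X i - s)) \<longlonglongrightarrow> f' x" if "x \<in> space M" for x
        using hd[OF that] X unfolding has_field_derivative_iff tendsto_at_iff_sequentially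
        by (auto simp: o_def)
      have m: "(\<lambda>x. (f (X i) x - f s x) / (X i - s)) \<in> borel_measurable M" for i
        using meas[OF XS] meas[OF s] by measurable
      have "(\<lambda>i. \<integral>x. (f (X i) x - f s x) / (X i - s) \<partial>M) \<longlonglongrightarrow> (\<integral>x. f' x \<partial>M)"
      proof (rule integral_dominated_convergence[where w="\<lambda>x. g x / \<rho>"])
        show "f' \<in> borel_measurable M" by (rule borel_measurable_LIMSEQ_metric[OF m lim])
        show "AE x in M. (\<lambda>i. (f (X i) x - f s x) / (X i - s)) \<longlonglongrightarrow> f' x" using lim by simp
        show "AE x in M. norm ((f (X i) x - f s x) / (X i - s)) \<le> g x / \<rho>" for i
          using lip
        proof eventually_elim
          case (elim x)
          have "X i \<in> ball s \<rho>" "X i - s \<noteq> 0" using X(1) by auto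
          thus ?case using elim by (auto simp: norm_divide divide_simps)
        qed
      qed (use g m in auto)
      moreover have "(\<integral>x. (f (X i) x - f s x) / (X i - s) \<partial>M) = ((\<integral>x. f (X i) x \<partial>M) - (\<integral>x. f s x \<partial>M)) / (X i - s)" for i
        using Bochner_Integration.integral_diff[OF int[OF X2[of i]] int[OF ss]] by (simp del: Bochner_Integration.integral_diff)
      ultimately show "((\<lambda>y. ((\<integral>x. f y x \<partial>M) - (\<integral>x. f s x \<partial>M)) / (y - s)) \<circ> X) \<longlonglongrightarrow> (\<integral>x. f' x \<partial>M)"
        by (simp only: o_def)
    qed
    thus ?thesis using \<rho> by (auto simp: at_within_open[of s "ball s \<rho>"])
  qed
  thus ?thesis using S by (auto simp: holomorphic_on_open)
qed

section \<open>Iterated integration over the two complex coordinates\<close>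

definition vec2 :: "complex \<Rightarrow> complex \<Rightarrow> complex^2" where
  "vec2 x y = (\<chi> i. if i = 1 then x else y)"

lemma vec2_nth [simp]: "vec2 x y $ 1 = x" "vec2 x y $ 2 = y"
  by (simp_all add: vec2_def)

lemma vec2_measurable [measurable]: "(\<lambda>(x, y). vec2 x y) \<in> borel_measurable (lborel \<Otimes>\<^sub>M lborel)"
proof -
  have "continuous_on UNIV (\<lambda>p. vec2 (fst p) (snd p))"
    unfolding vec2_def
  proof (rule continuous_on_vec_lambda)
    fix i :: 2
    show "continuous_on UNIV (\<lambda>p::complex \<times> complex. if i = 1 then fst p else snd p)"
      by (cases "i = 1") (auto intro!: continuous_intros)
  qed
  hence "(\<lambda>p. vec2 (fst p) (snd p)) \<in> borel_measurable borel" by (rule borel_measurable_continuous_onI)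
  thus ?thesis by (simp add: lborel_prod split_def)
qed

lemma Basis_complex2: "(Basis :: (complex^2) set) = {axis 1 1, axis 1 \<i>, axis 2 1, axis 2 \<i>}"
  by (auto simp: Basis_vec_def Basis_complex_def UNIV_2)

text \<open>Lebesgue measure is determined by its values on boxes, and a box of
  \<open>complex^2\<close> is a product of two rectangles.\<close>

lemma lborel_vec2: "lborel = distr (lborel \<Otimes>\<^sub>M lborel) borel (\<lambda>(x, y). vec2 x y)"
proof (rule lborel_eqI)
  fix l u :: "complex^2" assume lu: "\<And>b. b \<in> Basis \<Longrightarrow> l \<bullet> b \<le> u \<bullet> b"
  have lu': "Re (l$1) \<le> Re (u$1)" "Im (l$1) \<le> Im (u$1)" "Re (l$2) \<le> Re (u$2)" "Im (l$2) \<le> Im (u$2)"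
    using lu[of "axis 1 1"] lu[of "axis 1 \<i>"] lu[of "axis 2 1"] lu[of "axis 2 \<i>"]
    by (simp_all add: Basis_complex2 inner_axis inner_complex_def)
  have pre: "(\<lambda>(x, y). vec2 x y) -` box l u \<inter> space (lborel \<Otimes>\<^sub>M lborel) = box (l$1) (u$1) \<times> box (l$2) (u$2)"
    by (auto simp: box_def Basis_complex2 inner_axis Basis_complex_def space_pair_measure)
  have "emeasure (distr (lborel \<Otimes>\<^sub>M lborel) borel (\<lambda>(x, y). vec2 x y)) (box l u)
     = emeasure lborel (box (l$1) (u$1)) * emeasure lborel (box (l$2) (u$2))"
    by (subst emeasure_distr) (auto simp: pre lborel.emeasure_pair_measure_Times)
  also have "\<dots> = ennreal (\<Prod>b\<in>Basis. (u - l) \<bullet> b)"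
    using lu' by (simp add: emeasure_lborel_box_eq Basis_complex2 inner_axis Basis_complex_def axis_eq_axis
       ennreal_mult[symmetric] mult_ac inner_complex_def complex_eq_iff)
  finally show "emeasure (distr (lborel \<Otimes>\<^sub>M lborel) borel (\<lambda>(x, y). vec2 x y)) (box l u) = (\<Prod>b\<in>Basis. (u - l) \<bullet> b)" .
qed simp

text \<open>Both orders of integration are recorded because the inner variable will have to be one
  on which a given linear form depends.\<close>

lemma nn_integral_vec2:
  assumes [measurable]: "f \<in> borel_measurable borel"
  shows "(\<integral>\<^sup>+z. f z \<partial>lborel) = (\<integral>\<^sup>+x. \<integral>\<^sup>+y. f (vec2 x y) \<partial>lborel \<partial>lborel)"
    and "(\<integral>\<^sup>+z. f z \<partial>lborel) = (\<integral>\<^sup>+y. \<integral>\<^sup>+x. f (vec2 x y) \<partial>lborel \<partial>lborel)"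
proof -
  have 1: "(\<integral>\<^sup>+z. f z \<partial>lborel) = (\<integral>\<^sup>+p. f ((\<lambda>(x, y). vec2 x y) p) \<partial>(lborel \<Otimes>\<^sub>M lborel))"
    by (subst lborel_vec2, subst nn_integral_distr) auto
  have m: "(\<lambda>p. f ((\<lambda>(x, y). vec2 x y) p)) \<in> borel_measurable (lborel \<Otimes>\<^sub>M lborel)" by measurable
  show "(\<integral>\<^sup>+z. f z \<partial>lborel) = (\<integral>\<^sup>+x. \<integral>\<^sup>+y. f (vec2 x y) \<partial>lborel \<partial>lborel)"
    unfolding 1 using lborel.nn_integral_fst[OF m] by simp
  show "(\<integral>\<^sup>+z. f z \<partial>lborel) = (\<integral>\<^sup>+y. \<integral>\<^sup>+x. f (vec2 x y) \<partial>lborel \<partial>lborel)"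
    unfolding 1 using lborel_pair.nn_integral_snd[OF m[unfolded split_def]] by (simp add: split_def)
qed

section \<open>Local integrability of negative powers\<close>

lemma nn_integral_powr_interval:
  assumes "e < 1"
  shows "(\<integral>\<^sup>+x. indicator {-1..1} x * ennreal (\<bar>x\<bar> powr - e) \<partial>lborel) < \<infinity>"
proof -
  have "((\<lambda>x. x powr - e) has_integral (1 powr (- e + 1) / (- e + 1))) {0..1}"
    by (rule has_integral_powr_from_0) (use assms in auto)
  hence "((\<lambda>x. \<bar>x\<bar> powr - e) has_integral (1 powr (- e + 1) / (- e + 1))) {0..1}"
    by (rule has_integral_eq[rotated]) auto
  hence "((\<lambda>x. if x \<in> {0..1} then \<bar>x\<bar> powr - e else 0) has_integral (1 powr (- e + 1) / (- e + 1))) UNIV"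
    by (simp only: has_integral_restrict_UNIV)
  hence "(\<integral>\<^sup>+x. ennreal (if x \<in> {0..1} then \<bar>x\<bar> powr - e else 0) \<partial>lborel) = ennreal (1 powr (- e + 1) / (- e + 1))"
    by (rule nn_integral_has_integral_lborel[rotated 2]) auto
  moreover have "ennreal (if x \<in> {0..1} then \<bar>x\<bar> powr - e else 0) = indicator {0..1} x * ennreal (\<bar>x\<bar> powr - e)" for x
    by (simp add: indicator_def)
  ultimately have 1: "(\<integral>\<^sup>+x. indicator {0..1} x * ennreal (\<bar>x\<bar> powr - e) \<partial>lborel) = ennreal (1 powr (- e + 1) / (- e + 1))"
    by simp
  have 2: "(\<integral>\<^sup>+x. indicator {-1..0} x * ennreal (\<bar>x\<bar> powr - e) \<partial>lborel) = (\<integral>\<^sup>+x. indicator {0..1} x * ennreal (\<bar>x\<bar> powr - e) \<partial>lborel)"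
    by (subst nn_integral_real_affine[where c="-1" and t=0])
      (auto intro!: nn_integral_cong simp: indicator_def)
  have "(\<integral>\<^sup>+x. indicator {-1..1} x * ennreal (\<bar>x\<bar> powr - e) \<partial>lborel) \<le>
     (\<integral>\<^sup>+x. indicator {-1..0} x * ennreal (\<bar>x\<bar> powr - e) + indicator {0..1} x * ennreal (\<bar>x\<bar> powr - e) \<partial>lborel)"
    by (intro nn_integral_mono) (auto simp: indicator_def)
  also have "\<dots> = (\<integral>\<^sup>+x. indicator {-1..0} x * ennreal (\<bar>x\<bar> powr - e) \<partial>lborel) + (\<integral>\<^sup>+x. indicator {0..1} x * ennreal (\<bar>x\<bar> powr - e) \<partial>lborel)"
    by (rule nn_integral_add) auto
  also have "\<dots> < \<infinity>" unfolding 2 1 by simp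
  finally show ?thesis .
qed

text \<open>Instead of polar coordinates: \<open>cmod w ^ 2\<close> is at least the product of the
  absolute values of the real and imaginary parts, so the integrand is dominated by a product of two
  functions of one real variable with exponent \<open>c/2 < 1\<close>.\<close>

lemma nn_integral_complex_powr:
  assumes c: "0 \<le> c" "c < 2"
  shows "(\<integral>\<^sup>+w. indicator (cball 0 1) w * ennreal (cmod w powr - c) \<partial>lborel) < \<infinity>"
proof -
  \<comment> \<open>The value \<open>top\<close> at 0 makes the product bound hold on the coordinate
    axes too, where \<open>0 powr _ = 0\<close> would break it; a single point does not change the
    integral.\<close>
  define h :: "real \<Rightarrow> ennreal" where
    "h x = (if x = 0 then top else indicator {-1..1} x * ennreal (\<bar>x\<bar> powr - (c/2)))" for x
  have [measurable]: "h \<in> borel_measurable borel" unfolding h_def by measurable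
  have "(\<integral>\<^sup>+x. h x \<partial>lborel) = (\<integral>\<^sup>+x. indicator {-1..1} x * ennreal (\<bar>x\<bar> powr - (c/2)) \<partial>lborel)"
    by (intro nn_integral_cong_AE AE_I[where N="{0}"]) (auto simp: h_def)
  also have "\<dots> < \<infinity>" by (rule nn_integral_powr_interval) (use c in auto)
  finally have h: "(\<integral>\<^sup>+x. h x \<partial>lborel) < \<infinity>" .
  have "indicator (cball 0 1) w * ennreal (cmod w powr - c) \<le> (\<Prod>b\<in>Basis. h (w \<bullet> b))" for w :: complex
  proof (cases "w \<in> cball 0 1")
    case True
    hence w1: "\<bar>Re w\<bar> \<le> 1" "\<bar>Im w\<bar> \<le> 1"
      using abs_Re_le_cmod[of w] abs_Im_le_cmod[of w] by auto
    have hp: "h x > 0" if "\<bar>x\<bar> \<le> 1" for x using that by (auto simp: h_def indicator_def zero_less_iff_neq_zero)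
    have "ennreal (cmod w powr - c) \<le> h (Re w) * h (Im w)"
    proof (cases "Re w = 0 \<or> Im w = 0")
      case True
      hence "h (Re w) * h (Im w) = top" using hp[OF w1(1)] hp[OF w1(2)]
        by (auto simp: h_def[of 0] ennreal_top_mult ennreal_mult_top)
      thus ?thesis by simp
    next
      case False
      have "2 * (\<bar>Re w\<bar> * \<bar>Im w\<bar>) \<le> (cmod w)\<^sup>2"
        using sum_squares_bound[of "\<bar>Re w\<bar>" "\<bar>Im w\<bar>"] by (simp add: cmod_power2)
      hence le: "\<bar>Re w\<bar> * \<bar>Im w\<bar> \<le> (cmod w)\<^sup>2" using mult_nonneg_nonneg[of "\<bar>Re w\<bar>" "\<bar>Im w\<bar>"] by linarith
      have pos: "\<bar>Re w\<bar> * \<bar>Im w\<bar> > 0" using False by simp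
      have "cmod w powr - c = ((cmod w)\<^sup>2) powr - (c/2)"
        using False by (simp add: powr_powr flip: powr_numeral)
      also have "\<dots> \<le> (\<bar>Re w\<bar> * \<bar>Im w\<bar>) powr - (c/2)"
        using le pos c by (intro powr_mono2') auto
      finally show ?thesis using False w1
        by (simp add: h_def indicator_def powr_mult ennreal_mult[symmetric] abs_le_iff ennreal_leI)
    qed
    thus ?thesis using True by (simp add: Basis_complex_def)
  qed auto
  note le = this
  have "(\<integral>\<^sup>+w. indicator (cball 0 1) w * ennreal (cmod w powr - c) \<partial>lborel) \<le> (\<integral>\<^sup>+(w::complex). (\<Prod>b\<in>Basis. h (w \<bullet> b)) \<partial>lborel)"
    by (intro nn_integral_mono le)
  also have "\<dots> = (\<Prod>b\<in>(Basis::complex set). (\<integral>\<^sup>+x. h x \<partial>lborel))"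
    by (rule nn_integral_lborel_prod) auto
  also have "\<dots> < \<infinity>" using h by (simp add: Basis_complex_def ennreal_mult_less_top)
  finally show ?thesis .
qed

lemma cball_borel [measurable]: "cball a r \<in> sets borel"
  by (simp add: borel_closed)

text \<open>The uniformity in \<open>k\<close> is the point: in an iterated integral the zero of a
  linear form in the inner variable moves with the outer variable.\<close>

lemma nn_integral_complex_powr_translate:
  assumes c: "0 \<le> c" "c < 2"
  shows "\<exists>K<\<infinity>. \<forall>k. (\<integral>\<^sup>+w. indicator (cball 0 R) w * ennreal (cmod (w + k) powr - c) \<partial>lborel) \<le> K"
proof -
  define J where "J = (\<integral>\<^sup>+w. indicator (cball 0 1) w * ennreal (cmod w powr - c) \<partial>lborel)"
  define K where "K = J + emeasure lborel (cball (0::complex) R)"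
  have "K < \<infinity>" using nn_integral_complex_powr[OF c] emeasure_bounded_finite[of "cball (0::complex) R"]
    by (simp add: K_def J_def)
  moreover have "(\<integral>\<^sup>+w. indicator (cball 0 R) w * ennreal (cmod (w + k) powr - c) \<partial>lborel) \<le> K" for k
  proof -
    have "indicator (cball 0 R) w * ennreal (cmod (w + k) powr - c)
      \<le> indicator (cball 0 1) (k + w) * ennreal (cmod (k + w) powr - c) + indicator (cball 0 R) w" for w
    proof (cases "cmod (w + k) \<le> 1")
      case True thus ?thesis by (auto simp: indicator_def add.commute)
    next
      case False
      hence "cmod (w + k) powr - c \<le> 1 powr - c" using c by (intro powr_mono2') auto
      thus ?thesis using False by (auto simp: indicator_def add.commute)
    qed
    hence "(\<integral>\<^sup>+w. indicator (cball 0 R) w * ennreal (cmod (w + k) powr - c) \<partial>lborel) \<le>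
       (\<integral>\<^sup>+w. indicator (cball 0 1) (k + w) * ennreal (cmod (k + w) powr - c) + indicator (cball 0 R) w \<partial>lborel)"
      by (intro nn_integral_mono)
    also have "\<dots> = (\<integral>\<^sup>+w. indicator (cball 0 1) (k + w) * ennreal (cmod (k + w) powr - c) \<partial>lborel) + emeasure lborel (cball (0::complex) R)"
      by (subst nn_integral_add) auto
    also have "(\<integral>\<^sup>+w. indicator (cball 0 1) (k + w) * ennreal (cmod (k + w) powr - c) \<partial>lborel) =
       (\<integral>\<^sup>+w. indicator (cball 0 1) w * ennreal (cmod w powr - c) \<partial>(distr lborel borel ((+) k)))"
      by (subst nn_integral_distr) auto
    also have "\<dots> = J" by (simp add: lborel_distr_plus J_def)
    finally show ?thesis by (simp add: K_def)
  qed
  ultimately show ?thesis by blast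
qed

definition lform :: "complex^2 \<Rightarrow> complex^2 \<Rightarrow> complex" where
  "lform c z = c $ 1 * z $ 1 + c $ 2 * z $ 2"

lemma continuous_on_lform [continuous_intros]: "continuous_on S g \<Longrightarrow> continuous_on S (\<lambda>x. lform c (g x))"
  unfolding lform_def by (intro continuous_intros continuous_on_component)

lemma lform_measurable [measurable]: "lform c \<in> borel_measurable borel"
  by (rule borel_measurable_continuous_onI) (intro continuous_intros)

lemma norm_nth_le_vec: "cmod (z $ i) \<le> norm (z :: complex^2)"
  by (rule Finite_Cartesian_Product.norm_nth_le)

lemma lform_bound: "cmod (lform c z) \<le> (cmod (c $ 1) + cmod (c $ 2)) * norm z"
proof -
  have "cmod (lform c z) \<le> cmod (c $ 1) * cmod (z $ 1) + cmod (c $ 2) * cmod (z $ 2)"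
    unfolding lform_def by (metis norm_mult norm_triangle_ineq)
  also have "\<dots> \<le> cmod (c $ 1) * norm z + cmod (c $ 2) * norm z"
    by (intro add_mono mult_left_mono norm_nth_le_vec) auto
  finally show ?thesis by (simp add: algebra_simps)
qed

lemma vec2_eq_iff: "(z :: complex^2) = w \<longleftrightarrow> z $ 1 = w $ 1 \<and> z $ 2 = w $ 2"
  by (auto simp: vec_eq_iff forall_2)

text \<open>Splitting the exponents as \<open>x + y = min x m + max y m\<close> with \<open>m = (x + y) / 2 < 2\<close>
  makes both resulting exponents integrable in one complex variable.\<close>

lemma nn_integral_lform_powr:
  assumes c: "c \<noteq> 0" and x: "0 \<le> x" and y: "0 \<le> y" "y < 2" and xy: "x + y < 4"
  shows "(\<integral>\<^sup>+z. indicator (cball 0 R) z * ennreal (norm z powr - x * cmod (lform c z) powr - y) \<partial>lborel) < \<infinity>"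
proof -
  define x' where "x' = min x ((x + y) / 2)"
  define y' where "y' = max y ((x + y) / 2)"
  define M where "M = cmod (c $ 1) + cmod (c $ 2)"
  have M: "M > 0" using c by (auto simp: M_def vec2_eq_iff) (smt (verit) norm_ge_zero zero_less_norm_iff)+
  have xy': "0 \<le> x'" "x' < 2" "x' \<le> x" "0 \<le> y'" "y' < 2" "x + y = x' + y'"
    using x y xy by (auto simp: x'_def y'_def min_def max_def)
  \<comment> \<open>The power of \<open>norm z\<close> is split: the part \<open>x'\<close> is
    estimated by a coordinate, the remaining \<open>x - x'\<close> by the linear form, which is at
    most \<open>M * norm z\<close>. This moves the excess exponent from the origin to the
    line.\<close>
  have bnd: "norm z powr - x * cmod (lform c z) powr - y \<le> M powr (x - x') * (cmod (z $ i) powr - x' * cmod (lform c z) powr - y')"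
    if zi: "z $ i \<noteq> 0" for z :: "complex^2" and i
  proof (cases "lform c z = 0")
    case False
    have zn: "norm z \<ge> cmod (z $ i)" "cmod (z $ i) > 0" using norm_nth_le_vec zi by auto
    have "norm z powr - x = norm z powr - x' * norm z powr - (x - x')"
      using zn by (simp flip: powr_add)
    also have "\<dots> \<le> cmod (z $ i) powr - x' * (cmod (lform c z) / M) powr - (x - x')"
    proof (intro mult_mono powr_mono2')
      show "cmod (lform c z) / M \<le> norm z" using lform_bound[of c z] M by (simp add: M_def[symmetric] field_simps)
    qed (use zn False M xy' in auto)
    finally have "norm z powr - x * cmod (lform c z) powr - y \<le>
       cmod (z $ i) powr - x' * (cmod (lform c z) / M) powr - (x - x') * cmod (lform c z) powr - y"
      by (intro mult_right_mono) auto
    also have "(cmod (lform c z) / M) powr - (x - x') = M powr (x - x') * cmod (lform c z) powr - (x - x')"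
      using M False by (subst powr_divide) (auto simp: powr_minus divide_simps simp flip: powr_add)
    also have "cmod (z $ i) powr - x' * (M powr (x - x') * cmod (lform c z) powr - (x - x')) * cmod (lform c z) powr - y
       = M powr (x - x') * (cmod (z $ i) powr - x' * (cmod (lform c z) powr - (x - x') * cmod (lform c z) powr - y))"
      by (simp add: mult_ac)
    also have "cmod (lform c z) powr - (x - x') * cmod (lform c z) powr - y = cmod (lform c z) powr - y'"
    proof -
      have "- (x - x') + - y = - y'" using xy' by simp
      thus ?thesis by (metis powr_add)
    qed
    finally show ?thesis .
  qed simp
  obtain K where K: "K < \<infinity>" "\<And>k. (\<integral>\<^sup>+w. indicator (cball 0 R) w * ennreal (cmod (w + k) powr - y') \<partial>lborel) \<le> K"
    using nn_integral_complex_powr_translate[OF xy'(4,5)] by blast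
  obtain K' where K': "K' < \<infinity>" "(\<integral>\<^sup>+w. indicator (cball 0 R) w * ennreal (cmod (w + 0) powr - x') \<partial>lborel) \<le> K'"
    using nn_integral_complex_powr_translate[OF xy'(1,2)] by blast
  \<comment> \<open>Written for an abstract ordering \<open>g\<close> of the coordinates;
    \<open>q\<close> is the coefficient of the inner variable \<open>w\<close> and must not vanish,
    which decides between the two orders of integration.\<close>
  have core: "(\<integral>\<^sup>+v. \<integral>\<^sup>+w. indicator (cball 0 R) (g v w) * ennreal (norm (g v w) powr - x * cmod (lform c (g v w)) powr - y) \<partial>lborel \<partial>lborel) < \<infinity>"
    if g: "\<And>v w. g v w $ i = v" "\<And>v w. g v w $ j = w" "\<And>v w. lform c (g v w) = p * v + q * w" and q: "q \<noteq> 0"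
    for g :: "complex \<Rightarrow> complex \<Rightarrow> complex^2" and i j p q
  proof -
    define C where "C = ennreal (M powr (x - x') * cmod q powr - y')"
    have "(\<integral>\<^sup>+w. indicator (cball 0 R) (g v w) * ennreal (norm (g v w) powr - x * cmod (lform c (g v w)) powr - y) \<partial>lborel)
       \<le> C * K * (indicator (cball 0 R) v * ennreal (cmod v powr - x'))" if v: "v \<noteq> 0" for v
    proof -
      have "indicator (cball 0 R) (g v w) * ennreal (norm (g v w) powr - x * cmod (lform c (g v w)) powr - y) \<le>
        C * (indicator (cball 0 R) v * ennreal (cmod v powr - x')) * (indicator (cball 0 R) w * ennreal (cmod (w + p * v / q) powr - y'))" for w
      proof (cases "g v w \<in> cball 0 R")
        case True
        hence R: "v \<in> cball 0 R" "w \<in> cball 0 R"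
          using norm_nth_le_vec[of "g v w" i] norm_nth_le_vec[of "g v w" j] g by auto
        have "lform c (g v w) = q * (w + p * v / q)" using q by (simp add: g field_simps)
        hence "cmod (lform c (g v w)) powr - y' = cmod q powr - y' * cmod (w + p * v / q) powr - y'"
          by (simp add: norm_mult powr_mult)
        hence "norm (g v w) powr - x * cmod (lform c (g v w)) powr - y \<le> M powr (x - x') * cmod q powr - y' * cmod v powr - x' * cmod (w + p * v / q) powr - y'"
          using bnd[of "g v w" i] v g by (simp add: mult_ac)
        hence "ennreal (norm (g v w) powr - x * cmod (lform c (g v w)) powr - y) \<le> C * ennreal (cmod v powr - x') * ennreal (cmod (w + p * v / q) powr - y')"
          unfolding C_def by (simp add: ennreal_leI flip: ennreal_mult)
        thus ?thesis using R True by simp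
      qed auto
      hence "(\<integral>\<^sup>+w. indicator (cball 0 R) (g v w) * ennreal (norm (g v w) powr - x * cmod (lform c (g v w)) powr - y) \<partial>lborel)
        \<le> (\<integral>\<^sup>+w. C * (indicator (cball 0 R) v * ennreal (cmod v powr - x')) * (indicator (cball 0 R) w * ennreal (cmod (w + p * v / q) powr - y')) \<partial>lborel)"
        by (intro nn_integral_mono)
      also have "\<dots> \<le> C * (indicator (cball 0 R) v * ennreal (cmod v powr - x')) * K"
        by (subst nn_integral_cmult) (auto intro!: mult_left_mono K)
      finally show ?thesis by (simp add: mult_ac)
    qed
    hence "(\<integral>\<^sup>+v. \<integral>\<^sup>+w. indicator (cball 0 R) (g v w) * ennreal (norm (g v w) powr - x * cmod (lform c (g v w)) powr - y) \<partial>lborel \<partial>lborel)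
      \<le> (\<integral>\<^sup>+v. C * K * (indicator (cball 0 R) v * ennreal (cmod v powr - x')) \<partial>lborel)"
      by (intro nn_integral_mono_AE AE_I[where N="{0}"]) auto
    also have "\<dots> = C * K * (\<integral>\<^sup>+v. (indicator (cball 0 R) v * ennreal (cmod v powr - x')) \<partial>lborel)"
      by (subst nn_integral_cmult) auto
    also have "\<dots> < \<infinity>" using K K' by (auto simp: C_def ennreal_mult_less_top intro: le_less_trans)
    finally show ?thesis .
  qed
  show ?thesis
  proof (cases "c $ 2 = 0")
    case False
    show ?thesis by (subst nn_integral_vec2(1), simp, rule core[where i=1 and j=2]) (use False in \<open>auto simp: lform_def\<close>)
  next
    case True
    hence "c $ 1 \<noteq> 0" using c by (auto simp: vec2_eq_iff)
    thus ?thesis by (subst nn_integral_vec2(2), simp, intro core[where i=2 and j=1]) (auto simp: lform_def)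
  qed
qed

section \<open>Homogeneous families of integrands\<close>

text \<open>Since \<open>0 powr t = 0\<close>, this vanishes at \<open>w = 0\<close> also for \<open>Re s \<le> 0\<close>.\<close>

definition abs_pow :: "complex \<Rightarrow> complex \<Rightarrow> complex" where
  "abs_pow w s = of_real (cmod w) powr (2 * s)"

lemma abs_pow_0 [simp]: "abs_pow 0 s = 0" by (simp add: abs_pow_def)

lemma abs_pow_eq_exp: "w \<noteq> 0 \<Longrightarrow> abs_pow w s = exp (2 * s * of_real (ln (cmod w)))"
  by (simp add: abs_pow_def powr_def Ln_of_real)

lemma abs_pow_mult: "abs_pow (x * y) s = abs_pow x s * abs_pow y s"
  by (simp add: abs_pow_def norm_mult powr_times_real)

lemma abs_pow_prod: "abs_pow (\<Prod>i\<in>A. f i) s = (\<Prod>i\<in>A. abs_pow (f i) s)"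
  by (induction A rule: infinite_finite_induct) (auto simp: abs_pow_mult, auto simp: abs_pow_def)

lemma abs_pow_power: "k > 0 \<Longrightarrow> abs_pow (w ^ k) s = abs_pow w (of_nat k * s)"
  by (cases "w = 0") (auto simp: abs_pow_eq_exp norm_power ln_realpow mult_ac power_0_left)

lemma norm_abs_pow: "cmod (abs_pow w s) = cmod w powr (2 * Re s)"
  by (cases "w = 0") (auto simp: abs_pow_eq_exp powr_def norm_exp_eq_Re)

lemma abs_pow_of_real: "abs_pow w (of_real s) = of_real (cmod w powr (2 * s))"
  by (cases "w = 0") (auto simp: abs_pow_eq_exp powr_def simp flip: exp_of_real)

lemma holomorphic_abs_pow [holomorphic_intros]:
  "g holomorphic_on S \<Longrightarrow> (\<lambda>s. abs_pow w (g s)) holomorphic_on S"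
  by (cases "w = 0") (auto simp: abs_pow_eq_exp intro!: holomorphic_intros)

lemma abs_pow_measurable [measurable]:
  assumes [measurable]: "g \<in> borel_measurable M"
  shows "(\<lambda>z. abs_pow (g z) s) \<in> borel_measurable M"
proof -
  have "(\<lambda>z. abs_pow (g z) s) = (\<lambda>z. if g z = 0 then 0 else exp (2 * s * of_real (ln (cmod (g z)))))"
    by (auto simp: abs_pow_eq_exp)
  thus ?thesis by simp
qed

lemma lform_scaleR [simp]: "lform c (t *\<^sub>R z) = of_real t * lform c z"
  by (simp add: lform_def scaleR_conv_of_real[where 'a=complex] algebra_simps)

lemma lform_zero [simp]: "lform c 0 = 0" by (simp add: lform_def)

lemma lform_add: "lform c (z + w) = lform c z + lform c w"
  by (simp add: lform_def algebra_simps)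

lemma abs_pow_of_real_mult: "t > 0 \<Longrightarrow> abs_pow (of_real t * w) s = of_real t powr (2 * s) * abs_pow w s"
  by (simp add: abs_pow_mult) (simp add: abs_pow_def)

text \<open>The kernel is a proper real subspace, hence negligible; being a Borel set, it is then a
  null set of \<open>lborel\<close>.\<close>

lemma AE_lform_nonzero:
  assumes "c \<noteq> 0"
  shows "AE z in lborel. lform c z \<noteq> 0"
proof -
  have lin: "linear (lform c)"
    by (rule linearI) (simp_all add: lform_add scaleR_conv_of_real[where 'a=complex])
  have sub: "subspace {z. lform c z = 0}"
    by (rule subspaceI) (auto simp: lform_add)
  obtain w where w: "lform c w \<noteq> 0"
  proof (cases "c $ 1 = 0")
    case True
    hence "c $ 2 \<noteq> 0" using assms by (auto simp: vec2_eq_iff)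
    hence "lform c (vec2 0 1) \<noteq> 0" by (simp add: lform_def)
    thus ?thesis using that by blast
  next
    case False
    hence "lform c (vec2 1 0) \<noteq> 0" by (simp add: lform_def)
    thus ?thesis using that by blast
  qed
  hence "{z. lform c z = 0} \<noteq> UNIV" by blast
  hence "span {z. lform c z = 0} \<noteq> span UNIV" using sub by (simp add: span_eq_iff[THEN iffD2])
  hence "dim {z. lform c z = 0} \<noteq> DIM(complex^2)"
    using dim_eq_full[of "{z. lform c z = 0}"] by simp
  hence "dim {z. lform c z = 0} < DIM(complex^2)"
    using dim_subset_UNIV[of "{z. lform c z = 0}"] by linarith
  hence "negligible {z. lform c z = 0}" by (rule negligible_lowdim)
  hence "{z. lform c z = 0} \<in> null_sets lebesgue" by (simp add: negligible_iff_null_sets)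
  moreover have "{z. lform c z = 0} \<in> sets lborel" by measurable
  ultimately have "{z. lform c z = 0} \<in> null_sets lborel" by (simp add: null_sets_completion_iff)
  thus ?thesis by (rule AE_I') auto
qed

lemma integrable_lform_powr:
  assumes c: "c \<noteq> 0" and x: "0 \<le> x" and y: "0 \<le> y" "y < 2" and xy: "x + y < 4"
  shows "integrable lborel (\<lambda>z. indicator (cball 0 R) z * (norm z powr - x * cmod (lform c z) powr - y))"
proof (rule integrableI_nonneg)
  have "(\<integral>\<^sup>+z. ennreal (indicator (cball 0 R) z * (norm z powr - x * cmod (lform c z) powr - y)) \<partial>lborel)
     = (\<integral>\<^sup>+z. indicator (cball 0 R) z * ennreal (norm z powr - x * cmod (lform c z) powr - y) \<partial>lborel)"
    by (intro nn_integral_cong) (auto simp: indicator_def)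
  thus "(\<integral>\<^sup>+z. ennreal (indicator (cball 0 R) z * (norm z powr - x * cmod (lform c z) powr - y)) \<partial>lborel) < \<infinity>"
    using nn_integral_lform_powr[OF assms] by simp
qed auto

text \<open>Homogeneity spreads the estimate on the unit sphere: for \<open>norm z \<le> R\<close>
  the integrand is at most a constant times the sum of \<open>norm z powr (2 * d * \<sigma> + y) *
  cmod (lform (l i) z) powr - y\<close>. This is integrable if \<open>y < 2\<close>, for the lines,
  and \<open>- 2 * d * \<sigma> < 4\<close>, for the origin; the latter says
  \<open>\<sigma> > - 2 / d\<close>.\<close>

lemma homogeneous_family_dominated:
  fixes G :: "complex \<Rightarrow> complex^2 \<Rightarrow> complex" and \<phi> :: "complex^2 \<Rightarrow> complex" and d :: real
  assumes d: "d > 0" and I: "finite I" "I \<noteq> {}" "\<And>i. i \<in> I \<Longrightarrow> l i \<noteq> 0"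
    and hom: "\<And>s t z. t > 0 \<Longrightarrow> G s (t *\<^sub>R z) = of_real t powr (2 * of_real d * s) * G s z"
    and bd: "\<exists>r>0. \<exists>C y. 0 \<le> y \<and> y < 2 \<and> (\<forall>t\<in>ball s r. \<forall>z. norm z = 1 \<longrightarrow> (\<forall>i\<in>I. lform (l i) z \<noteq> 0)
              \<longrightarrow> norm (G t z) \<le> C * (\<Sum>i\<in>I. cmod (lform (l i) z) powr - y))"
    and \<phi>: "\<And>z. norm (\<phi> z) \<le> B" "\<And>z. norm z > R \<Longrightarrow> \<phi> z = 0"
    and s: "Re s > - 2 / d"
  shows "\<exists>r>0. \<exists>g. integrable lborel g \<and> (AE z in lborel. \<forall>t\<in>ball s r. norm (G t z * \<phi> z) \<le> g z)"
proof -
  obtain r C y where r: "r > 0" and y: "0 \<le> y" "y < 2"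
    and C: "\<And>t z. t \<in> ball s r \<Longrightarrow> norm z = 1 \<Longrightarrow> (\<forall>i\<in>I. lform (l i) z \<noteq> 0) \<Longrightarrow> norm (G t z) \<le> C * (\<Sum>i\<in>I. cmod (lform (l i) z) powr - y)"
    using bd by blast
  \<comment> \<open>The bound by \<open>- y / (2 * d)\<close> keeps the exponent \<open>x\<close>
    defined below nonnegative.\<close>
  have "- 2 / d < min (Re s) (- y / (2 * d))" using s y d by (auto simp: field_simps)
  then obtain \<sigma> where \<sigma>: "- 2 / d < \<sigma>" "\<sigma> < Re s" "\<sigma> < - y / (2 * d)" by (metis dense min_less_iff_conj)
  define r' where "r' = min r (Re s - \<sigma>)"
  have r': "r' > 0" using r \<sigma> by (simp add: r'_def)
  define x where "x = - (2 * d * \<sigma> + y)"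
  have x: "0 \<le> x" "x + y < 4" using \<sigma> d by (auto simp: x_def field_simps)
  define R1 where "R1 = max R 1"
  \<comment> \<open>The exponent is the largest value of \<open>2 * d * (Re t - \<sigma>)\<close> on
    the ball around \<open>s\<close>; \<open>R1 \<ge> 1\<close> makes the power monotone in its
    exponent.\<close>
  define C' where "C' = R1 powr (2 * d * (2 * (Re s - \<sigma>))) * \<bar>C\<bar> * \<bar>B\<bar>"
  define g where "g z = C' * (\<Sum>i\<in>I. indicator (cball 0 R) z * (norm z powr - x * cmod (lform (l i) z) powr - y))" for z
  have "integrable lborel g" unfolding g_def
    by (intro integrable_mult_right Bochner_Integration.integrable_sum integrable_lform_powr) (use I x y in auto)
  moreover have "AE z in lborel. \<forall>i\<in>I. lform (l i) z \<noteq> 0"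
    using I by (intro AE_finite_allI AE_lform_nonzero) auto
  hence "AE z in lborel. \<forall>t\<in>ball s r'. norm (G t z * \<phi> z) \<le> g z"
  proof eventually_elim
    case (elim z)
    show ?case
    proof
      fix t assume t: "t \<in> ball s r'"
      have z: "norm z > 0" using elim I by auto
      show "norm (G t z * \<phi> z) \<le> g z"
      proof (cases "norm z > R")
        case True thus ?thesis using \<phi>(2)[of z] by (simp add: g_def)
      next
        case False
        define u where "u = z /\<^sub>R norm z"
        have zu: "z = norm z *\<^sub>R u" using z by (simp add: u_def)
        have lfu: "lform (l i) u = lform (l i) z / norm z" for i
          by (simp add: u_def divide_inverse mult.commute)
        have "\<bar>Re t - Re s\<bar> < Re s - \<sigma>"
          using t abs_Re_le_cmod[of "s - t"] by (auto simp: r'_def dist_norm)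
        hence Ret: "0 \<le> Re t - \<sigma>" "Re t - \<sigma> \<le> 2 * (Re s - \<sigma>)" by auto
        have "norm (G t z) = norm z powr (2 * d * Re t) * norm (G t u)"
          using hom[OF z, of t u] zu z by (simp add: norm_mult norm_powr_real_powr)
        also have "norm z powr (2 * d * Re t) = norm z powr (2 * d * \<sigma>) * norm z powr (2 * d * (Re t - \<sigma>))"
          by (simp add: algebra_simps flip: powr_add)
        also have "norm z powr (2 * d * (Re t - \<sigma>)) \<le> R1 powr (2 * d * (Re t - \<sigma>))"
          by (rule powr_mono2) (use False d Ret in \<open>auto simp: R1_def\<close>)
        also have "R1 powr (2 * d * (Re t - \<sigma>)) \<le> R1 powr (2 * d * (2 * (Re s - \<sigma>)))"
          by (rule powr_mono) (use Ret d in \<open>auto simp: R1_def\<close>)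
        also have "norm (G t u) \<le> C * (\<Sum>i\<in>I. cmod (lform (l i) u) powr - y)"
          by (rule C) (use t elim z in \<open>auto simp: r'_def lfu u_def\<close>)
        also have "\<dots> \<le> \<bar>C\<bar> * (\<Sum>i\<in>I. cmod (lform (l i) u) powr - y)"
          by (intro mult_right_mono sum_nonneg) auto
        also have "(\<Sum>i\<in>I. cmod (lform (l i) u) powr - y) = (\<Sum>i\<in>I. cmod (lform (l i) z) powr - y) * norm z powr y"
          unfolding sum_distrib_right
          by (intro sum.cong refl) (use z in \<open>simp add: lfu norm_divide powr_divide powr_minus field_simps\<close>)
        finally have "norm (G t z) \<le> norm z powr (2 * d * \<sigma>) * R1 powr (2 * d * (2 * (Re s - \<sigma>))) *
            (\<bar>C\<bar> * ((\<Sum>i\<in>I. cmod (lform (l i) z) powr - y) * norm z powr y))"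
          by (simp add: mult_left_mono mult_right_mono mult_mono)
        also have "\<dots> = R1 powr (2 * d * (2 * (Re s - \<sigma>))) * \<bar>C\<bar> * ((norm z powr (2 * d * \<sigma>) * norm z powr y) * (\<Sum>i\<in>I. cmod (lform (l i) z) powr - y))"
          by (simp add: mult_ac)
        also have "norm z powr (2 * d * \<sigma>) * norm z powr y = norm z powr - x"
          by (simp add: x_def add.commute flip: powr_add)
        finally have G: "norm (G t z) \<le> R1 powr (2 * d * (2 * (Re s - \<sigma>))) * \<bar>C\<bar> * (norm z powr - x * (\<Sum>i\<in>I. cmod (lform (l i) z) powr - y))" .
        have "norm (\<phi> z) \<le> \<bar>B\<bar>" using \<phi>(1)[of z] by linarith
        hence "norm (G t z) * norm (\<phi> z) \<le> R1 powr (2 * d * (2 * (Re s - \<sigma>))) * \<bar>C\<bar> * (norm z powr - x * (\<Sum>i\<in>I. cmod (lform (l i) z) powr - y)) * \<bar>B\<bar>"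
          by (intro mult_mono G) (auto intro!: mult_nonneg_nonneg sum_nonneg)
        also have "\<dots> = g z" using False by (simp add: g_def C'_def sum_distrib_left mult_ac)
        finally show ?thesis by (simp add: norm_mult)
      qed
    qed
  qed
  ultimately show ?thesis using r' by blast
qed

lemma homogeneous_family_holomorphic:
  fixes G :: "complex \<Rightarrow> complex^2 \<Rightarrow> complex" and \<phi> :: "complex^2 \<Rightarrow> complex" and d :: real
  assumes d: "d > 0" and I: "finite I" "I \<noteq> {}" "\<And>i. i \<in> I \<Longrightarrow> l i \<noteq> 0"
    and meas: "\<And>s. G s \<in> borel_measurable borel" "\<phi> \<in> borel_measurable borel"
    and hol: "\<And>z. (\<lambda>s. G s z) holomorphic_on UNIV"
    and hom: "\<And>s t z. t > 0 \<Longrightarrow> G s (t *\<^sub>R z) = of_real t powr (2 * of_real d * s) * G s z"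
    and bd: "\<And>s. Re s > - 2 / d \<Longrightarrow> \<exists>r>0. \<exists>C y. 0 \<le> y \<and> y < 2 \<and> (\<forall>t\<in>ball s r. \<forall>z. norm z = 1 \<longrightarrow> (\<forall>i\<in>I. lform (l i) z \<noteq> 0)
              \<longrightarrow> norm (G t z) \<le> C * (\<Sum>i\<in>I. cmod (lform (l i) z) powr - y))"
    and \<phi>: "\<And>z. norm (\<phi> z) \<le> B" "\<And>z. norm z > R \<Longrightarrow> \<phi> z = 0"
  shows "(\<lambda>s. \<integral>z. G s z * \<phi> z \<partial>lborel) holomorphic_on {s. Re s > - 2 / d}"
    and "Re s > - 2 / d \<Longrightarrow> integrable lborel (\<lambda>z. G s z * \<phi> z)"
proof -
  note [measurable] = meas
  note dom = homogeneous_family_dominated[where G=G and \<phi>=\<phi>, OF d I hom bd \<phi>]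
  show "(\<lambda>s. \<integral>z. G s z * \<phi> z \<partial>lborel) holomorphic_on {s. Re s > - 2 / d}"
  proof (rule holomorphic_on_integral)
    show "open {s. Re s > - 2 / d}" by (rule open_halfspace_Re_gt)
    show "(\<lambda>s. G s x * \<phi> x) holomorphic_on {s. Re s > - 2 / d}" for x
      by (intro holomorphic_intros holomorphic_on_subset[OF hol]) auto
    fix s :: complex assume "s \<in> {s. Re s > - 2 / d}"
    then obtain r g where rg: "r > 0" "integrable lborel g" "AE z in lborel. \<forall>t\<in>ball s r. norm (G t z * \<phi> z) \<le> g z"
      using dom[of s] by blast
    from rg(3) have "AE z in lborel. \<forall>t\<in>ball s r \<inter> {s. Re s > - 2 / d}. norm (G t z * \<phi> z) \<le> g z"
      by eventually_elim auto
    with rg show "\<exists>r>0. \<exists>g. integrable lborel g \<and> (AE x in lborel. \<forall>t\<in>ball s r \<inter> {s. Re s > - 2 / d}. norm (G t x * \<phi> x) \<le> g x)"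
      by blast
  qed measurable
  assume "Re s > - 2 / d"
  then obtain r g where rg: "r > 0" "integrable lborel g" "AE z in lborel. \<forall>t\<in>ball s r. norm (G t z * \<phi> z) \<le> g z"
    using dom[of s] by blast
  show "integrable lborel (\<lambda>z. G s z * \<phi> z)"
  proof (rule Bochner_Integration.integrable_bound[OF rg(2)])
    show "AE z in lborel. norm (G s z * \<phi> z) \<le> norm (g z)"
      using rg(3) by eventually_elim (use rg(1) in \<open>auto intro: order_trans[OF _ abs_ge_self]\<close>)
  qed measurable
qed

text \<open>On the ball \<open>N\<close> the integral \<open>J s\<close> of \<open>G s\<close> satisfies \<open>J s = K s + 4 powr -(2 + d s) * J s\<close>,
  where \<open>K s\<close> is the integral over the shell \<open>N - N/2\<close>.\<close>

lemma homogeneous_family_lower_bound: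
  fixes G :: "complex \<Rightarrow> complex^2 \<Rightarrow> complex" and \<phi> :: "complex^2 \<Rightarrow> complex" and d :: real
  assumes d: "d > 0" and I: "finite I" "I \<noteq> {}" "\<And>i. i \<in> I \<Longrightarrow> l i \<noteq> 0"
    and meas: "\<And>s. G s \<in> borel_measurable borel" "\<phi> \<in> borel_measurable borel"
    and hol: "\<And>z. (\<lambda>s. G s z) holomorphic_on UNIV"
    and hom: "\<And>s t z. t > 0 \<Longrightarrow> G s (t *\<^sub>R z) = of_real t powr (2 * of_real d * s) * G s z"
    and bd: "\<And>s. Re s > - 2 / d \<Longrightarrow> \<exists>r>0. \<exists>C y. 0 \<le> y \<and> y < 2 \<and> (\<forall>t\<in>ball s r. \<forall>z. norm z = 1 \<longrightarrow> (\<forall>i\<in>I. lform (l i) z \<noteq> 0)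
              \<longrightarrow> norm (G t z) \<le> C * (\<Sum>i\<in>I. cmod (lform (l i) z) powr - y))"
    and \<phi>: "\<And>z. norm (\<phi> z) \<le> B" "\<And>z. norm z > R \<Longrightarrow> \<phi> z = 0"
    and \<phi>_nonneg: "\<And>z. \<phi> z \<in> \<real>\<^sub>\<ge>\<^sub>0" and \<rho>: "\<rho> > 0" and \<phi>_1: "\<And>z. norm z < \<rho> \<Longrightarrow> \<phi> z = 1"
    and G_nonneg: "\<And>s z. s < 0 \<Longrightarrow> G (of_real s) z \<in> \<real>\<^sub>\<ge>\<^sub>0"
    and cont: "isCont (\<lambda>p. G (of_real (fst p)) (snd p)) (- 2 / d, z0)"
    and pos: "Re (G (of_real (- 2 / d)) z0) > 0" and z0: "z0 \<noteq> 0"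
  shows "\<exists>c>0. \<forall>\<^sub>F s in at_right (- 2 / d). (\<integral>z. G (of_real s) z * \<phi> z \<partial>lborel) \<in> \<real> \<and>
           (2 + d * s) * Re (\<integral>z. G (of_real s) z * \<phi> z \<partial>lborel) \<ge> c"
proof -
  note [measurable] = meas
  define g where "g s z = Re (G (of_real s) z)" for s z
  define f where "f z = Re (\<phi> z)" for z
  have Gg: "G (of_real s) z = of_real (g s z)" "g s z \<ge> 0" if "s < 0" for s z
    using G_nonneg[OF that, of z] by (auto simp: g_def complex_nonneg_Reals_iff complex_eq_iff)
  have \<phi>f: "\<phi> z = of_real (f z)" "f z \<ge> 0" for z
    using \<phi>_nonneg[of z] by (auto simp: f_def complex_nonneg_Reals_iff complex_eq_iff)
  define N where "N = ball (0::complex^2) \<rho>"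
  define N2 where "N2 = ball (0::complex^2) (\<rho> / 2)"
  have [measurable]: "N \<in> sets borel" "N2 \<in> sets borel" by (auto simp: N_def N2_def)
  have [measurable]: "g s \<in> borel_measurable borel" "f \<in> borel_measurable borel" for s
    unfolding g_def f_def by measurable
  have int1: "integrable lborel (\<lambda>z. G s z * of_real (indicator N z))" if "Re s > - 2 / d" for s
    by (rule homogeneous_family_holomorphic(2)[OF d I meas(1) _ hol hom bd _ _ that, where B=1 and R=\<rho>])
      (auto simp: N_def indicator_def)
  have int2: "integrable lborel (\<lambda>z. G s z * \<phi> z)" if "Re s > - 2 / d" for s
    by (rule homogeneous_family_holomorphic(2)[OF d I meas hol hom bd \<phi> that])
  have intN: "integrable lborel (\<lambda>z. g s z * indicator N z)" if "- 2 / d < s" "s < 0" for s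
    using integrable_Re[OF int1[of "of_real s"]] that by (simp add: g_def)
  have intf: "integrable lborel (\<lambda>z. g s z * f z)" if "- 2 / d < s" "s < 0" for s
    using integrable_Re[OF int2[of "of_real s"]] that by (simp add: \<phi>f(1) g_def)
  \<comment> \<open>Scaling by \<open>\<tau>\<close> moves \<open>z0\<close> to norm
    \<open>3/4 * \<rho>\<close>. A relative perturbation of at most \<open>1/4\<close>, the role of
    \<open>\<eta>\<close> below, changes the norm to between \<open>9/16\<close> and
    \<open>15/16\<close> of \<open>\<rho>\<close>, so the small ball \<open>U\<close> stays in the
    shell.\<close>
  define \<tau> where "\<tau> = 3 * \<rho> / (4 * norm z0)"
  have \<tau>: "\<tau> > 0" using \<rho> z0 by (simp add: \<tau>_def)
  define \<epsilon> where "\<epsilon> = g (- 2 / d) z0 / 2"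
  have \<epsilon>: "\<epsilon> > 0" using pos by (simp add: \<epsilon>_def g_def)
  have "isCont (\<lambda>p. Re (G (of_real (fst p)) (snd p))) (- 2 / d, z0)"
    by (rule continuous_Re[OF cont])
  hence "((\<lambda>p. Re (G (of_real (fst p)) (snd p))) \<longlongrightarrow> 2 * \<epsilon>) (nhds (- 2 / d, z0))"
    using tendsto_at_iff_tendsto_nhds[of "\<lambda>p. Re (G (of_real (fst p)) (snd p))" "(- 2 / d, z0)"]
    by (simp add: isCont_def \<epsilon>_def g_def)
  moreover have "\<epsilon> < 2 * \<epsilon>" using \<epsilon> by simp
  ultimately have "\<forall>\<^sub>F p in nhds (- 2 / d, z0). \<epsilon> < Re (G (of_real (fst p)) (snd p))"
    by (rule order_tendstoD(1))
  then obtain e where e: "e > 0" "\<And>p. dist p (- 2 / d, z0) < e \<Longrightarrow> \<epsilon> < Re (G (of_real (fst p)) (snd p))"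
    unfolding eventually_nhds_metric by blast
  define \<eta> where "\<eta> = min (e / 2) (norm z0 / 4)"
  have \<eta>: "\<eta> > 0" using e z0 by (simp add: \<eta>_def)
  define U where "U = ball (\<tau> *\<^sub>R z0) (\<tau> * \<eta>)"
  have [measurable]: "U \<in> sets borel" by (simp add: U_def)
  have Ug: "\<tau> powr (2 * d * s) * \<epsilon> \<le> g s z \<and> norm z < \<rho> \<and> norm z \<ge> \<rho> / 2"
    if z: "z \<in> U" and s: "\<bar>s - (- 2 / d)\<bar> < e / 2" "s < 0" for z s
  proof -
    define w where "w = z /\<^sub>R \<tau>"
    have zw: "z = \<tau> *\<^sub>R w" using \<tau> by (simp add: w_def)
    have "\<tau> * norm (z0 - w) < \<tau> * \<eta>"
      using z \<tau> by (simp add: U_def dist_norm zw scaleR_diff_right[symmetric] del: scaleR_diff_right)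
    hence wz: "norm (z0 - w) < \<eta>" using \<tau> by simp
    hence wz2: "norm (z0 - w) < norm z0 / 4" by (simp add: \<eta>_def)
    have "dist (s, w) (- 2 / d, z0) \<le> \<bar>s - (- 2 / d)\<bar> + norm (z0 - w)"
      unfolding dist_Pair_Pair using sqrt_sum_squares_le_sum_abs[of "dist s (- 2 / d)" "dist w z0"]
      by (simp add: dist_norm norm_minus_commute)
    also have "\<dots> < e" using s wz by (simp add: \<eta>_def)
    finally have "\<epsilon> < g s w" using e(2)[of "(s, w)"] by (simp add: g_def)
    moreover have "g s z = \<tau> powr (2 * d * s) * g s w"
    proof -
      have "G (of_real s) z = of_real (\<tau> powr (2 * d * s)) * G (of_real s) w"
        using hom[OF \<tau>, of "of_real s" w] \<tau> by (simp add: zw powr_of_real[symmetric])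
      thus ?thesis by (simp add: g_def)
    qed
    moreover have "norm w < norm z0 * (5 / 4)" "norm w > norm z0 * (3 / 4)"
      using wz2 norm_triangle_ineq2[of z0 w] norm_triangle_ineq2[of w z0] by (auto simp: norm_minus_commute)
    hence "\<tau> * norm w < \<tau> * (norm z0 * (5 / 4))" "\<tau> * norm w > \<tau> * (norm z0 * (3 / 4))"
      using \<tau> by auto
    hence "norm z < \<rho> \<and> norm z \<ge> \<rho> / 2"
      using \<tau> z0 \<rho> by (simp add: zw \<tau>_def)
    ultimately show ?thesis using \<tau> by (simp add: less_imp_le)
  qed
  \<comment> \<open>A lower bound, uniform in \<open>s\<close>, for the integral over the shell: on
    \<open>U\<close> the integrand is at least \<open>\<epsilon> * \<tau> powr (2 * d * s)\<close>,
    and the exponent lies between -4 and 0.\<close>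
  define K where "K = \<epsilon> * min 1 (\<tau> powr - 4) * measure lborel U"
  have mU: "measure lborel U > 0"
  proof -
    have "\<not> negligible U" unfolding U_def by (rule open_not_negligible) (use mult_pos_pos[OF \<tau> \<eta>] in auto)
    hence "emeasure lborel U \<noteq> 0" by (auto simp: negligible_iff_emeasure0)
    moreover have "emeasure lborel U < \<infinity>" by (rule emeasure_bounded_finite) (simp add: U_def)
    ultimately show ?thesis by (simp add: measure_def enn2real_positive_iff zero_less_iff_neq_zero)
  qed
  have K: "K > 0" using \<epsilon> \<tau> mU by (simp add: K_def)
  have main: "(2 + d * s) * Re (\<integral>z. G (of_real s) z * \<phi> z \<partial>lborel) \<ge> K / ln 4 \<and> (\<integral>z. G (of_real s) z * \<phi> z \<partial>lborel) \<in> \<real>"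
    if s: "- 2 / d < s" "s < 0" "s < - 2 / d + e / 2" for s
  proof -
    define J where "J = (\<integral>z. g s z * indicator N z \<partial>lborel)"
    have J2: "(\<integral>z. g s z * indicator N2 z \<partial>lborel) = (1/2) ^ 4 * (1/2) powr (2 * d * s) * J"
    proof -
      have "(\<integral>z. g s z * indicator N2 z \<partial>lborel) = (1/2)^DIM(complex^2) *\<^sub>R (\<integral>z. g s ((1/2) *\<^sub>R z) * indicator N2 ((1/2) *\<^sub>R z) \<partial>lborel)"
        by (rule integral_lborel_scale) auto
      also have "(\<lambda>z. g s ((1/2) *\<^sub>R z) * indicator N2 ((1/2) *\<^sub>R z)) = (\<lambda>z. (1/2) powr (2 * d * s) * (g s z * indicator N z))"
      proof
        fix z
        have "G (of_real s) ((1/2) *\<^sub>R z) = of_real ((1/2) powr (2 * d * s)) * G (of_real s) z"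
          using hom[of "1/2" "of_real s" z] powr_of_real[of "1/2" "2 * d * s", symmetric] by simp
        hence "g s ((1/2) *\<^sub>R z) = (1/2) powr (2 * d * s) * g s z" by (simp add: g_def)
        moreover have "indicator N2 ((1/2) *\<^sub>R z) = (indicator N z :: real)" by (auto simp: indicator_def N_def N2_def)
        ultimately show "g s ((1/2) *\<^sub>R z) * indicator N2 ((1/2) *\<^sub>R z) = (1/2) powr (2 * d * s) * (g s z * indicator N z)"
          by simp
      qed
      finally show ?thesis by (simp add: J_def)
    qed
    have "(1/2::real) ^ 4 * (1/2) powr (2 * d * s) = (1/2) powr 4 * (1/2) powr (2 * d * s)" by simp
    also have "\<dots> = (1/2) powr (2 * (2 + d * s))"
      by (subst powr_add[symmetric]) (simp add: algebra_simps)
    also have "\<dots> = exp (- (ln 4 * (2 + d * s)))"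
      using ln_realpow[of 2 2] by (simp add: powr_def ln_div)
    finally have J3: "(\<integral>z. g s z * indicator N2 z \<partial>lborel) = exp (- (ln 4 * (2 + d * s))) * J"
      using J2 by simp
    have intN2: "integrable lborel (\<lambda>z. g s z * indicator N2 z)"
      by (rule Bochner_Integration.integrable_bound[OF intN[OF s(1,2)]]) (use \<rho> in \<open>auto simp: indicator_def N_def N2_def\<close>)
    have intU: "integrable lborel (\<lambda>z. K / measure lborel U * indicator U z)"
      using emeasure_bounded_finite[of U] by (intro integrable_mult_right integrable_real_indicator) (auto simp: U_def)
    have "K = (\<integral>z. K / measure lborel U * indicator U z \<partial>lborel)" using mU by simp
    also have "\<dots> \<le> (\<integral>z. g s z * indicator N z - g s z * indicator N2 z \<partial>lborel)"
    proof (rule integral_mono[OF intU])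
      show "integrable lborel (\<lambda>z. g s z * indicator N z - g s z * indicator N2 z)"
        using intN[OF s(1,2)] intN2 by (rule Bochner_Integration.integrable_diff)
      fix z
      show "K / measure lborel U * indicator U z \<le> g s z * indicator N z - g s z * indicator N2 z"
      proof (cases "z \<in> U")
        case True
        have *: "\<tau> powr (2 * d * s) * \<epsilon> \<le> g s z" "norm z < \<rho>" "norm z \<ge> \<rho> / 2"
          using Ug[OF True, of s] s by auto
        have "min 1 (\<tau> powr - 4) \<le> \<tau> powr (2 * d * s)"
        proof (cases "\<tau> \<ge> 1")
          case True
          have "\<tau> powr - 4 \<le> \<tau> powr (2 * d * s)" by (rule powr_mono) (use True s d in \<open>auto simp: field_simps\<close>)
          thus ?thesis by simp
        next
          case False
          have "\<tau> powr 0 \<le> \<tau> powr (2 * d * s)"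
            by (rule powr_mono') (use False \<tau> s d in \<open>auto simp: mult_nonneg_nonpos\<close>)
          thus ?thesis using \<tau> by simp
        qed
        hence "\<epsilon> * min 1 (\<tau> powr - 4) \<le> \<epsilon> * \<tau> powr (2 * d * s)" using \<epsilon> by (intro mult_left_mono) auto
        hence "\<epsilon> * min 1 (\<tau> powr - 4) \<le> g s z" using * by (simp add: mult.commute)
        thus ?thesis using True * mU by (simp add: K_def N_def N2_def)
      next
        case False
        thus ?thesis using Gg(2)[OF s(2), of z] \<rho> by (auto simp: indicator_def N_def N2_def)
      qed
    qed
    also have "\<dots> = J - exp (- (ln 4 * (2 + d * s))) * J"
      using intN[OF s(1,2)] intN2 J3 by (simp add: J_def)
    also have "\<dots> = (1 - exp (- (ln 4 * (2 + d * s)))) * J" by (simp add: algebra_simps)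
    \<comment> \<open>From \<open>1 - exp (- x) \<le> x\<close>: this is where the factor
      \<open>2 + d * s\<close> of the conclusion appears.\<close>
    also have "\<dots> \<le> (ln 4 * (2 + d * s)) * J"
    proof (rule mult_right_mono)
      show "1 - exp (- (ln 4 * (2 + d * s))) \<le> ln 4 * (2 + d * s)"
        using exp_ge_add_one_self[of "- (ln 4 * (2 + d * s))"] by simp
      show "0 \<le> J" unfolding J_def by (rule Bochner_Integration.integral_nonneg) (use Gg(2)[OF s(2)] in auto)
    qed
    finally have KJ: "K / ln 4 \<le> (2 + d * s) * J" by (simp add: field_simps)
    have "J \<le> (\<integral>z. g s z * f z \<partial>lborel)" unfolding J_def
    proof (rule integral_mono[OF intN[OF s(1,2)] intf[OF s(1,2)]])
      fix z
      have "indicator N z \<le> f z" using \<phi>_1[of z] \<phi>f(2)[of z] by (auto simp: indicator_def N_def f_def)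
      thus "g s z * indicator N z \<le> g s z * f z" by (intro mult_left_mono Gg(2) s)
    qed
    hence "(2 + d * s) * J \<le> (2 + d * s) * (\<integral>z. g s z * f z \<partial>lborel)"
      using s d by (intro mult_left_mono) (auto simp: field_simps)
    moreover have "(\<integral>z. G (of_real s) z * \<phi> z \<partial>lborel) = of_real (\<integral>z. g s z * f z \<partial>lborel)"
      by (simp add: Gg(1)[OF s(2)] \<phi>f(1) flip: of_real_mult integral_complex_of_real)
    ultimately show ?thesis using KJ by auto
  qed
  have "\<forall>\<^sub>F s in at_right (- 2 / d). s \<in> {- 2 / d <..< min 0 (- 2 / d + e / 2)}"
    by (rule eventually_at_right_real) (use d e in auto)
  hence "\<forall>\<^sub>F s in at_right (- 2 / d). (\<integral>z. G (of_real s) z * \<phi> z \<partial>lborel) \<in> \<real> \<and>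
           (2 + d * s) * Re (\<integral>z. G (of_real s) z * \<phi> z \<partial>lborel) \<ge> K / ln 4"
    by eventually_elim (use main in auto)
  moreover have "K / ln 4 > 0" using K by simp
  ultimately show ?thesis by blast
qed

section \<open>Wirtinger derivatives and integration by parts\<close>

lemma C_k_add: "C_k k f \<Longrightarrow> C_k k g \<Longrightarrow> C_k k (\<lambda>x. f x + g x)"
proof (induction k arbitrary: f g)
  case 0
  thus ?case by (auto intro: continuous_intros)
next
  case (Suc k)
  have "frechet_derivative (\<lambda>x. f x + g x) (at x) v = frechet_derivative f (at x) v + frechet_derivative g (at x) v" for x v
  proof -
    have "((\<lambda>x. f x + g x) has_derivative (\<lambda>v. frechet_derivative f (at x) v + frechet_derivative g (at x) v)) (at x)"
      using Suc.prems by (intro has_derivative_add) (auto simp flip: frechet_derivative_works)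
    from frechet_derivative_at[OF this] show ?thesis by metis
  qed
  thus ?case using Suc by auto
qed

lemma C_k_cmult:
  fixes f :: "'a::euclidean_space \<Rightarrow> complex"
  shows "C_k k f \<Longrightarrow> C_k k (\<lambda>x. c * f x)"
proof (induction k arbitrary: f)
  case 0
  thus ?case by (auto intro: continuous_intros)
next
  case (Suc k)
  have "frechet_derivative (\<lambda>x. c * f x) (at x) = (\<lambda>v. c * frechet_derivative f (at x) v)" for x
  proof (rule frechet_derivative_at[symmetric])
    have "(f has_derivative frechet_derivative f (at x)) (at x)"
      using Suc.prems frechet_derivative_works by auto
    thus "((\<lambda>x. c * f x) has_derivative (\<lambda>v. c * frechet_derivative f (at x) v)) (at x)"
      by (rule has_derivative_mult_right)
  qed
  thus ?case using Suc by (auto intro!: differentiable_cmult_left_iff[THEN iffD2])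
qed

lemma C_k_dilation:
  fixes f :: "'a::euclidean_space \<Rightarrow> complex" and t :: real
  shows "C_k k f \<Longrightarrow> C_k k (\<lambda>x. f (t *\<^sub>R x))"
proof (induction k arbitrary: f)
  case 0
  thus ?case by (auto intro!: continuous_intros continuous_on_compose2[of UNIV f])
next
  case (Suc k)
  have d: "((\<lambda>x. f (t *\<^sub>R x)) has_derivative (\<lambda>v. of_real t * frechet_derivative f (at (t *\<^sub>R x)) v)) (at x)" for x
  proof -
    have fd: "(f has_derivative frechet_derivative f (at (t *\<^sub>R x))) (at (t *\<^sub>R x))"
      using Suc.prems frechet_derivative_works by auto
    have "((\<lambda>x. t *\<^sub>R x) has_derivative (\<lambda>v. t *\<^sub>R v)) (at x)" by (auto intro!: derivative_eq_intros)
    from diff_chain_at[OF this fd]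
    have "((\<lambda>x. f (t *\<^sub>R x)) has_derivative (\<lambda>v. frechet_derivative f (at (t *\<^sub>R x)) (t *\<^sub>R v))) (at x)"
      by (simp add: o_def)
    thus ?thesis
      using linear_cmul[OF has_derivative_linear[OF fd]] by (simp add: scaleR_conv_of_real)
  qed
  have "frechet_derivative (\<lambda>x. f (t *\<^sub>R x)) (at x) = (\<lambda>v. of_real t * frechet_derivative f (at (t *\<^sub>R x)) v)" for x
    by (rule frechet_derivative_at[symmetric]) (rule d)
  moreover have "C_k k (\<lambda>x. of_real t * frechet_derivative f (at (t *\<^sub>R x)) v)" for v
    using Suc by (intro C_k_cmult Suc.IH[of "\<lambda>x. frechet_derivative f (at x) v"]) auto
  ultimately show ?case using d by (auto simp: differentiable_def)
qed

lemma Cc_infinity_supportE: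
  fixes f :: "'a::euclidean_space \<Rightarrow> complex"
  assumes "f \<in> Cc_infinity"
  obtains R where "\<And>x. norm x > R \<Longrightarrow> f x = 0"
proof -
  have "bounded (closure {x. f x \<noteq> 0})" using assms by (auto simp: Cc_infinity_def compact_imp_bounded)
  then obtain R where "\<And>x. x \<in> closure {x. f x \<noteq> 0} \<Longrightarrow> norm x \<le> R" by (auto simp: bounded_iff)
  thus ?thesis using that[of R] closure_subset[of "{x. f x \<noteq> 0}"] by force
qed

lemma Cc_infinityI:
  fixes f :: "'a::euclidean_space \<Rightarrow> complex"
  assumes "\<And>k. C_k k f" "\<And>x. norm x > R \<Longrightarrow> f x = 0"
  shows "f \<in> Cc_infinity"
proof -
  have "closure {x. f x \<noteq> 0} \<subseteq> cball 0 R"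
    by (rule closure_minimal) (use assms(2) in \<open>force simp: not_le[symmetric]\<close>, simp)
  hence "compact (closure {x. f x \<noteq> 0})"
    by (meson bounded_cball bounded_subset closed_closure compact_eq_bounded_closed)
  thus ?thesis using assms(1) by (simp add: Cc_infinity_def)
qed

lemma Cc_infinity_continuous: "f \<in> Cc_infinity \<Longrightarrow> continuous_on UNIV f"
  by (metis (mono_tags, lifting) C_k.simps(1) Cc_infinity_def mem_Collect_eq)

lemma continuous_compact_support_bounded:
  fixes f :: "'a::euclidean_space \<Rightarrow> 'b::real_normed_vector"
  assumes f: "continuous_on UNIV f" and R: "\<And>x. norm x > R \<Longrightarrow> f x = 0"
  obtains C where "\<And>x. norm (f x) \<le> C"
proof -
  have "compact (f ` cball 0 R)"
    by (intro compact_continuous_image continuous_on_subset[OF f]) auto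
  then obtain C where C: "C > 0" "\<And>x. x \<in> cball 0 R \<Longrightarrow> norm (f x) \<le> C"
    using bounded_pos compact_imp_bounded by (metis imageI)
  have "norm (f x) \<le> C" for x
    using C R[of x] by (cases "norm x > R") auto
  thus ?thesis using that by blast
qed

lemma Cc_infinity_diff:
  fixes f g :: "'a::euclidean_space \<Rightarrow> complex"
  assumes "f \<in> Cc_infinity" "g \<in> Cc_infinity"
  shows "(\<lambda>x. f x - g x) \<in> Cc_infinity"
proof -
  obtain R R' where "\<And>x. norm x > R \<Longrightarrow> f x = 0" "\<And>x. norm x > R' \<Longrightarrow> g x = 0"
    using assms Cc_infinity_supportE by metis
  moreover have "C_k k (\<lambda>x. f x + (-1) * g x)" for k
    using assms by (intro C_k_add C_k_cmult) (auto simp: Cc_infinity_def)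
  ultimately show ?thesis by (intro Cc_infinityI[where R="max R R'"]) auto
qed

lemma Cc_infinity_dilation:
  fixes f :: "'a::euclidean_space \<Rightarrow> complex"
  assumes "f \<in> Cc_infinity" "t > 0"
  shows "(\<lambda>x. f (t *\<^sub>R x)) \<in> Cc_infinity"
proof -
  obtain R where "\<And>x. norm x > R \<Longrightarrow> f x = 0"
    using assms Cc_infinity_supportE by metis
  thus ?thesis using assms
    by (intro Cc_infinityI[where R="R / t"] C_k_dilation) (auto simp: Cc_infinity_def field_simps)
qed

section \<open>Wirtinger derivatives in one variable\<close>

definition wirt :: "(complex \<Rightarrow> complex) \<Rightarrow> complex \<Rightarrow> complex" where
  "wirt f w = (frechet_derivative f (at w) 1 - \<i> * frechet_derivative f (at w) \<i>) / 2"

definition wirt_bar :: "(complex \<Rightarrow> complex) \<Rightarrow> complex \<Rightarrow> complex" where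
  "wirt_bar f w = (frechet_derivative f (at w) 1 + \<i> * frechet_derivative f (at w) \<i>) / 2"

lemma has_derivative_wirt:
  assumes "f differentiable (at w)"
  shows "(f has_derivative (\<lambda>h. wirt f w * h + wirt_bar f w * cnj h)) (at w)"
proof -
  have fd: "(f has_derivative frechet_derivative f (at w)) (at w)"
    using assms frechet_derivative_works by auto
  note lin = has_derivative_linear[OF fd]
  have "frechet_derivative f (at w) h = wirt f w * h + wirt_bar f w * cnj h" for h
  proof -
    have "frechet_derivative f (at w) h = frechet_derivative f (at w) (Re h *\<^sub>R 1 + Im h *\<^sub>R \<i>)"
      by (intro arg_cong[where f="frechet_derivative f (at w)"]) (auto simp: complex_eq_iff)
    also have "\<dots> = Re h *\<^sub>R frechet_derivative f (at w) 1 + Im h *\<^sub>R frechet_derivative f (at w) \<i>"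
      using lin by (simp add: linear_add linear_cmul)
    also have "\<dots> = wirt f w * h + wirt_bar f w * cnj h"
      by (simp add: wirt_def wirt_bar_def complex_eq_iff algebra_simps add_divide_distrib diff_divide_distrib)
    finally show ?thesis .
  qed
  hence "frechet_derivative f (at w) = (\<lambda>h. wirt f w * h + wirt_bar f w * cnj h)" by auto
  thus ?thesis using fd by simp
qed

lemma frechet_derivative_zero_outside:
  fixes f :: "complex \<Rightarrow> complex"
  assumes "\<And>x. norm x > R \<Longrightarrow> f x = 0" "norm w > R"
  shows "frechet_derivative f (at w) = (\<lambda>_. 0)"
proof (rule frechet_derivative_at[symmetric])
  have "open {x::complex. norm x > R}" by (intro open_Collect_less continuous_intros)
  thus "(f has_derivative (\<lambda>_. 0)) (at w)"
    using has_derivative_transform_within_open[of "\<lambda>_. 0" "\<lambda>_. 0" w UNIV "{x. norm x > R}" f] assms by simp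
qed

lemma wirt_Cc_infinity:
  assumes "f \<in> Cc_infinity"
  shows "wirt f \<in> Cc_infinity" "wirt_bar f \<in> Cc_infinity"
proof -
  obtain R where R: "\<And>x. norm x > R \<Longrightarrow> f x = 0" using assms Cc_infinity_supportE by metis
  have C: "C_k k (\<lambda>x. frechet_derivative f (at x) v)" for k v
    using assms by (auto simp: Cc_infinity_def dest: spec[of _ "Suc k"])
  have "C_k k (\<lambda>w. 1/2 * frechet_derivative f (at w) 1 + (- \<i>/2) * frechet_derivative f (at w) \<i>)" for k
    by (intro C_k_add C_k_cmult C)
  moreover have "(\<lambda>w. 1/2 * frechet_derivative f (at w) 1 + (- \<i>/2) * frechet_derivative f (at w) \<i>) = wirt f"
    by (auto simp: wirt_def field_simps)
  ultimately show "wirt f \<in> Cc_infinity"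
    using frechet_derivative_zero_outside[OF R] by (intro Cc_infinityI[where R=R]) (auto simp: wirt_def)
  have "C_k k (\<lambda>w. 1/2 * frechet_derivative f (at w) 1 + (\<i>/2) * frechet_derivative f (at w) \<i>)" for k
    by (intro C_k_add C_k_cmult C)
  moreover have "(\<lambda>w. 1/2 * frechet_derivative f (at w) 1 + (\<i>/2) * frechet_derivative f (at w) \<i>) = wirt_bar f"
    by (auto simp: wirt_bar_def field_simps)
  ultimately show "wirt_bar f \<in> Cc_infinity"
    using frechet_derivative_zero_outside[OF R] by (intro Cc_infinityI[where R=R]) (auto simp: wirt_bar_def)
qed

lemma Cc_infinity_has_derivative:
  assumes "f \<in> Cc_infinity"
  shows "(f has_derivative (\<lambda>h. wirt f w * h + wirt_bar f w * cnj h)) (at w)"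
proof (rule has_derivative_wirt)
  have "C_k (Suc 0) f" using assms by (simp add: Cc_infinity_def)
  thus "f differentiable (at w)" by simp
qed

section \<open>Wirtinger derivatives along a direction in two variables\<close>

text \<open>Local boundedness is used rather than continuity because it admits factors such as
  \<open>lform c z / cnj (lform c z)\<close>, which have no continuous extension across the
  line.\<close>

definition loc_bdd :: "(complex^2 \<Rightarrow> complex) \<Rightarrow> bool" where
  "loc_bdd f \<longleftrightarrow> (\<forall>R. \<exists>C. \<forall>z. norm z \<le> R \<longrightarrow> norm (f z) \<le> C)"

lemma loc_bdd_continuous:
  assumes "continuous_on UNIV f"
  shows "loc_bdd f"
  unfolding loc_bdd_def
proof
  fix R
  have "compact (f ` cball 0 R)"
    by (intro compact_continuous_image continuous_on_subset[OF assms]) auto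
  then obtain C where C: "C > 0" "\<And>x. x \<in> cball 0 R \<Longrightarrow> norm (f x) \<le> C"
    using bounded_pos compact_imp_bounded by (metis imageI)
  thus "\<exists>C. \<forall>z. norm z \<le> R \<longrightarrow> norm (f z) \<le> C" by auto
qed

lemma loc_bdd_add: "loc_bdd f \<Longrightarrow> loc_bdd g \<Longrightarrow> loc_bdd (\<lambda>z. f z + g z)"
  unfolding loc_bdd_def by (meson add_mono norm_triangle_ineq order_trans)

lemma loc_bdd_mult:
  assumes "loc_bdd f" "loc_bdd g"
  shows "loc_bdd (\<lambda>z. f z * g z)"
  unfolding loc_bdd_def
proof
  fix R
  obtain C D where "\<forall>z. norm z \<le> R \<longrightarrow> norm (f z) \<le> C" "\<forall>z. norm z \<le> R \<longrightarrow> norm (g z) \<le> D"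
    using assms unfolding loc_bdd_def by metis
  hence "\<forall>z. norm z \<le> R \<longrightarrow> norm (f z * g z) \<le> C * D"
    by (metis (no_types, lifting) mult_mono norm_ge_zero norm_mult order_trans)
  thus "\<exists>C. \<forall>z. norm z \<le> R \<longrightarrow> norm (f z * g z) \<le> C" by blast
qed

text \<open>\<open>b\<close> is the conjugate derivative; only its local boundedness matters.\<close>

definition wirt_along :: "complex^2 \<Rightarrow> (complex^2 \<Rightarrow> complex) \<Rightarrow> (complex^2 \<Rightarrow> complex) \<Rightarrow> bool" where
  "wirt_along e f f' \<longleftrightarrow> continuous_on UNIV f \<and> loc_bdd f' \<and> (\<exists>b. loc_bdd b \<and>
     (\<forall>z. ((\<lambda>w. f (z + w *s e)) has_derivative (\<lambda>h. f' z * h + b z * cnj h)) (at 0)))"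

lemma wirt_along_add: "wirt_along e f f' \<Longrightarrow> wirt_along e g g' \<Longrightarrow> wirt_along e (\<lambda>z. f z + g z) (\<lambda>z. f' z + g' z)"
proof -
  assume "wirt_along e f f'" "wirt_along e g g'"
  then obtain b c where 1: "continuous_on UNIV f" "loc_bdd f'" "loc_bdd b" "continuous_on UNIV g" "loc_bdd g'" "loc_bdd c" and
    2: "\<And>z. ((\<lambda>w. f (z + w *s e)) has_derivative (\<lambda>h. f' z * h + b z * cnj h)) (at 0)"
    "\<And>z. ((\<lambda>w. g (z + w *s e)) has_derivative (\<lambda>h. g' z * h + c z * cnj h)) (at 0)"
    unfolding wirt_along_def by blast
  have "((\<lambda>w. f (z + w *s e) + g (z + w *s e)) has_derivative (\<lambda>h. (f' z + g' z) * h + (b z + c z) * cnj h)) (at 0)" for z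
    by (rule has_derivative_eq_rhs[OF has_derivative_add[OF 2(1) 2(2)]]) (auto simp: algebra_simps)
  thus ?thesis using 1 unfolding wirt_along_def by (blast intro: loc_bdd_add continuous_on_add)
qed

lemma wirt_along_mult: "wirt_along e f f' \<Longrightarrow> wirt_along e g g' \<Longrightarrow> wirt_along e (\<lambda>z. f z * g z) (\<lambda>z. f' z * g z + f z * g' z)"
proof -
  assume "wirt_along e f f'" "wirt_along e g g'"
  then obtain b c where 1: "continuous_on UNIV f" "loc_bdd f'" "loc_bdd b" "continuous_on UNIV g" "loc_bdd g'" "loc_bdd c" and
    2: "\<And>z. ((\<lambda>w. f (z + w *s e)) has_derivative (\<lambda>h. f' z * h + b z * cnj h)) (at 0)"
    "\<And>z. ((\<lambda>w. g (z + w *s e)) has_derivative (\<lambda>h. g' z * h + c z * cnj h)) (at 0)"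
    unfolding wirt_along_def by blast
  have "((\<lambda>w. f (z + w *s e) * g (z + w *s e)) has_derivative
     (\<lambda>h. (f' z * g z + f z * g' z) * h + (b z * g z + f z * c z) * cnj h)) (at 0)" for z
    by (rule has_derivative_eq_rhs[OF has_derivative_mult[OF 2(1) 2(2)]]) (auto simp: algebra_simps)
  moreover have "loc_bdd f" "loc_bdd g" using 1 loc_bdd_continuous by auto
  hence "loc_bdd (\<lambda>z. f' z * g z + f z * g' z)" "loc_bdd (\<lambda>z. b z * g z + f z * c z)"
    using 1 by (auto intro!: loc_bdd_add loc_bdd_mult)
  ultimately show ?thesis using 1 unfolding wirt_along_def by (auto intro!: continuous_on_mult exI[of _ "\<lambda>z. b z * g z + f z * c z"])
qed

text \<open>Factors that need not be differentiable at all, such as powers of forms killed by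
  \<open>e\<close> or cutoffs in the other coordinate, enter the product rule through this
  lemma.\<close>

lemma wirt_along_constant_along:
  assumes "continuous_on UNIV f" "\<And>z w. f (z + w *s e) = f z"
  shows "wirt_along e f (\<lambda>_. 0)"
  unfolding wirt_along_def using assms
  by (auto intro!: exI[of _ "\<lambda>_. 0"] loc_bdd_continuous simp: continuous_on_const)

lemma wirt_along_const: "wirt_along e (\<lambda>_. c) (\<lambda>_. 0)"
  by (rule wirt_along_constant_along) auto

lemma wirt_along_prod:
  assumes "finite A" "\<And>i. i \<in> A \<Longrightarrow> wirt_along e (f i) (f' i)"
  shows "wirt_along e (\<lambda>z. \<Prod>i\<in>A. f i z) (\<lambda>z. \<Sum>i\<in>A. f' i z * (\<Prod>j\<in>A-{i}. f j z))"
  using assms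
proof (induction A rule: finite_induct)
  case empty
  thus ?case by (simp add: wirt_along_const)
next
  case (insert x A)
  have "wirt_along e (\<lambda>z. f x z * (\<Prod>i\<in>A. f i z)) (\<lambda>z. f' x z * (\<Prod>i\<in>A. f i z) + f x z * (\<Sum>i\<in>A. f' i z * (\<Prod>j\<in>A-{i}. f j z)))"
    using insert by (intro wirt_along_mult) auto
  moreover have "f' x z * (\<Prod>i\<in>A. f i z) + f x z * (\<Sum>i\<in>A. f' i z * (\<Prod>j\<in>A-{i}. f j z)) =
      (\<Sum>i\<in>insert x A. f' i z * (\<Prod>j\<in>insert x A-{i}. f j z))" for z
  proof -
    have "f x z * (f' i z * (\<Prod>j\<in>A-{i}. f j z)) = f' i z * (\<Prod>j\<in>insert x A-{i}. f j z)" if "i \<in> A" for i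
    proof -
      have "insert x A - {i} = insert x (A - {i})" using that insert by auto
      thus ?thesis using insert by simp
    qed
    hence "f x z * (\<Sum>i\<in>A. f' i z * (\<Prod>j\<in>A-{i}. f j z)) = (\<Sum>i\<in>A. f' i z * (\<Prod>j\<in>insert x A-{i}. f j z))"
      unfolding sum_distrib_left by (intro sum.cong refl)
    thus ?thesis using insert by simp
  qed
  ultimately show ?case using insert by simp
qed

lemma wirt_along_compose_lform:
  assumes g: "\<And>w. (g has_derivative (\<lambda>h. g' w * h + gb w * cnj h)) (at w)"
    and "continuous_on UNIV g'" "loc_bdd (\<lambda>z. gb (lform c z))"
  shows "wirt_along e (\<lambda>z. g (lform c z)) (\<lambda>z. g' (lform c z) * lform c e)"
proof -
  have lfe: "lform c (z + w *s e) = lform c z + w * lform c e" for z w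
    by (simp add: lform_def algebra_simps)
  have "((\<lambda>w. g (lform c (z + w *s e))) has_derivative (\<lambda>h. g' (lform c z) * lform c e * h + gb (lform c z) * cnj (lform c e) * cnj h)) (at 0)" for z
  proof -
    have 1: "((\<lambda>w. lform c z + w * lform c e) has_derivative (\<lambda>h. h * lform c e)) (at 0)"
      by (auto intro!: derivative_eq_intros)
    have 2: "(g has_derivative (\<lambda>h. g' (lform c z) * h + gb (lform c z) * cnj h)) (at (lform c z + 0 * lform c e))"
      using g[of "lform c z"] by simp
    show ?thesis
      using diff_chain_at[OF 1 2] unfolding lfe o_def by (simp add: mult_ac)
  qed
  moreover have "continuous_on UNIV g"
    using g by (intro continuous_at_imp_continuous_on ballI has_derivative_continuous) blast
  hence "continuous_on UNIV (\<lambda>z. g (lform c z))"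
    by (rule continuous_on_compose2) (auto intro: continuous_intros)
  moreover have "continuous_on UNIV (\<lambda>z. g' (lform c z))"
    by (rule continuous_on_compose2[OF assms(2)]) (auto intro: continuous_intros)
  hence "loc_bdd (\<lambda>z. g' (lform c z) * lform c e)" by (intro loc_bdd_continuous continuous_intros)
  moreover have "loc_bdd (\<lambda>z. gb (lform c z) * cnj (lform c e))"
    by (rule loc_bdd_mult[OF assms(3)], rule loc_bdd_continuous) auto
  ultimately show ?thesis unfolding wirt_along_def by blast
qed

lemma wirt_along_lform: "wirt_along e (lform c) (\<lambda>_. lform c e)"
  using wirt_along_compose_lform[of "\<lambda>w. w" "\<lambda>_. 1" "\<lambda>_. 0" c e] by (simp add: loc_bdd_def exI[of _ 0])

lemma nth_conv_lform: "z $ i = lform (axis i 1) z"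
  using exhaust_2[of i] by (auto simp: lform_def axis_def)

lemma wirt_along_nth: "wirt_along e (\<lambda>z. z $ i) (\<lambda>_. e $ i)"
  unfolding nth_conv_lform by (rule wirt_along_lform)

lemma wirt_along_test:
  assumes "\<eta> \<in> Cc_infinity"
  shows "wirt_along e (\<lambda>z. \<eta> (z $ i)) (\<lambda>z. wirt \<eta> (z $ i) * e $ i)"
  unfolding nth_conv_lform
proof (rule wirt_along_compose_lform[OF Cc_infinity_has_derivative[OF assms]])
  show "continuous_on UNIV (wirt \<eta>)" using wirt_Cc_infinity[OF assms] Cc_infinity_continuous by blast
  have "continuous_on UNIV (wirt_bar \<eta>)" using wirt_Cc_infinity[OF assms] Cc_infinity_continuous by blast
  hence "continuous_on UNIV (\<lambda>z. wirt_bar \<eta> (lform (axis i 1) z))"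
    by (rule continuous_on_compose2) (auto intro: continuous_intros)
  thus "loc_bdd (\<lambda>z. wirt_bar \<eta> (lform (axis i 1) z))" by (rule loc_bdd_continuous)
qed

lemma continuous_abs_pow:
  assumes "Re \<sigma> > 0"
  shows "continuous_on UNIV (\<lambda>w. abs_pow w \<sigma>)"
proof (intro continuous_at_imp_continuous_on ballI)
  fix w :: complex
  show "isCont (\<lambda>w. abs_pow w \<sigma>) w"
  proof (cases "w = 0")
    case True
    have "((\<lambda>w::complex. cmod w powr (2 * Re \<sigma>)) \<longlongrightarrow> cmod 0 powr (2 * Re \<sigma>)) (at 0)"
      by (intro tendsto_powr2 tendsto_intros) (use assms in auto)
    hence "((\<lambda>w. abs_pow w \<sigma>) \<longlongrightarrow> 0) (at 0)"
      by (subst tendsto_norm_zero_iff[symmetric]) (simp add: norm_abs_pow)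
    thus ?thesis using True by (simp add: isCont_def)
  next
    case False
    have "isCont (\<lambda>w. exp (2 * \<sigma> * of_real (ln (cmod w)))) w"
      using False by (intro continuous_intros) auto
    moreover have "\<forall>\<^sub>F x in nhds w. abs_pow x \<sigma> = exp (2 * \<sigma> * of_real (ln (cmod x)))"
    proof -
      have "\<forall>\<^sub>F x in nhds w. x \<in> - {0}" by (rule eventually_nhds_in_open) (use False in auto)
      thus ?thesis by eventually_elim (simp add: abs_pow_eq_exp)
    qed
    ultimately show ?thesis by (subst isCont_cong) auto
  qed
qed

text \<open>The extra factor \<open>w\<close> gives differentiability also at 0, since the remaining
  factor \<open>abs_pow w \<sigma>\<close> tends to 0 there. Away from 0 the power is written as
  \<open>exp (\<sigma> * ln (w \<bullet> w))\<close>.\<close>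

lemma has_derivative_abs_pow_mult:
  assumes "Re \<sigma> > 0"
  shows "((\<lambda>w. abs_pow w \<sigma> * w) has_derivative (\<lambda>h. ((\<sigma> + 1) * abs_pow w \<sigma>) * h + (\<sigma> * abs_pow w \<sigma> * (w / cnj w)) * cnj h)) (at w)"
proof (cases "w = 0")
  case True
  have "((\<lambda>w. cmod (abs_pow w \<sigma>)) \<longlongrightarrow> 0) (at 0)"
  proof -
    have "((\<lambda>w. abs_pow w \<sigma>) \<longlongrightarrow> abs_pow 0 \<sigma>) (at 0)"
      using continuous_abs_pow[OF assms] unfolding continuous_on_def by blast
    thus ?thesis by (simp add: tendsto_norm_zero_iff)
  qed
  hence "((\<lambda>h. norm (abs_pow h \<sigma> * h) / norm h) \<longlongrightarrow> 0) (at 0)"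
    by (rule Lim_transform_eventually) (auto simp: eventually_at_filter norm_mult)
  thus ?thesis using True by (simp add: has_derivative_at)
next
  case False
  have c2: "(cmod w)\<^sup>2 \<noteq> 0" using False by simp
  have 1: "((\<lambda>w. ln (w \<bullet> w)) has_derivative (\<lambda>h. (h \<bullet> w + w \<bullet> h) / (w \<bullet> w))) (at w)"
    by (auto intro!: derivative_eq_intros simp: False divide_inverse mult.commute add.commute)
  have e: "((\<lambda>w. exp (\<sigma> * of_real (ln (w \<bullet> w))) * w) has_derivative
     (\<lambda>h. exp (\<sigma> * of_real (ln (w \<bullet> w))) * (\<sigma> * of_real ((h \<bullet> w + w \<bullet> h) / (w \<bullet> w))) * w + exp (\<sigma> * of_real (ln (w \<bullet> w))) * h)) (at w)"
  proof -
    have "((\<lambda>w. \<sigma> * of_real (ln (w \<bullet> w))) has_derivative (\<lambda>h. \<sigma> * of_real ((h \<bullet> w + w \<bullet> h) / (w \<bullet> w)))) (at w)"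
      by (intro has_derivative_mult_right has_derivative_of_real 1)
    moreover have "(exp has_derivative (\<lambda>h. exp y * h)) (at y)" for y :: complex
      using DERIV_exp[of y] by (simp add: has_field_derivative_def)
    ultimately have "(exp \<circ> (\<lambda>w. \<sigma> * of_real (ln (w \<bullet> w))) has_derivative
       ((\<lambda>h. exp (\<sigma> * of_real (ln (w \<bullet> w))) * h) \<circ> (\<lambda>h. \<sigma> * of_real ((h \<bullet> w + w \<bullet> h) / (w \<bullet> w))))) (at w)"
      by (rule diff_chain_at)
    hence "((\<lambda>w. exp (\<sigma> * of_real (ln (w \<bullet> w)))) has_derivative
       (\<lambda>h. exp (\<sigma> * of_real (ln (w \<bullet> w))) * (\<sigma> * of_real ((h \<bullet> w + w \<bullet> h) / (w \<bullet> w))))) (at w)"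
      unfolding o_def .
    from has_derivative_mult[OF this has_derivative_ident] show ?thesis by (simp add: add.commute)
  qed
  have mpe: "abs_pow x \<sigma> = exp (\<sigma> * of_real (ln (x \<bullet> x)))" if "x \<noteq> 0" for x
    using that by (simp add: abs_pow_eq_exp ln_realpow power2_norm_eq_inner[symmetric] mult_ac)
  have ev: "((\<lambda>w. abs_pow w \<sigma> * w) has_derivative
     (\<lambda>h. exp (\<sigma> * of_real (ln (w \<bullet> w))) * (\<sigma> * of_real ((h \<bullet> w + w \<bullet> h) / (w \<bullet> w))) * w + exp (\<sigma> * of_real (ln (w \<bullet> w))) * h)) (at w)"
    by (rule has_derivative_transform_within_open[OF e, of "- {0}"]) (use False mpe in auto)
  \<comment> \<open>The logarithmic differential of \<open>w * cnj w\<close>; it separates the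
    complex-linear from the conjugate-linear part.\<close>
  have ww: "of_real ((h \<bullet> w + w \<bullet> h) / (w \<bullet> w)) = h / w + cnj h / cnj w" for h
  proof -
    have i: "complex_of_real (w \<bullet> w) = w * cnj w"
      by (simp add: complex_eq_iff inner_complex_def)
    have j: "complex_of_real (h \<bullet> w + w \<bullet> h) = h * cnj w + cnj h * w"
      by (simp add: complex_eq_iff inner_complex_def algebra_simps)
    show ?thesis using False by (simp only: of_real_divide i j) (simp add: field_simps)
  qed
  show ?thesis
    by (rule has_derivative_eq_rhs[OF ev], unfold ww mpe[OF False])
      (use False in \<open>auto simp: fun_eq_iff field_simps\<close>)
qed

text \<open>Only the holomorphic power is lowered, because formally the derivative of
  \<open>abs_pow l \<sigma>\<close> with respect to \<open>l\<close> is
  \<open>\<sigma> * abs_pow l \<sigma> / l\<close>. The scalar \<open>\<sigma> + Suc m\<close> is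
  the factor that each integration by parts costs, and its zeros are the candidate poles.\<close>

lemma wirt_along_abs_pow_power:
  assumes "Re \<sigma> > 0"
  shows "wirt_along e (\<lambda>z. abs_pow (lform c z) \<sigma> * lform c z ^ Suc m) (\<lambda>z. (\<sigma> + of_nat (Suc m)) * lform c e * (abs_pow (lform c z) \<sigma> * lform c z ^ m))"
proof -
  have cm: "continuous_on UNIV (\<lambda>z. abs_pow (lform c z) \<sigma>)"
    by (rule continuous_on_compose2[OF continuous_abs_pow[OF assms]]) (auto intro: continuous_intros)
  have 1: "wirt_along e (\<lambda>z. abs_pow (lform c z) \<sigma> * lform c z) (\<lambda>z. ((\<sigma> + 1) * abs_pow (lform c z) \<sigma>) * lform c e)"
  proof (rule wirt_along_compose_lform[OF has_derivative_abs_pow_mult[OF assms]])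
    show "continuous_on UNIV (\<lambda>w. (\<sigma> + 1) * abs_pow w \<sigma>)" by (intro continuous_intros continuous_abs_pow assms)
    have "loc_bdd (\<lambda>z. \<sigma> * abs_pow (lform c z) \<sigma>)" by (intro loc_bdd_continuous continuous_intros cm)
    moreover have "loc_bdd (\<lambda>z. lform c z / cnj (lform c z))"
      unfolding loc_bdd_def by (intro allI exI[of _ 1]) (auto simp: norm_divide)
    ultimately show "loc_bdd (\<lambda>z. \<sigma> * abs_pow (lform c z) \<sigma> * (lform c z / cnj (lform c z)))" by (rule loc_bdd_mult)
  qed
  have 2: "wirt_along e (\<lambda>z. lform c z ^ m) (\<lambda>z. of_nat m * lform c e * lform c z ^ (m - 1))"
  proof -
    have "wirt_along e (\<lambda>z. lform c z ^ m) (\<lambda>z. (of_nat m * lform c z ^ (m - 1)) * lform c e)"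
    proof (rule wirt_along_compose_lform[where g="\<lambda>w. w ^ m" and g'="\<lambda>w. of_nat m * w ^ (m - 1)" and gb="\<lambda>_. 0"])
      show "((\<lambda>w. w ^ m) has_derivative (\<lambda>h. of_nat m * w ^ (m - 1) * h + 0 * cnj h)) (at w)" for w :: complex
        by (rule has_derivative_eq_rhs, rule derivative_intros, rule derivative_intros) (auto simp: mult_ac)
    qed (auto intro!: continuous_intros simp: loc_bdd_def)
    thus ?thesis by (simp add: mult_ac)
  qed
  have "((\<sigma> + 1) * abs_pow (lform c z) \<sigma>) * lform c e * lform c z ^ m + (abs_pow (lform c z) \<sigma> * lform c z) * (of_nat m * lform c e * lform c z ^ (m - 1))
     = (\<sigma> + of_nat (Suc m)) * lform c e * (abs_pow (lform c z) \<sigma> * lform c z ^ m)" for z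
    by (cases m) (auto simp: algebra_simps)
  thus ?thesis using wirt_along_mult[OF 1 2] by (simp add: mult_ac)
qed

text \<open>\<open>A\<close> is a linear combination of the real directional derivatives
  \<open>P\<close> along \<open>e\<close> and \<open>Q\<close> along \<open>\<i> *s e\<close>, and
  each of these has integral zero.\<close>

lemma wirt_along_integral_eq_0:
  assumes "wirt_along e G A" and supp: "\<And>z. norm z > R \<Longrightarrow> G z = 0"
  shows "A \<in> borel_measurable borel" "integrable lborel A" "integral\<^sup>L lborel A = 0"
proof -
  obtain B where cont: "continuous_on UNIV G" and loc_bdd: "loc_bdd A" "loc_bdd B" and
    d: "\<And>z. ((\<lambda>w. G (z + w *s e)) has_derivative (\<lambda>h. A z * h + B z * cnj h)) (at 0)"
    using assms(1) unfolding wirt_along_def by blast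
  \<comment> \<open>\<open>A\<close> and \<open>B\<close> are only known to be bounded on bounded
    sets; since they vanish outside the support of \<open>G\<close>, the bounds become global.
    Evaluating the zero derivative at 1 and \<open>\<i>\<close> separates the two
    coefficients.\<close>
  have zero: "A z = 0 \<and> B z = 0" if "norm z > R" for z
  proof -
    have c: "continuous_on UNIV (\<lambda>w::complex. z + w *s e)"
      unfolding vector_scalar_mult_def by (intro continuous_intros continuous_on_vec_lambda)
    have o: "open {w::complex. norm (z + w *s e) > R}"
      by (intro open_Collect_less continuous_intros c)
    have "((\<lambda>w. G (z + w *s e)) has_derivative (\<lambda>_. 0)) (at 0)"
      using has_derivative_transform_within_open[of "\<lambda>_. 0" "\<lambda>_. 0" 0 UNIV "{w. norm (z + w *s e) > R}" "\<lambda>w. G (z + w *s e)"] o supp that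
      by simp
    hence eq: "(\<lambda>h. A z * h + B z * cnj h) = (\<lambda>_. 0)" using d[of z] has_derivative_unique by blast
    have "A z * 1 + B z * cnj 1 = 0" using fun_cong[OF eq, of 1] by simp
    moreover have "A z * \<i> + B z * cnj \<i> = 0" using fun_cong[OF eq, of \<i>] by simp
    hence "\<i> * (A z - B z) = 0" by (simp add: algebra_simps)
    ultimately show ?thesis by (auto simp: add_eq_0_iff2)
  qed
  obtain CA CB where C: "\<And>z. norm z \<le> R \<Longrightarrow> norm (A z) \<le> CA" "\<And>z. norm z \<le> R \<Longrightarrow> norm (B z) \<le> CB"
    using loc_bdd unfolding loc_bdd_def by metis
  have bA: "norm (A z) \<le> \<bar>CA\<bar>" and bB: "norm (B z) \<le> \<bar>CB\<bar>" for z
    using C[of z] zero[of z] by (cases "norm z > R"; force)+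
  have dir: "((\<lambda>t. G (z + t *\<^sub>R (u *s e))) has_vector_derivative (A z * u + B z * cnj u)) (at 0)" for z u
  proof -
    have 1: "((\<lambda>t::real. of_real t * u) has_derivative (\<lambda>t. of_real t * u)) (at 0)"
      by (auto intro!: derivative_eq_intros)
    have 2: "((\<lambda>w. G (z + w *s e)) has_derivative (\<lambda>h. A z * h + B z * cnj h)) (at (of_real 0 * u))"
      using d[of z] by simp
    have eq: "(of_real t * u) *s e = t *\<^sub>R (u *s e)" for t :: real
      by (simp add: vec_eq_iff scaleR_conv_of_real[where 'a=complex] mult.assoc)
    show ?thesis
      using diff_chain_at[OF 1 2] unfolding o_def eq has_vector_derivative_def
      by (simp add: scaleR_conv_of_real algebra_simps)
  qed
  have 1: "(\<lambda>z. A z * 1 + B z * cnj 1) \<in> borel_measurable borel \<and> integral\<^sup>L lborel (\<lambda>z. A z * 1 + B z * cnj 1) = 0"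
    by (rule integral_directional_derivative_eq_0[OF cont supp dir, where C="\<bar>CA\<bar> + \<bar>CB\<bar>"])
      (use bA bB in \<open>auto intro!: order_trans[OF norm_triangle_ineq] add_mono\<close>)
  have 2: "(\<lambda>z. A z * \<i> + B z * cnj \<i>) \<in> borel_measurable borel \<and> integral\<^sup>L lborel (\<lambda>z. A z * \<i> + B z * cnj \<i>) = 0"
    by (rule integral_directional_derivative_eq_0[OF cont supp dir, where C="\<bar>CA\<bar> + \<bar>CB\<bar>"])
      (use bA bB in \<open>auto intro!: order_trans[OF norm_triangle_ineq] order_trans[OF norm_triangle_ineq4] add_mono simp: norm_mult\<close>)
  define P Q where "P = (\<lambda>z. A z * 1 + B z * cnj 1)" and "Q = (\<lambda>z. A z * \<i> + B z * cnj \<i>)"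
  have m [measurable]: "P \<in> borel_measurable borel" "Q \<in> borel_measurable borel"
    and i0: "integral\<^sup>L lborel P = 0" "integral\<^sup>L lborel Q = 0"
    using 1 2 by (auto simp: P_def Q_def)
  have Aeq: "A = (\<lambda>z. (1/2) * P z + (- \<i> / 2) * Q z)"
    by (auto simp: field_simps fun_eq_iff P_def Q_def)
  have i1: "integrable lborel P" "integrable lborel Q"
    by (rule integrable_bounded_support[where C="\<bar>CA\<bar> + \<bar>CB\<bar>" and R=R],
      use m bA bB zero in \<open>auto intro!: order_trans[OF norm_triangle_ineq] order_trans[OF norm_triangle_ineq4] add_mono simp: norm_mult P_def Q_def\<close>)+
  show "A \<in> borel_measurable borel" by (subst Aeq) measurable
  show "integrable lborel A" by (subst Aeq) (use i1 in auto)
  show "integral\<^sup>L lborel A = 0" using i1 i0 by (subst Aeq) (subst Bochner_Integration.integral_add, auto)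
qed

section \<open>Continuation by integration by parts\<close>

text \<open>Integrands that are smooth in \<open>z $ k\<close> but only continuous in \<open>z $ j\<close>, and vanish for small \<open>z $ j\<close>.\<close>

inductive test_family :: "2 \<Rightarrow> 2 \<Rightarrow> (complex \<Rightarrow> complex^2 \<Rightarrow> complex) \<Rightarrow> bool" for j k where
  base: "continuous_on UNIV \<gamma> \<Longrightarrow> \<epsilon> > 0 \<Longrightarrow> (\<And>w. cmod w < \<epsilon> \<Longrightarrow> \<gamma> w = 0) \<Longrightarrow> (\<And>w. cmod w > R \<Longrightarrow> \<gamma> w = 0)
    \<Longrightarrow> \<eta> \<in> Cc_infinity \<Longrightarrow> test_family j k (\<lambda>s z. \<gamma> (z $ j) * \<eta> (z $ k))"
| add: "test_family j k \<tau> \<Longrightarrow> test_family j k \<tau>' \<Longrightarrow> test_family j k (\<lambda>s z. \<tau> s z + \<tau>' s z)"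
| const: "test_family j k \<tau> \<Longrightarrow> test_family j k (\<lambda>s z. c * \<tau> s z)"
| param: "test_family j k \<tau> \<Longrightarrow> test_family j k (\<lambda>s z. s * \<tau> s z)"
| coord: "test_family j k \<tau> \<Longrightarrow> test_family j k (\<lambda>s z. z $ i * \<tau> s z)"

lemma norm_vec2_le: "norm (z :: complex^2) \<le> cmod (z $ 1) + cmod (z $ 2)"
  unfolding norm_vec_def using L2_set_le_sum[of UNIV "\<lambda>i. cmod (z $ i)"] by (simp add: UNIV_2)

lemma test_family_zero: "test_family j k (\<lambda>s z. 0)"
proof -
  have "C_k n (\<lambda>_::complex. 0::complex)" for n
    by (induction n) (auto simp: frechet_derivative_const)
  hence "(\<lambda>_::complex. 0::complex) \<in> Cc_infinity" by (intro Cc_infinityI[where R=0]) auto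
  hence "test_family j k (\<lambda>s z. (\<lambda>_. 0) (z $ j) * (\<lambda>_. 0) (z $ k))"
    by (intro base[where \<epsilon>=1 and R=0]) auto
  thus ?thesis by simp
qed

lemma test_family_sum: "finite A \<Longrightarrow> (\<And>i. i \<in> A \<Longrightarrow> test_family j k (t i)) \<Longrightarrow> test_family j k (\<lambda>s z. \<Sum>i\<in>A. t i s z)"
  by (induction A rule: finite_induct) (auto simp: test_family_zero intro: test_family.add)

lemma test_family_affine:
  assumes "test_family j k \<tau>"
  shows "test_family j k (\<lambda>s z. (x * s + y) * \<tau> s z)"
proof -
  have "test_family j k (\<lambda>s z. x * (s * \<tau> s z) + y * \<tau> s z)"
    by (intro test_family.add test_family.const test_family.param assms)
  thus ?thesis by (simp add: algebra_simps)
qed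

lemma test_family_affine_prod: "finite A \<Longrightarrow> test_family j k \<tau> \<Longrightarrow> test_family j k (\<lambda>s z. (\<Prod>i\<in>A. x i * s + y i) * \<tau> s z)"
proof (induction A rule: finite_induct)
  case (insert b A)
  thus ?case using test_family_affine[of j k "\<lambda>s z. (\<Prod>i\<in>A. x i * s + y i) * \<tau> s z" "x b" "y b"] by (simp add: mult.assoc)
qed simp

lemma test_family_support:
  assumes "test_family j k \<tau>" "j \<noteq> k"
  shows "\<exists>R \<epsilon>. \<epsilon> > 0 \<and> (\<forall>s z. \<tau> s z \<noteq> 0 \<longrightarrow> norm z \<le> R \<and> \<epsilon> \<le> cmod (z $ j))"
  using assms(1)
proof induction
  case (base \<gamma> \<epsilon> R \<eta>)
  obtain R' where R': "\<And>w. cmod w > R' \<Longrightarrow> \<eta> w = 0" using base Cc_infinity_supportE by metis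
  have "norm z \<le> R + R' \<and> \<epsilon> \<le> cmod (z $ j)" if nz: "\<gamma> (z $ j) * \<eta> (z $ k) \<noteq> 0" for z
  proof -
    have g: "\<gamma> (z $ j) \<noteq> 0" and h: "\<eta> (z $ k) \<noteq> 0" using nz by auto
    have "cmod (z $ j) \<le> R" using g base(4)[of "z $ j"] by linarith
    moreover have "cmod (z $ k) \<le> R'" using h R'[of "z $ k"] by linarith
    moreover have "\<epsilon> \<le> cmod (z $ j)" using g base(3)[of "z $ j"] by linarith
    moreover have "cmod (z $ 1) + cmod (z $ 2) = cmod (z $ j) + cmod (z $ k)"
      using assms(2) exhaust_2[of j] exhaust_2[of k] by auto
    ultimately show ?thesis using norm_vec2_le[of z] by linarith
  qed
  thus ?case using base(2) by blast
next
  case (add \<tau> \<tau>')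
  then obtain R \<epsilon> R' \<epsilon>' where "\<epsilon> > 0" "\<epsilon>' > 0" and
    1: "\<And>s z. \<tau> s z \<noteq> 0 \<Longrightarrow> norm z \<le> R \<and> \<epsilon> \<le> cmod (z $ j)"
    "\<And>s z. \<tau>' s z \<noteq> 0 \<Longrightarrow> norm z \<le> R' \<and> \<epsilon>' \<le> cmod (z $ j)" by blast
  moreover have "norm z \<le> max R R' \<and> min \<epsilon> \<epsilon>' \<le> cmod (z $ j)" if "\<tau> s z + \<tau>' s z \<noteq> 0" for s z
  proof -
    have "\<tau> s z \<noteq> 0 \<or> \<tau>' s z \<noteq> 0" using that by auto
    thus ?thesis using 1[of s z] by auto
  qed
  ultimately show ?case by (intro exI[of _ "max R R'"] exI[of _ "min \<epsilon> \<epsilon>'"]) auto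
qed (metis mult_eq_0_iff)+

lemma continuous_on_nth_compose:
  fixes f :: "'a::topological_space \<Rightarrow> complex^2"
  assumes "continuous_on UNIV \<gamma>" "continuous_on S f"
  shows "continuous_on S (\<lambda>x. \<gamma> (f x $ i))"
  by (rule continuous_on_compose2[OF assms(1)]) (auto intro!: continuous_on_component assms)

lemma test_family_continuous: "test_family j k \<tau> \<Longrightarrow> continuous_on UNIV (\<lambda>p. \<tau> (fst p) (snd p))"
proof (induction rule: test_family.induct)
  case (base \<gamma> \<epsilon> R \<eta>)
  show ?case
    by (intro continuous_intros continuous_on_nth_compose[OF base(1)]
          continuous_on_nth_compose[OF Cc_infinity_continuous[OF base(5)]])
qed (auto intro!: continuous_intros continuous_on_component)

lemma test_family_continuous2: "test_family j k \<tau> \<Longrightarrow> continuous_on UNIV (\<tau> s)"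
  using continuous_on_compose2[OF test_family_continuous, of j k \<tau> UNIV "\<lambda>z. (s, z)"]
    continuous_on_Pair[OF continuous_on_const continuous_on_id]
  by auto

lemma test_family_holomorphic: "test_family j k \<tau> \<Longrightarrow> (\<lambda>s. \<tau> s z) holomorphic_on S"
  by (induction rule: test_family.induct) (auto intro!: holomorphic_intros)

lemma test_family_bounded:
  assumes "test_family j k \<tau>" "j \<noteq> k"
  shows "\<exists>C\<ge>0. \<forall>t\<in>cball s r. \<forall>z. norm (\<tau> t z) \<le> C"
proof -
  obtain R \<epsilon> where R: "\<And>s z. \<tau> s z \<noteq> 0 \<Longrightarrow> norm z \<le> R" using test_family_support[OF assms] by blast
  have "compact ((\<lambda>p. \<tau> (fst p) (snd p)) ` (cball s r \<times> cball 0 R))"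
    by (intro compact_continuous_image compact_Times continuous_on_subset[OF test_family_continuous[OF assms(1)]]) auto
  then obtain C where C: "C > 0" "\<And>p. p \<in> cball s r \<times> cball 0 R \<Longrightarrow> norm (\<tau> (fst p) (snd p)) \<le> C"
    using bounded_pos compact_imp_bounded by (metis (no_types, lifting) imageI)
  have "norm (\<tau> t z) \<le> C" if "t \<in> cball s r" for t z
    using C(1) C(2)[of "(t, z)"] R[of t z] that by (cases "\<tau> t z = 0") auto
  thus ?thesis using C(1) by (intro exI[of _ C]) auto
qed

text \<open>Differentiation along \<open>z $ k\<close> never touches the factor in
  \<open>z $ j\<close>, which is merely continuous; the smooth factor in \<open>z $ k\<close> can be
  differentiated indefinitely.\<close>

lemma test_family_wirt_along:
  assumes "test_family j k \<tau>" "j \<noteq> k"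
  shows "\<exists>\<tau>'. test_family j k \<tau>' \<and> (\<forall>s. wirt_along (axis k 1) (\<tau> s) (\<tau>' s))"
  using assms(1)
proof induction
  case (base \<gamma> \<epsilon> R \<eta>)
  have jk: "axis k (1::complex) $ j = 0" "axis k (1::complex) $ k = 1" using assms(2) by (auto simp: axis_def)
  have "wirt_along (axis k 1) (\<lambda>z. \<gamma> (z $ j)) (\<lambda>_. 0)"
    by (rule wirt_along_constant_along) (use base in \<open>auto intro!: continuous_on_nth_compose continuous_intros simp: jk\<close>)
  from wirt_along_mult[OF this wirt_along_test[OF base(5), of "axis k 1" k]]
  have "wirt_along (axis k 1) (\<lambda>z. \<gamma> (z $ j) * \<eta> (z $ k)) (\<lambda>z. \<gamma> (z $ j) * wirt \<eta> (z $ k))"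
    by (simp add: jk)
  moreover have "test_family j k (\<lambda>s z. \<gamma> (z $ j) * wirt \<eta> (z $ k))"
    by (rule test_family.base[OF base(1-4) wirt_Cc_infinity(1)[OF base(5)]])
  ultimately show ?case by blast
next
  case (add \<tau> \<tau>')
  then obtain t t' where 1: "test_family j k t" "\<And>s. wirt_along (axis k 1) (\<tau> s) (t s)" "test_family j k t'" "\<And>s. wirt_along (axis k 1) (\<tau>' s) (t' s)"
    by blast
  show ?case using test_family.add[OF 1(1,3)] wirt_along_add[OF 1(2,4)] by blast
next
  case (const \<tau> c)
  then obtain \<tau>' where 1: "test_family j k \<tau>'" "\<And>s. wirt_along (axis k 1) (\<tau> s) (\<tau>' s)" by blast
  from wirt_along_mult[OF wirt_along_const 1(2)] have "wirt_along (axis k 1) (\<lambda>z. c * \<tau> s z) (\<lambda>z. c * \<tau>' s z)" for s by simp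
  thus ?case using test_family.const[OF 1(1)] by blast
next
  case (param \<tau>)
  then obtain \<tau>' where 1: "test_family j k \<tau>'" "\<And>s. wirt_along (axis k 1) (\<tau> s) (\<tau>' s)" by blast
  from wirt_along_mult[OF wirt_along_const 1(2)] have "wirt_along (axis k 1) (\<lambda>z. s * \<tau> s z) (\<lambda>z. s * \<tau>' s z)" for s by simp
  thus ?case using test_family.param[OF 1(1)] by blast
next
  case (coord \<tau> i)
  then obtain \<tau>' where 1: "test_family j k \<tau>'" "\<And>s. wirt_along (axis k 1) (\<tau> s) (\<tau>' s)" by blast
  have "test_family j k (\<lambda>s z. (axis k 1 $ i) * \<tau> s z + z $ i * \<tau>' s z)"
    by (intro test_family.add test_family.const test_family.coord 1(1) coord)
  thus ?case using wirt_along_mult[OF wirt_along_nth 1(2)] by blast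
qed

text \<open>The reason for requiring \<open>\<gamma>\<close> to vanish near 0:
  \<open>\<gamma> w / w\<close> is then again continuous with the same support properties.
  Divisibility by powers of \<open>z $ j\<close> is what the ideal membership below turns into
  divisibility by products of forms.\<close>

lemma test_family_divide:
  assumes "test_family j k \<tau>"
  shows "\<exists>\<tau>'. test_family j k \<tau>' \<and> (\<forall>s z. \<tau> s z = z $ j * \<tau>' s z)"
  using assms
proof induction
  case (base \<gamma> \<epsilon> R \<eta>)
  have "continuous_on UNIV (\<lambda>w. \<gamma> w / w)"
  proof (intro continuous_at_imp_continuous_on ballI)
    fix w :: complex
    show "isCont (\<lambda>w. \<gamma> w / w) w"
    proof (cases "w = 0")
      case False
      thus ?thesis using base(1) by (auto intro!: continuous_intros simp: continuous_on_eq_continuous_at)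
    next
      case True
      have "\<forall>\<^sub>F w in nhds 0. w \<in> ball (0::complex) \<epsilon>" by (rule eventually_nhds_in_open) (use base in auto)
      hence "\<forall>\<^sub>F w in nhds 0. \<gamma> w / w = 0" by eventually_elim (use base(3) in auto)
      thus ?thesis using True by (subst isCont_cong[where g="\<lambda>_. 0"]) auto
    qed
  qed
  hence "test_family j k (\<lambda>s z. (\<lambda>w. \<gamma> w / w) (z $ j) * \<eta> (z $ k))"
    by (rule test_family.base[where \<epsilon>=\<epsilon> and R=R]) (use base in auto)
  moreover have "\<gamma> w = w * (\<gamma> w / w)" for w using base(2) base(3)[of 0] by (cases "w = 0") auto
  hence "\<gamma> (z $ j) * \<eta> (z $ k) = z $ j * (\<gamma> (z $ j) / z $ j * \<eta> (z $ k))" for z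
    by (metis mult.assoc)
  ultimately show ?case by blast
next
  case (add \<tau> \<tau>')
  then obtain t t' where "test_family j k t" "test_family j k t'" "\<And>s z. \<tau> s z = z $ j * t s z" "\<And>s z. \<tau>' s z = z $ j * t' s z"
    by blast
  thus ?case by (intro exI[of _ "\<lambda>s z. t s z + t' s z"]) (auto intro: test_family.add simp: algebra_simps)
next
  case (const \<tau> c)
  then obtain t where "test_family j k t" "\<And>s z. \<tau> s z = z $ j * t s z" by blast
  thus ?case by (intro exI[of _ "\<lambda>s z. c * t s z"]) (auto intro: test_family.const)
next
  case (param \<tau>)
  then obtain t where "test_family j k t" "\<And>s z. \<tau> s z = z $ j * t s z" by blast
  thus ?case by (intro exI[of _ "\<lambda>s z. s * t s z"]) (auto intro: test_family.param)
next
  case (coord \<tau> i)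
  then obtain t where "test_family j k t" "\<And>s z. \<tau> s z = z $ j * t s z" by blast
  thus ?case by (intro exI[of _ "\<lambda>s z. z $ i * t s z"]) (auto intro: test_family.coord)
qed

lemma test_family_divide_power:
  assumes "test_family j k \<tau>"
  shows "\<exists>\<tau>'. test_family j k \<tau>' \<and> (\<forall>s z. \<tau> s z = (z $ j) ^ n * \<tau>' s z)"
proof (induction n)
  case 0
  thus ?case using assms by auto
next
  case (Suc n)
  then obtain \<tau>' where "test_family j k \<tau>'" "\<And>s z. \<tau> s z = (z $ j) ^ n * \<tau>' s z" by blast
  moreover obtain \<tau>'' where "test_family j k \<tau>''" "\<And>s z. \<tau>' s z = z $ j * \<tau>'' s z" using test_family_divide calculation by blast
  ultimately show ?case by (intro exI[of _ \<tau>'']) auto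
qed

section \<open>The ideal generated by products of all but one form\<close>

text \<open>Polynomials as functions, generated by operations under which multiplication of test
  families is easily checked; their coefficients are never inspected.\<close>

inductive polyfun :: "(complex^2 \<Rightarrow> complex) \<Rightarrow> bool" where
  const: "polyfun (\<lambda>z. c)"
| coord: "polyfun (\<lambda>z. z $ i)"
| add: "polyfun p \<Longrightarrow> polyfun p' \<Longrightarrow> polyfun (\<lambda>z. p z + p' z)"
| mult: "polyfun p \<Longrightarrow> polyfun p' \<Longrightarrow> polyfun (\<lambda>z. p z * p' z)"

lemma polyfun_lform: "polyfun (lform c)"
proof -
  have "polyfun (\<lambda>z. c $ 1 * z $ 1 + c $ 2 * z $ 2)" by (intro polyfun.intros)
  moreover have "lform c = (\<lambda>z. c $ 1 * z $ 1 + c $ 2 * z $ 2)" by (auto simp: lform_def)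
  ultimately show ?thesis by simp
qed

lemma polyfun_prod: "finite A \<Longrightarrow> (\<And>i. i \<in> A \<Longrightarrow> polyfun (p i)) \<Longrightarrow> polyfun (\<lambda>z. \<Prod>i\<in>A. p i z)"
  by (induction A rule: finite_induct) (auto intro: polyfun.intros)

lemma test_family_polyfun: "polyfun p \<Longrightarrow> test_family j k \<tau> \<Longrightarrow> test_family j k (\<lambda>s z. p z * \<tau> s z)"
proof (induction arbitrary: \<tau> rule: polyfun.induct)
  case (add p p')
  hence "test_family j k (\<lambda>s z. p z * \<tau> s z + p' z * \<tau> s z)" by (intro test_family.add) auto
  thus ?case by (simp add: algebra_simps)
next
  case (mult p p')
  have "test_family j k (\<lambda>s z. p z * (p' z * \<tau> s z))" by (intro mult.IH mult.prems)
  thus ?case by (simp add: mult.assoc)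
qed (auto intro: test_family.intros)

lemma lform_expand: "j \<noteq> k \<Longrightarrow> lform c z = c $ j * z $ j + c $ k * z $ k" for j k :: 2
  using exhaust_2[of j] exhaust_2[of k] by (auto simp: lform_def add.commute)

text \<open>A power of the coordinate \<open>z $ j\<close> lies in the ideal generated by the products
  that omit one of the linear forms: induct on the number of lines.\<close>

lemma coord_power_in_ideal:
  fixes j k :: 2
  assumes "finite J" "J \<noteq> {}" "j \<noteq> k"
    and "\<And>i l. i \<in> J \<Longrightarrow> l \<in> J \<Longrightarrow> i \<noteq> l \<Longrightarrow> c i $ j * c l $ k \<noteq> c i $ k * c l $ j"
  shows "\<exists>A. (\<forall>i\<in>J. polyfun (A i)) \<and>
    (\<forall>z. (z $ j) ^ (card J - 1) = (\<Sum>i\<in>J. A i z * (\<Prod>l\<in>J-{i}. lform (c l) z)))"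
  using assms(1,2,4)
proof (induction J rule: finite_ne_induct)
  case (singleton x)
  show ?case by (intro exI[of _ "\<lambda>_ _. 1"]) (auto intro: polyfun.const)
next
  case (insert x J)
  have "\<exists>A. (\<forall>i\<in>J. polyfun (A i)) \<and> (\<forall>z. (z $ j) ^ (card J - 1) = (\<Sum>i\<in>J. A i z * (\<Prod>l\<in>J-{i}. lform (c l) z)))"
    by (rule insert.IH) (use insert.prems in auto)
  then obtain A where A: "\<And>i. i \<in> J \<Longrightarrow> polyfun (A i)"
    "\<And>z. (z $ j) ^ (card J - 1) = (\<Sum>i\<in>J. A i z * (\<Prod>l\<in>J-{i}. lform (c l) z))"
    by blast
  define D where "D i = c i $ j * c x $ k - c i $ k * c x $ j" for i
  have D: "D i \<noteq> 0" if "i \<in> J" for i using insert.prems[of i x] that insert.hyps by (auto simp: D_def)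
  \<comment> \<open>Cramer's rule for the two forms \<open>c i\<close> and \<open>c x\<close>, with
    determinant \<open>D i\<close>: a coordinate is a combination of any two independent
    forms.\<close>
  have zj: "z $ j = (c x $ k / D i) * lform (c i) z - (c i $ k / D i) * lform (c x) z" if "i \<in> J" for i and z :: "complex^2"
    using D[OF that] by (simp add: lform_expand[OF assms(3)] divide_simps) (simp add: D_def algebra_simps)
  \<comment> \<open>The old identity is multiplied by \<open>z $ j\<close> and \<open>zj\<close> is
    inserted. The term with \<open>lform (c i)\<close> completes the product over
    \<open>J - {i}\<close> to the one over \<open>J\<close>, which omits \<open>x\<close>; the term
    with \<open>lform (c x)\<close> gives the product omitting \<open>i\<close>.\<close>
  define B where "B i = (if i = x then (\<lambda>z. \<Sum>i\<in>J. A i z * (c x $ k / D i)) else (\<lambda>z. A i z * (- c i $ k / D i)))" for i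
  have "polyfun (\<lambda>z. \<Sum>i\<in>J'. A i z * (c x $ k / D i))" if "J' \<subseteq> J" for J'
    using finite_subset[OF that insert.hyps(1)] that
    by (induction J' rule: finite_induct) (auto intro!: polyfun.intros A simp del: times_divide_eq_right)
  moreover have "polyfun (\<lambda>z. A i z * (- c i $ k / D i))" if "i \<in> J" for i
    by (intro polyfun.mult polyfun.const A that)
  ultimately have "polyfun (B i)" if "i \<in> insert x J" for i
    using that unfolding B_def by (cases "i = x") (simp_all only: if_True if_False insert_iff simp_thms order_refl)
  moreover have "(z $ j) ^ (card (insert x J) - 1) = (\<Sum>i\<in>insert x J. B i z * (\<Prod>l\<in>insert x J-{i}. lform (c l) z))" for z
  proof -
    define q where "q i = (\<Prod>l\<in>J-{i}. lform (c l) z)" for i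
    define qJ where "qJ = (\<Prod>l\<in>J. lform (c l) z)"
    have qJ: "qJ = lform (c i) z * q i" if "i \<in> J" for i
      using prod.remove[OF insert.hyps(1) that] by (simp add: q_def qJ_def)
    have qi: "(\<Prod>l\<in>insert x J-{i}. lform (c l) z) = lform (c x) z * q i" if "i \<in> J" for i
    proof -
      have "insert x J - {i} = insert x (J - {i})" using that insert.hyps by auto
      thus ?thesis using insert.hyps by (simp add: q_def)
    qed
    have "card J > 0" using insert.hyps by (simp add: card_gt_0_iff)
    hence "(z $ j) ^ (card (insert x J) - 1) = (z $ j) ^ (card J - 1) * z $ j"
      using insert.hyps by (cases "card J") auto
    also have "\<dots> = (\<Sum>i\<in>J. A i z * q i * z $ j)" unfolding A(2) q_def sum_distrib_right ..
    also have "\<dots> = (\<Sum>i\<in>J. A i z * (c x $ k / D i) * qJ + B i z * (\<Prod>l\<in>insert x J-{i}. lform (c l) z))"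
    proof (intro sum.cong refl)
      fix i assume i: "i \<in> J"
      hence ix: "i \<noteq> x" using insert.hyps by auto
      have "A i z * q i * z $ j = A i z * q i * ((c x $ k / D i) * lform (c i) z - (c i $ k / D i) * lform (c x) z)"
        using zj[OF i, of z] by simp
      thus "A i z * q i * z $ j = A i z * (c x $ k / D i) * qJ + B i z * (\<Prod>l\<in>insert x J-{i}. lform (c l) z)"
        using ix by (simp add: qi[OF i] qJ[OF i] B_def algebra_simps)
    qed
    also have "\<dots> = B x z * qJ + (\<Sum>i\<in>J. B i z * (\<Prod>l\<in>insert x J-{i}. lform (c l) z))"
      by (simp add: sum.distrib B_def sum_distrib_right)
    also have "qJ = (\<Prod>l\<in>insert x J-{x}. lform (c l) z)" using insert.hyps by (simp add: qJ_def)
    finally show ?thesis using insert.hyps by simp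
  qed
  ultimately show ?case by blast
qed

section \<open>Gaining factors of the defining polynomial\<close>

text \<open>\<open>indep\<close> says that the lines are pairwise distinct. \<open>card3\<close> is
  the form in which essentiality and indecomposability enter, since two lines can be made the
  coordinate axes.\<close>

locale lines =
  fixes I :: "nat set" and c :: "nat \<Rightarrow> complex^2" and a :: "nat \<Rightarrow> nat"
  assumes finI: "finite I" and a_pos: "\<And>i. i \<in> I \<Longrightarrow> a i > 0"
    and indep: "\<And>i j. i \<in> I \<Longrightarrow> j \<in> I \<Longrightarrow> i \<noteq> j \<Longrightarrow> c i $ 1 * c j $ 2 \<noteq> c i $ 2 * c j $ 1"
    and card3: "card I \<ge> 3"
begin

definition F :: "complex \<Rightarrow> complex^2 \<Rightarrow> complex" where
  "F s z = (\<Prod>i\<in>I. abs_pow (lform (c i) z) (of_nat (a i) * s))"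

lemma F_measurable [measurable]: "F s \<in> borel_measurable borel"
  unfolding F_def by measurable

lemma continuous_abs_pow_lform: "Re \<sigma> > 0 \<Longrightarrow> continuous_on UNIV (\<lambda>z. abs_pow (lform v z) \<sigma>)"
  by (rule continuous_on_compose2[OF continuous_abs_pow]) (auto intro: continuous_intros)

lemma F_continuous: "Re s > 0 \<Longrightarrow> continuous_on UNIV (F s)"
  unfolding F_def by (intro continuous_on_prod continuous_abs_pow_lform) (use a_pos in auto)

lemma F_holomorphic: "(\<lambda>s. F s z) holomorphic_on S"
  unfolding F_def by (intro holomorphic_intros)

end

text \<open>\<open>j\<close> is the coordinate kept away from 0 by the test families and
  \<open>k\<close> the one along which they are differentiated. Both choices occur, one for each
  term of the split test function.\<close>

locale lines_dir = lines +
  fixes j k :: 2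
  assumes jk: "j \<noteq> k"
begin

text \<open>The forms outside \<open>J\<close> are multiples of \<open>z $ j\<close> and do not
  vanish on the support of a test family, so only those in \<open>J\<close> cause
  singularities.\<close>

definition J :: "nat set" where "J = {i \<in> I. c i $ k \<noteq> 0}"
definition q :: "complex^2 \<Rightarrow> complex" where "q z = (\<Prod>i\<in>J. lform (c i) z)"
definition Q :: "nat \<Rightarrow> complex^2 \<Rightarrow> complex" where "Q i z = (\<Prod>l\<in>J-{i}. lform (c l) z)"
definition D :: "nat \<Rightarrow> complex \<Rightarrow> complex" where "D m s = (\<Prod>i\<in>J. of_nat (a i) * s + of_nat (Suc m))"

text \<open>\<open>gain m \<tau>\<close>: at the price of the factor \<open>D m\<close>, one more factor of \<open>q\<close> is gained in the integrand.\<close>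

definition gain :: "nat \<Rightarrow> (complex \<Rightarrow> complex^2 \<Rightarrow> complex) \<Rightarrow> bool" where
  "gain m \<tau> \<longleftrightarrow> (\<exists>\<tau>'. test_family j k \<tau>' \<and> (\<forall>s. Re s > 0 \<longrightarrow>
     D m s * (\<integral>z. F s z * q z ^ m * \<tau> s z \<partial>lborel) = (\<integral>z. F s z * q z ^ Suc m * \<tau>' s z \<partial>lborel)))"

lemma finJ: "finite J" "J \<subseteq> I" using finI by (auto simp: J_def)

lemma q_Q: "i \<in> J \<Longrightarrow> q z = lform (c i) z * Q i z"
  unfolding q_def Q_def using finJ by (simp add: prod.remove)

lemma q_continuous: "continuous_on S q"
  unfolding q_def by (intro continuous_on_prod continuous_intros)

lemma integrable_F_test_family:
  assumes "test_family j k \<tau>" "Re s > 0"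
  shows "integrable lborel (\<lambda>z. F s z * q z ^ m * \<tau> s z)"
proof -
  obtain R \<epsilon> where R: "\<And>s z. \<tau> s z \<noteq> 0 \<Longrightarrow> norm z \<le> R" using test_family_support[OF assms(1) jk] by blast
  have c: "continuous_on UNIV (\<lambda>z. F s z * q z ^ m * \<tau> s z)"
    by (intro continuous_intros F_continuous q_continuous test_family_continuous2[OF assms(1)] assms(2))
  have z: "F s z * q z ^ m * \<tau> s z = 0" if "norm z > R" for z using R[of s z] that by force
  obtain C where "\<And>z. norm (F s z * q z ^ m * \<tau> s z) \<le> C"
    using continuous_compact_support_bounded[OF c z] by blast
  thus ?thesis using z by (intro integrable_bounded_support borel_measurable_continuous_onI c) auto
qed

lemma gain_add: "gain m \<tau> \<Longrightarrow> gain m \<tau>' \<Longrightarrow> test_family j k \<tau> \<Longrightarrow> test_family j k \<tau>' \<Longrightarrow> gain m (\<lambda>s z. \<tau> s z + \<tau>' s z)"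
proof -
  assume T: "test_family j k \<tau>" "test_family j k \<tau>'" and "gain m \<tau>" "gain m \<tau>'"
  then obtain t t' where t: "test_family j k t" "test_family j k t'" and
    e: "\<And>s. Re s > 0 \<Longrightarrow> D m s * (\<integral>z. F s z * q z ^ m * \<tau> s z \<partial>lborel) = (\<integral>z. F s z * q z ^ Suc m * t s z \<partial>lborel)"
      "\<And>s. Re s > 0 \<Longrightarrow> D m s * (\<integral>z. F s z * q z ^ m * \<tau>' s z \<partial>lborel) = (\<integral>z. F s z * q z ^ Suc m * t' s z \<partial>lborel)"
    unfolding gain_def by blast
  have "D m s * (\<integral>z. F s z * q z ^ m * (\<tau> s z + \<tau>' s z) \<partial>lborel) = (\<integral>z. F s z * q z ^ Suc m * (t s z + t' s z) \<partial>lborel)"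
    if "Re s > 0" for s
  proof -
    have "(\<integral>z. F s z * q z ^ m * (\<tau> s z + \<tau>' s z) \<partial>lborel) =
      (\<integral>z. F s z * q z ^ m * \<tau> s z \<partial>lborel) + (\<integral>z. F s z * q z ^ m * \<tau>' s z \<partial>lborel)"
      unfolding distrib_left by (rule Bochner_Integration.integral_add) (intro integrable_F_test_family T that)+
    moreover have "(\<integral>z. F s z * q z ^ Suc m * (t s z + t' s z) \<partial>lborel) =
      (\<integral>z. F s z * q z ^ Suc m * t s z \<partial>lborel) + (\<integral>z. F s z * q z ^ Suc m * t' s z \<partial>lborel)"
      unfolding distrib_left by (rule Bochner_Integration.integral_add) (intro integrable_F_test_family t that)+
    ultimately show ?thesis using e[OF that] by (simp only: distrib_left)
  qed
  thus ?thesis unfolding gain_def using test_family.add[OF t] by blast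
qed

lemma gain_sum:
  assumes "finite A" "\<And>i. i \<in> A \<Longrightarrow> gain m (t i)" "\<And>i. i \<in> A \<Longrightarrow> test_family j k (t i)"
  shows "gain m (\<lambda>s z. \<Sum>i\<in>A. t i s z)"
  using assms
proof (induction A rule: finite_induct)
  case empty
  show ?case unfolding gain_def by (intro exI[of _ "\<lambda>_ _. 0"]) (auto simp: test_family_zero)
next
  case (insert x A)
  have "gain m (\<lambda>s z. t x s z + (\<Sum>i\<in>A. t i s z))"
    using insert by (intro gain_add test_family_sum) auto
  thus ?case using insert by simp
qed

text \<open>If the factor \<open>q\<close> is already present, no integration by parts takes place:
  \<open>D m\<close> is a polynomial in \<open>s\<close> and is absorbed into the test family, which
  is allowed to depend on \<open>s\<close> in this way.\<close>

lemma gain_q: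
  assumes "test_family j k \<tau>"
  shows "gain m (\<lambda>s z. q z * \<tau> s z)"
proof -
  have "test_family j k (\<lambda>s z. D m s * \<tau> s z)"
    unfolding D_def by (rule test_family_affine_prod[OF finJ(1) assms])
  moreover have "D m s * (\<integral>z. F s z * q z ^ m * (q z * \<tau> s z) \<partial>lborel) = (\<integral>z. F s z * q z ^ Suc m * (D m s * \<tau> s z) \<partial>lborel)" for s
    by (subst integral_mult_right_zero[symmetric]) (simp add: mult_ac)
  ultimately show ?thesis unfolding gain_def by blast
qed

text \<open>In the derivative of \<open>F s * q ^ Suc m * Q i * \<tau>\<close> every term without a factor \<open>q ^ Suc m\<close>, except
  the one with \<open>Q i * Q i\<close>, contains \<open>Q l * Q i\<close> for some \<open>l \<noteq> i\<close>, which is a multiple of \<open>q\<close>.\<close>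

lemma gain_Q_square:
  assumes i: "i \<in> J" and T: "test_family j k \<tau>"
  shows "gain m (\<lambda>s z. (Q i z)\<^sup>2 * \<tau> s z)"
proof -
  define e :: "complex^2" where "e = axis k 1"
  have lfe: "lform (c l) e = c l $ k" for l
    using jk by (simp add: lform_expand[OF jk] e_def axis_def)
  have polQ: "polyfun (\<lambda>z. \<Prod>l\<in>B. lform (c l) z)" if "B \<subseteq> J" for B
    by (intro polyfun_prod polyfun_lform finite_subset[OF that finJ(1)])
  have T2: "test_family j k (\<lambda>s z. Q i z * \<tau> s z)" unfolding Q_def by (intro test_family_polyfun polQ T) auto
  obtain \<tau>2 where \<tau>2: "test_family j k \<tau>2" "\<And>s. wirt_along e (\<lambda>z. Q i z * \<tau> s z) (\<tau>2 s)"
    using test_family_wirt_along[OF T2 jk] unfolding e_def by blast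
  define w :: "nat \<Rightarrow> complex \<Rightarrow> complex" where "w l s = of_nat (a l) * s + of_nat (Suc m)" for l s
  define R where "R l z = (\<Prod>l'\<in>J-{i}-{l}. lform (c l') z)" for l z
  define \<tau>3 where "\<tau>3 = (\<lambda>s z. \<tau>2 s z + (\<Sum>l\<in>J-{i}. c l $ k * (w l s * (R l z * \<tau> s z))))"
  have T3: "test_family j k \<tau>3" unfolding \<tau>3_def w_def R_def
    by (intro test_family.add \<tau>2 test_family_sum test_family.const test_family_affine test_family_polyfun polQ T) (use finJ in auto)
  \<comment> \<open>The factors of \<open>D m\<close> belonging to the other lines are multiplied
    in, so that the price is the same for every \<open>i\<close> and the results can be
    added.\<close>
  define \<tau>4 where "\<tau>4 = (\<lambda>s z. (- 1 / c i $ k) * ((\<Prod>l\<in>J-{i}. w l s) * \<tau>3 s z))"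
  have T4: "test_family j k \<tau>4" unfolding \<tau>4_def w_def by (intro test_family.const test_family_affine_prod T3) (use finJ in auto)
  have "D m s * (\<integral>z. F s z * q z ^ m * ((Q i z)\<^sup>2 * \<tau> s z) \<partial>lborel) = (\<integral>z. F s z * q z ^ Suc m * \<tau>4 s z \<partial>lborel)"
    if s: "Re s > 0" for s
  proof -
    define \<sigma> where "\<sigma> l = of_nat (a l) * s" for l
    have \<sigma>: "Re (\<sigma> l) > 0" if "l \<in> I" for l using a_pos[OF that] s by (simp add: \<sigma>_def)
    define F0 where "F0 z = (\<Prod>l\<in>I-J. abs_pow (lform (c l) z) (\<sigma> l))" for z
    define F1 where "F1 z = (\<Prod>l\<in>J. abs_pow (lform (c l) z) (\<sigma> l))" for z
    have FF: "F s z = F0 z * F1 z" for z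
      unfolding F_def F0_def F1_def \<sigma>_def using prod.subset_diff[OF finJ(2) finI] by simp
    \<comment> \<open>The forms outside \<open>J\<close> do not involve \<open>z $ k\<close>; their
      powers behave as constants for this derivative.\<close>
    have "wirt_along e F0 (\<lambda>_. 0)"
    proof (rule wirt_along_constant_along)
      show "continuous_on UNIV F0" unfolding F0_def by (intro continuous_on_prod continuous_abs_pow_lform \<sigma>) auto
      show "F0 (z + u *s e) = F0 z" for z u
        unfolding F0_def by (intro prod.cong refl) (auto simp: J_def lform_expand[OF jk] e_def axis_def jk)
    qed
    moreover have "wirt_along e (\<lambda>z. \<Prod>l\<in>J. abs_pow (lform (c l) z) (\<sigma> l) * lform (c l) z ^ Suc m)
       (\<lambda>z. \<Sum>l\<in>J. ((\<sigma> l + of_nat (Suc m)) * lform (c l) e * (abs_pow (lform (c l) z) (\<sigma> l) * lform (c l) z ^ m)) *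
          (\<Prod>l'\<in>J-{l}. abs_pow (lform (c l') z) (\<sigma> l') * lform (c l') z ^ Suc m))"
      by (intro wirt_along_prod wirt_along_abs_pow_power \<sigma> finJ) (use finJ in auto)
    moreover have "(\<Prod>l\<in>J. abs_pow (lform (c l) z) (\<sigma> l) * lform (c l) z ^ Suc m) = F1 z * q z ^ Suc m" for z
      by (simp only: F1_def q_def prod.distrib prod_power_distrib)
    moreover have "(\<Sum>l\<in>J. ((\<sigma> l + of_nat (Suc m)) * lform (c l) e * (abs_pow (lform (c l) z) (\<sigma> l) * lform (c l) z ^ m)) *
          (\<Prod>l'\<in>J-{l}. abs_pow (lform (c l') z) (\<sigma> l') * lform (c l') z ^ Suc m)) =
       (\<Sum>l\<in>J. w l s * c l $ k * (F1 z * q z ^ m * Q l z))" for z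
    proof (intro sum.cong refl)
      fix l assume l: "l \<in> J"
      have "(\<Prod>l'\<in>J-{l}. abs_pow (lform (c l') z) (\<sigma> l') * lform (c l') z ^ Suc m) =
        (\<Prod>l'\<in>J-{l}. abs_pow (lform (c l') z) (\<sigma> l')) * Q l z ^ Suc m"
        by (simp only: Q_def prod.distrib prod_power_distrib)
      moreover have "F1 z = abs_pow (lform (c l) z) (\<sigma> l) * (\<Prod>l'\<in>J-{l}. abs_pow (lform (c l') z) (\<sigma> l'))"
        unfolding F1_def by (rule prod.remove[OF finJ(1) l])
      ultimately show "((\<sigma> l + of_nat (Suc m)) * lform (c l) e * (abs_pow (lform (c l) z) (\<sigma> l) * lform (c l) z ^ m)) *
          (\<Prod>l'\<in>J-{l}. abs_pow (lform (c l') z) (\<sigma> l') * lform (c l') z ^ Suc m) = w l s * c l $ k * (F1 z * q z ^ m * Q l z)"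
        by (simp add: q_Q[OF l] power_mult_distrib lfe w_def \<sigma>_def mult_ac)
    qed
    ultimately have dzF: "wirt_along e (\<lambda>z. F0 z * (F1 z * q z ^ Suc m)) (\<lambda>z. F0 z * (\<Sum>l\<in>J. w l s * c l $ k * (F1 z * q z ^ m * Q l z)))"
      using wirt_along_mult[of e F0 "\<lambda>_. 0"] by simp
    define A where "A z = F0 z * (\<Sum>l\<in>J. w l s * c l $ k * (F1 z * q z ^ m * Q l z)) * (Q i z * \<tau> s z)
      + F0 z * (F1 z * q z ^ Suc m) * \<tau>2 s z" for z
    obtain R0 where R0: "\<And>s z. \<tau> s z \<noteq> 0 \<Longrightarrow> norm z \<le> R0" using test_family_support[OF T jk] by blast
    have "integral\<^sup>L lborel A = 0"
      by (rule wirt_along_integral_eq_0(3)[OF wirt_along_mult[OF dzF \<tau>2(2)], of R0 s, folded A_def]) (use R0[of s] in force)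
    moreover have AB: "A z = w i s * c i $ k * (F s z * q z ^ m * ((Q i z)\<^sup>2 * \<tau> s z)) + F s z * q z ^ Suc m * \<tau>3 s z" for z
    proof -
      have QR: "Q l z * Q i z = q z * R l z" if "l \<in> J - {i}" for l
      proof -
        have "Q i z = lform (c l) z * R l z" unfolding Q_def R_def
          using that finJ by (intro prod.remove) auto
        thus ?thesis using that by (simp add: q_Q[of l] mult_ac)
      qed
      have "(\<Sum>l\<in>J. w l s * c l $ k * (F1 z * q z ^ m * Q l z)) * (Q i z * \<tau> s z) =
         (\<Sum>l\<in>J. w l s * c l $ k * (F1 z * q z ^ m * (Q l z * Q i z) * \<tau> s z))"
        unfolding sum_distrib_right by (intro sum.cong refl) (simp add: mult_ac)
      also have "\<dots> = w i s * c i $ k * (F1 z * q z ^ m * (Q i z * Q i z) * \<tau> s z)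
          + (\<Sum>l\<in>J-{i}. w l s * c l $ k * (F1 z * q z ^ m * (q z * R l z) * \<tau> s z))"
        using QR by (subst sum.remove[OF finJ(1) i]) (auto intro!: sum.cong)
      also have "(\<Sum>l\<in>J-{i}. w l s * c l $ k * (F1 z * q z ^ m * (q z * R l z) * \<tau> s z)) =
          F1 z * q z ^ Suc m * (\<Sum>l\<in>J-{i}. c l $ k * (w l s * (R l z * \<tau> s z)))"
        by (simp add: sum_distrib_left mult_ac)
      finally show ?thesis unfolding A_def \<tau>3_def FF
        by (simp only: mult.assoc) (simp add: algebra_simps power2_eq_square)
    qed
    ultimately have "(\<integral>z. w i s * c i $ k * (F s z * q z ^ m * ((Q i z)\<^sup>2 * \<tau> s z)) + F s z * q z ^ Suc m * \<tau>3 s z \<partial>lborel) = 0"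
    proof -
      have "A = (\<lambda>z. w i s * c i $ k * (F s z * q z ^ m * ((Q i z)\<^sup>2 * \<tau> s z)) + F s z * q z ^ Suc m * \<tau>3 s z)"
        by (rule ext) (rule AB)
      thus ?thesis using \<open>integral\<^sup>L lborel A = 0\<close> by metis
    qed
    moreover have TQ: "test_family j k (\<lambda>s z. (Q i z)\<^sup>2 * \<tau> s z)"
      using test_family_polyfun[OF polyfun.mult[OF polQ polQ] T, of "J-{i}" "J-{i}"] by (simp add: Q_def power2_eq_square)
    ultimately have key: "w i s * c i $ k * (\<integral>z. F s z * q z ^ m * ((Q i z)\<^sup>2 * \<tau> s z) \<partial>lborel) =
       - (\<integral>z. F s z * q z ^ Suc m * \<tau>3 s z \<partial>lborel)"
      using integrable_F_test_family[OF TQ s, of m] integrable_F_test_family[OF T3 s, of "Suc m"]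
      by (subst (asm) Bochner_Integration.integral_add) (auto simp: add_eq_0_iff)
    have ck: "c i $ k \<noteq> 0" using i by (simp add: J_def)
    have Di: "D m s = w i s * (\<Prod>l\<in>J-{i}. w l s)"
      unfolding D_def w_def by (rule prod.remove[OF finJ(1) i])
    have "(\<integral>z. F s z * q z ^ Suc m * \<tau>4 s z \<partial>lborel) =
       (\<integral>z. ((- 1 / c i $ k) * (\<Prod>l\<in>J-{i}. w l s)) * (F s z * q z ^ Suc m * \<tau>3 s z) \<partial>lborel)"
      by (simp add: \<tau>4_def mult_ac)
    also have "\<dots> = ((- 1 / c i $ k) * (\<Prod>l\<in>J-{i}. w l s)) * (\<integral>z. F s z * q z ^ Suc m * \<tau>3 s z \<partial>lborel)"
      by (rule integral_mult_right_zero)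
    also have "\<dots> = D m s * (\<integral>z. F s z * q z ^ m * ((Q i z)\<^sup>2 * \<tau> s z) \<partial>lborel)"
    proof -
      have "(\<integral>z. F s z * q z ^ Suc m * \<tau>3 s z \<partial>lborel) =
          - (w i s * c i $ k * (\<integral>z. F s z * q z ^ m * ((Q i z)\<^sup>2 * \<tau> s z) \<partial>lborel))"
        unfolding key by (rule minus_minus[symmetric])
      thus ?thesis unfolding Di using ck by (simp only:) (simp add: mult_ac)
    qed
    finally show ?thesis by simp
  qed
  thus ?thesis unfolding gain_def using T4 by blast
qed

end

lemma powr_le_bound:
  fixes x y :: real
  assumes "0 < lo" "lo \<le> 1" "lo \<le> x" "x \<le> hi" "1 \<le> hi" "\<bar>y\<bar> \<le> E"
  shows "x powr y \<le> hi powr E + lo powr - E"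
proof (cases "x \<ge> 1")
  case True
  have "x powr y \<le> x powr E" using True assms by (intro powr_mono) auto
  also have "\<dots> \<le> hi powr E" using True assms by (intro powr_mono2) auto
  finally show ?thesis using assms by (simp add: add_increasing2)
next
  case False
  have "x powr y \<le> x powr - E" using False assms by (intro powr_mono') auto
  also have "\<dots> \<le> lo powr - E" using assms by (intro powr_mono2') auto
  finally show ?thesis using assms by (simp add: add_increasing)
qed

context lines_dir
begin

text \<open>A power of \<open>z $ j\<close> is a combination of the \<open>Q i\<close>, and the test
  family is divisible by its square. Expanding the square gives terms with \<open>Q i * Q l\<close>:
  those with \<open>i = l\<close> are gained by integration by parts, and for
  \<open>i \<noteq> l\<close> the product is already a multiple of \<open>q\<close>. Squaring is
  needed because a single \<open>Q i\<close> falls under neither case.\<close>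

lemma gain_all:
  assumes T: "test_family j k \<tau>"
  shows "gain m \<tau>"
proof (cases "J = {}")
  case True
  thus ?thesis using T by (auto simp: gain_def D_def q_def)
next
  case False
  have "c i $ j * c l $ k \<noteq> c i $ k * c l $ j" if "i \<in> J" "l \<in> J" "i \<noteq> l" for i l
    using indep[of i l] that finJ jk exhaust_2[of j] exhaust_2[of k] by (auto simp: subset_iff mult.commute)
  then obtain A where A: "\<And>i. i \<in> J \<Longrightarrow> polyfun (A i)"
    and Aeq: "\<And>z. (z $ j) ^ (card J - 1) = (\<Sum>i\<in>J. A i z * Q i z)"
    using coord_power_in_ideal[OF finJ(1) False jk, of c] unfolding Q_def by blast
  obtain t where t: "test_family j k t" "\<And>s z. \<tau> s z = (z $ j) ^ (2 * (card J - 1)) * t s z"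
    using test_family_divide_power[OF T] by blast
  have polQ: "polyfun (\<lambda>z. \<Prod>l\<in>B. lform (c l) z)" if "B \<subseteq> J" for B
    by (intro polyfun_prod polyfun_lform finite_subset[OF that finJ(1)])
  define R where "R i l z = (\<Prod>l'\<in>J-{i}-{l}. lform (c l') z)" for i l z
  define T1 where "T1 i l = (\<lambda>s z. (A i z * A l z) * t s z)" for i l
  have T1: "test_family j k (T1 i l)" if "i \<in> J" "l \<in> J" for i l
    unfolding T1_def by (intro test_family_polyfun polyfun.mult A that t(1))
  define T2 where "T2 i l = (if i = l then (\<lambda>s z. (Q i z)\<^sup>2 * T1 i l s z) else (\<lambda>s z. q z * (R i l z * T1 i l s z)))" for i l
  have eq: "\<tau> = (\<lambda>s z. \<Sum>i\<in>J. \<Sum>l\<in>J. T2 i l s z)"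
  proof (intro ext)
    fix s z
    have "\<tau> s z = (\<Sum>i\<in>J. A i z * Q i z) * (\<Sum>l\<in>J. A l z * Q l z) * t s z"
      by (simp only: t(2) mult_2 power_add Aeq)
    also have "\<dots> = (\<Sum>i\<in>J. \<Sum>l\<in>J. (A i z * Q i z) * (A l z * Q l z) * t s z)"
      unfolding sum_product by (simp only: sum_distrib_right)
    also have "\<dots> = (\<Sum>i\<in>J. \<Sum>l\<in>J. T2 i l s z)"
    proof (intro sum.cong refl)
      fix i l assume il: "i \<in> J" "l \<in> J"
      show "(A i z * Q i z) * (A l z * Q l z) * t s z = T2 i l s z"
      proof (cases "i = l")
        case True
        thus ?thesis by (simp add: T2_def T1_def power2_eq_square)
      next
        case False
        have "Q i z = lform (c l) z * R i l z" unfolding Q_def R_def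
          using il False finJ by (intro prod.remove) auto
        hence "Q i z * Q l z = q z * R i l z" by (simp add: q_Q[OF il(2)] mult_ac)
        hence "(Q i z * Q l z) * (A i z * A l z * t s z) = (q z * R i l z) * (A i z * A l z * t s z)" by simp
        thus ?thesis using False by (simp add: T2_def T1_def mult_ac)
      qed
    qed
    finally show "\<tau> s z = (\<Sum>i\<in>J. \<Sum>l\<in>J. T2 i l s z)" .
  qed
  have TTR: "test_family j k (\<lambda>s z. R i l z * T1 i l s z)" if "i \<in> J" "l \<in> J" for i l
    unfolding R_def by (intro test_family_polyfun polQ T1 that) auto
  have TT2: "test_family j k (T2 i l)" if "i \<in> J" "l \<in> J" for i l
  proof (cases "i = l")
    case True
    have "test_family j k (\<lambda>s z. (Q i z * Q i z) * T1 i l s z)"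
      unfolding Q_def by (intro test_family_polyfun polyfun.mult polQ T1 that) auto
    thus ?thesis using True by (simp add: T2_def power2_eq_square)
  next
    case False
    have "test_family j k (\<lambda>s z. q z * (R i l z * T1 i l s z))"
      unfolding q_def by (intro test_family_polyfun polQ TTR that) auto
    thus ?thesis using False by (simp add: T2_def)
  qed
  have G2: "gain m (T2 i l)" if "i \<in> J" "l \<in> J" for i l
    unfolding T2_def using gain_Q_square[OF that(1) T1[OF that]] gain_q[OF TTR[OF that]] by auto
  show ?thesis
    unfolding eq by (intro gain_sum test_family_sum finJ G2 TT2)
qed

lemma gain_iterate:
  assumes T: "test_family j k \<tau>"
  shows "\<exists>\<tau>'. test_family j k \<tau>' \<and> (\<forall>s. Re s > 0 \<longrightarrow>
     (\<Prod>n<m. D n s) * (\<integral>z. F s z * \<tau> s z \<partial>lborel) = (\<integral>z. F s z * q z ^ m * \<tau>' s z \<partial>lborel))"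
proof (induction m)
  case 0
  thus ?case using T by (intro exI[of _ \<tau>]) auto
next
  case (Suc m)
  then obtain t where t: "test_family j k t" "\<And>s. Re s > 0 \<Longrightarrow>
     (\<Prod>n<m. D n s) * (\<integral>z. F s z * \<tau> s z \<partial>lborel) = (\<integral>z. F s z * q z ^ m * t s z \<partial>lborel)" by blast
  obtain t' where t': "test_family j k t'" "\<And>s. Re s > 0 \<Longrightarrow>
     D m s * (\<integral>z. F s z * q z ^ m * t s z \<partial>lborel) = (\<integral>z. F s z * q z ^ Suc m * t' s z \<partial>lborel)"
    using gain_all[OF t(1), of m] unfolding gain_def by blast
  have "(\<Prod>n<Suc m. D n s) * (\<integral>z. F s z * \<tau> s z \<partial>lborel) = (\<integral>z. F s z * q z ^ Suc m * t' s z \<partial>lborel)"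
    if "Re s > 0" for s
    using t(2)[OF that] t'(2)[OF that] by (simp add: mult_ac)
  thus ?case using t'(1) by blast
qed

text \<open>The recursion \<open>rGamma x = x * rGamma (x + 1)\<close>, applied \<open>m\<close>
  times for each line. The factors released in round \<open>n\<close> make up \<open>D n\<close>,
  and \<open>Suc m\<close> in the definition of \<open>D\<close> matches the first one,
  \<open>a i * s + 1\<close>.\<close>

lemma rGamma_D: "(\<Prod>i\<in>J. rGamma (of_nat (a i) * s + 1)) =
   (\<Prod>i\<in>J. rGamma (of_nat (a i) * s + of_nat m + 1)) * (\<Prod>n<m. D n s)"
proof (induction m)
  case (Suc m)
  have "(\<Prod>i\<in>J. rGamma (of_nat (a i) * s + of_nat m + 1)) =
    (\<Prod>i\<in>J. (of_nat (a i) * s + of_nat (Suc m)) * rGamma (of_nat (a i) * s + of_nat (Suc m) + 1))"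
  proof (intro prod.cong refl)
    fix i
    have x: "of_nat (a i) * s + of_nat m + 1 = of_nat (a i) * s + of_nat (Suc m)" by simp
    show "rGamma (of_nat (a i) * s + of_nat m + 1) =
      (of_nat (a i) * s + of_nat (Suc m)) * rGamma (of_nat (a i) * s + of_nat (Suc m) + 1)"
      unfolding x by (rule rGamma_plus1[symmetric])
  qed
  thus ?case using Suc by (simp add: D_def prod.distrib mult_ac)
qed simp

section \<open>Continuation to successive half-planes\<close>

text \<open>The largest exponent decides how far to the left \<open>m\<close> gained factors reach,
  namely to \<open>Re s > - m / (2 * A0)\<close>.\<close>

definition A0 :: real where "A0 = real (Max (a ` I))"

lemma a_le_A0: "i \<in> I \<Longrightarrow> real (a i) \<le> A0"
  using finI by (simp add: A0_def)

lemma A0_pos: "A0 > 0"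
proof -
  have "I \<noteq> {}" using card3 by auto
  then obtain i where "i \<in> I" by blast
  thus ?thesis using a_le_A0[of i] a_pos[of i] by auto
qed

text \<open>The forms outside \<open>J\<close> are bounded below because \<open>z $ j\<close> is. A
  form in \<open>J\<close> may vanish, but together with its \<open>m\<close> gained factors it has
  total exponent \<open>2 * a i * Re t + m\<close>, which is nonnegative in the given
  half-plane.\<close>

lemma F_q_bounded:
  assumes s: "Re s > - real m / (2 * A0)" and \<epsilon>: "\<epsilon> > 0"
  shows "\<exists>r>0. \<exists>C. \<forall>t\<in>ball s r. \<forall>z. norm z \<le> R \<longrightarrow> \<epsilon> \<le> cmod (z $ j) \<longrightarrow> norm (F t z * q z ^ m) \<le> C"
proof -
  define r where "r = Re s + real m / (2 * A0)"
  have r: "r > 0" using s by (simp add: r_def)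
  define E where "E = 2 * A0 * (cmod s + r) + real m"
  define M where "M = Max (insert 1 ((\<lambda>i. (cmod (c i $ 1) + cmod (c i $ 2)) * \<bar>R\<bar>) ` I))"
  have M: "M \<ge> 1" "\<And>i. i \<in> I \<Longrightarrow> (cmod (c i $ 1) + cmod (c i $ 2)) * \<bar>R\<bar> \<le> M"
    using finI by (auto simp: M_def intro!: Max_ge)
  define lo where "lo = Min (insert 1 ((\<lambda>i. cmod (c i $ j) * \<epsilon>) ` (I - J)))"
  \<comment> \<open>A form outside \<open>J\<close> with vanishing \<open>j\<close>-coefficient
    would be zero, which contradicts independence from any other line.\<close>
  have cj: "c i $ j \<noteq> 0" if "i \<in> I - J" for i
  proof
    assume z: "c i $ j = 0"
    have k0: "c i $ k = 0" using that by (auto simp: J_def)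
    have "I \<noteq> {i}" using card3 by auto
    moreover have "i \<in> I" using that by auto
    ultimately obtain l where "l \<in> I" "l \<noteq> i" by blast
    thus False using indep[of i l] that z k0 jk exhaust_2[of j] exhaust_2[of k] by auto
  qed
  have lo: "lo > 0" "lo \<le> 1" "\<And>i. i \<in> I - J \<Longrightarrow> lo \<le> cmod (c i $ j) * \<epsilon>"
    using finI cj \<epsilon> by (auto simp: lo_def Min_gr_iff)
  have "norm (F t z * q z ^ m) \<le> (\<Prod>i\<in>J. M powr E) * (\<Prod>i\<in>I-J. M powr E + lo powr - E)"
    if t: "t \<in> ball s r" and z: "norm z \<le> R" "\<epsilon> \<le> cmod (z $ j)" for t z
  proof -
    have "\<bar>Re t - Re s\<bar> < r" using t abs_Re_le_cmod[of "t - s"] by (auto simp: dist_norm norm_minus_commute)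
    hence Ret: "Re t > - real m / (2 * A0)" by (auto simp: r_def)
    have "\<bar>Re t\<bar> \<le> cmod t" by (rule abs_Re_le_cmod)
    also have "\<dots> \<le> cmod s + r" using t norm_triangle_ineq2[of t s] by (auto simp: dist_norm norm_minus_commute)
    finally have Ret2: "\<bar>Re t\<bar> \<le> cmod s + r" .
    have absle: "\<bar>2 * (real (a i) * Re t)\<bar> \<le> 2 * A0 * (cmod s + r)" if "i \<in> I" for i
      using mult_mono[OF a_le_A0[OF that] Ret2] A0_pos by (simp add: abs_mult)
    have lfM: "cmod (lform (c i) z) \<le> M" if "i \<in> I" for i
    proof -
      have "(cmod (c i $ 1) + cmod (c i $ 2)) * norm z \<le> (cmod (c i $ 1) + cmod (c i $ 2)) * \<bar>R\<bar>"
        using z by (intro mult_left_mono) auto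
      thus ?thesis using lform_bound[of "c i" z] M(2)[OF that] by linarith
    qed
    have "F t z * q z ^ m = (\<Prod>i\<in>J. abs_pow (lform (c i) z) (of_nat (a i) * t) * lform (c i) z ^ m) * (\<Prod>i\<in>I-J. abs_pow (lform (c i) z) (of_nat (a i) * t))"
      unfolding F_def q_def prod.subset_diff[OF finJ(2) finI] by (simp add: prod.distrib prod_power_distrib mult_ac)
    hence "norm (F t z * q z ^ m) = (\<Prod>i\<in>J. norm (abs_pow (lform (c i) z) (of_nat (a i) * t) * lform (c i) z ^ m)) * (\<Prod>i\<in>I-J. norm (abs_pow (lform (c i) z) (of_nat (a i) * t)))"
      unfolding prod_norm by (simp only: norm_mult[of "prod f J" for f])
    also have "\<dots> \<le> (\<Prod>i\<in>J. M powr E) * (\<Prod>i\<in>I-J. M powr E + lo powr - E)"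
    proof (intro mult_mono prod_mono conjI prod_nonneg ballI)
      fix i assume i: "i \<in> J"
      hence iI: "i \<in> I" using finJ by auto
      show "norm (abs_pow (lform (c i) z) (of_nat (a i) * t) * lform (c i) z ^ m) \<le> M powr E"
      proof (cases "lform (c i) z = 0")
        case False
        have "norm (abs_pow (lform (c i) z) (of_nat (a i) * t) * lform (c i) z ^ m) = cmod (lform (c i) z) powr (2 * (real (a i) * Re t) + real m)"
          using False by (simp add: norm_mult norm_abs_pow norm_power powr_add powr_realpow)
        also have "\<dots> \<le> M powr (2 * (real (a i) * Re t) + real m)"
        proof (rule powr_mono2)
          have "real (a i) * (- real m / (2 * A0)) \<ge> A0 * (- real m / (2 * A0))"
            using a_le_A0[OF iI] A0_pos by (intro mult_right_mono_neg) (auto simp: field_simps)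
          moreover have "real (a i) * Re t \<ge> real (a i) * (- real m / (2 * A0))"
            using Ret by (intro mult_left_mono) auto
          moreover have "A0 * (- real m / (2 * A0)) = - real m / 2" using A0_pos by simp
          ultimately show "0 \<le> 2 * (real (a i) * Re t) + real m" by linarith
        qed (use lfM[OF iI] in auto)
        also have "\<dots> \<le> M powr E"
          using absle[OF iI] M by (intro powr_mono) (auto simp: E_def)
        finally show ?thesis .
      qed simp
    next
      fix i assume i: "i \<in> I - J"
      have "lform (c i) z = c i $ j * z $ j" using i by (simp add: lform_expand[OF jk] J_def)
      moreover have "cmod (c i $ j) * \<epsilon> \<le> cmod (c i $ j) * cmod (z $ j)" using z by (intro mult_left_mono) auto
      ultimately have "lo \<le> cmod (lform (c i) z)" using lo(3)[OF i] by (simp add: norm_mult)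
      thus "norm (abs_pow (lform (c i) z) (of_nat (a i) * t)) \<le> M powr E + lo powr - E"
        unfolding norm_abs_pow using i absle[of i] lo M lfM[of i] by (intro powr_le_bound) (auto simp: E_def)
    qed auto
    finally show ?thesis .
  qed
  thus ?thesis using r by blast
qed

lemma holomorphic_F_q_test_family:
  assumes T: "test_family j k \<tau>"
  shows "(\<lambda>s. \<integral>z. F s z * q z ^ m * \<tau> s z \<partial>lborel) holomorphic_on {s. Re s > - real m / (2 * A0)}"
proof (rule holomorphic_on_integral)
  show "open {s. Re s > - real m / (2 * A0)}" by (rule open_halfspace_Re_gt)
  have [measurable]: "\<tau> s \<in> borel_measurable borel" for s
    by (rule borel_measurable_continuous_onI[OF test_family_continuous2[OF T]])
  have [measurable]: "q \<in> borel_measurable borel"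
    by (rule borel_measurable_continuous_onI[OF q_continuous])
  show "(\<lambda>z. F s z * q z ^ m * \<tau> s z) \<in> borel_measurable lborel" for s by measurable
  show "(\<lambda>s. F s x * q x ^ m * \<tau> s x) holomorphic_on {s. Re s > - real m / (2 * A0)}" for x
    by (intro holomorphic_intros F_holomorphic test_family_holomorphic[OF T])
  fix s assume s: "s \<in> {s. Re s > - real m / (2 * A0)}"
  obtain R \<epsilon> where R: "\<epsilon> > 0" "\<And>s z. \<tau> s z \<noteq> 0 \<Longrightarrow> norm z \<le> R \<and> \<epsilon> \<le> cmod (z $ j)"
    using test_family_support[OF T jk] by blast
  obtain r C where r: "r > 0" and C: "\<And>t z. t \<in> ball s r \<Longrightarrow> norm z \<le> R \<Longrightarrow> \<epsilon> \<le> cmod (z $ j) \<Longrightarrow> norm (F t z * q z ^ m) \<le> C"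
    using F_q_bounded[of m s \<epsilon> R] s R(1) by (metis mem_Collect_eq)
  obtain C' where C': "C' \<ge> 0" "\<And>t z. t \<in> cball s r \<Longrightarrow> norm (\<tau> t z) \<le> C'"
    using test_family_bounded[OF T jk, of s r] by blast
  define g where "g z = \<bar>C\<bar> * C' * indicator (cball 0 R) z" for z :: "complex^2"
  have "integrable lborel g" unfolding g_def
    using emeasure_bounded_finite[of "cball (0::complex^2) R"]
    by (intro integrable_mult_right integrable_real_indicator) auto
  moreover have "norm (F t z * q z ^ m * \<tau> t z) \<le> g z" if t: "t \<in> ball s r" for t z
  proof (cases "\<tau> t z = 0")
    case True
    thus ?thesis using C' by (simp add: g_def)
  next
    case False
    have "norm (F t z * q z ^ m) * norm (\<tau> t z) \<le> \<bar>C\<bar> * C'"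
      using C[OF t] R(2)[OF False] C'(2)[of t z] t by (intro mult_mono) fastforce+
    thus ?thesis using R(2)[OF False] by (simp add: g_def norm_mult)
  qed
  ultimately show "\<exists>r>0. \<exists>g. integrable lborel g \<and> (AE x in lborel. \<forall>t\<in>ball s r \<inter> {s. Re s > - real m / (2 * A0)}. norm (F t x * q x ^ m * \<tau> t x) \<le> g x)"
    using r by (intro exI[of _ r] conjI exI[of _ g]) auto
qed

end

text \<open>The half-planes exhaust the plane and their pairwise intersections are convex. By the
  identity theorem the functions, which agree for \<open>Re s > 0\<close>, agree wherever two of
  them are defined, so any admissible index may be chosen at each point.\<close>

lemma holomorphic_glue_halfplanes:
  fixes f :: "nat \<Rightarrow> complex \<Rightarrow> complex"
  assumes b: "b > 0" and hol: "\<And>m. f m holomorphic_on {s. Re s > - real m * b}"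
    and eq: "\<And>m s. Re s > 0 \<Longrightarrow> f m s = g s"
  shows "\<exists>X. X holomorphic_on UNIV \<and> (\<forall>s. Re s > 0 \<longrightarrow> X s = g s)"
proof -
  define H where "H m = {s. Re s > - real m * b}" for m
  have oH: "open (H m)" for m unfolding H_def by (rule open_halfspace_Re_gt)
  have conv: "convex (H m)" for m unfolding H_def by (rule convex_halfspace_Re_gt)
  have agree: "f m s = f n s" if "s \<in> H m" "s \<in> H n" for m n s
  proof (rule analytic_continuation_open[where s="{s. Re s > 0}" and s'="H m \<inter> H n" and f="f m" and g="f n"])
    show "connected (H m \<inter> H n)" by (intro convex_connected convex_Int conv)
    show "{s. Re s > 0} \<noteq> {}" by (auto intro: exI[of _ 1])
    show "{s. Re s > 0} \<subseteq> H m \<inter> H n"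
      using b by (auto simp: H_def intro!: le_less_trans[of _ 0] mult_nonneg_nonneg)
    show "f m holomorphic_on H m \<inter> H n" "f n holomorphic_on H m \<inter> H n"
      by (rule holomorphic_on_subset[OF hol], force simp: H_def)+
  qed (use that oH eq open_halfspace_Re_gt in \<open>auto\<close>)
  have ex: "\<exists>m. s \<in> H m" for s
  proof -
    obtain m where "- Re s / b < real m" using reals_Archimedean2 by blast
    hence "s \<in> H m" using b by (auto simp: H_def field_simps)
    thus ?thesis by blast
  qed
  define N where "N s = (SOME m. s \<in> H m)" for s
  have N: "s \<in> H (N s)" for s unfolding N_def using someI_ex[OF ex] .
  define X where "X s = f (N s) s" for s
  have X: "X s = f m s" if "s \<in> H m" for m s unfolding X_def using agree[OF N that] .
  have "X holomorphic_on (\<Union>m\<in>UNIV. H m)"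
  proof (rule holomorphic_on_UN_open)
    show "X holomorphic_on H m" for m
      by (rule holomorphic_transform[OF hol[of m, folded H_def]]) (simp add: X)
  qed (use oH in auto)
  moreover have "(\<Union>m\<in>UNIV. H m) = UNIV" using ex by blast
  moreover have "X s = g s" if "Re s > 0" for s using X[OF N] eq[OF that] by simp
  ultimately show ?thesis by auto
qed

context lines_dir
begin

text \<open>The reciprocal Gamma factors absorb all the factors \<open>D n\<close> at once.\<close>

lemma entire_extension:
  assumes T: "test_family j k \<tau>"
  shows "\<exists>X. X holomorphic_on UNIV \<and> (\<forall>s. Re s > 0 \<longrightarrow>
     X s = (\<Prod>i\<in>I. rGamma (of_nat (a i) * s + 1)) * (\<integral>z. F s z * \<tau> s z \<partial>lborel))"
proof -
  have "\<exists>t. \<forall>m. test_family j k (t m) \<and> (\<forall>s. Re s > 0 \<longrightarrow>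
     (\<Prod>n<m. D n s) * (\<integral>z. F s z * \<tau> s z \<partial>lborel) = (\<integral>z. F s z * q z ^ m * t m s z \<partial>lborel))"
    using gain_iterate[OF T] by (intro choice allI) blast
  then obtain t where t: "\<And>m. test_family j k (t m)" "\<And>m s. Re s > 0 \<Longrightarrow>
     (\<Prod>n<m. D n s) * (\<integral>z. F s z * \<tau> s z \<partial>lborel) = (\<integral>z. F s z * q z ^ m * t m s z \<partial>lborel)" by blast
  \<comment> \<open>For the lines in \<open>J\<close> the first \<open>m\<close> zeros have been
    used up by the factors \<open>D n\<close>, which shifts the argument by \<open>m\<close>. The
    lines outside \<open>J\<close> produce no such factors; they are carried along so that both
    choices of direction share one product over \<open>I\<close>.\<close>
  define f where "f m s = (\<Prod>i\<in>I-J. rGamma (of_nat (a i) * s + 1)) *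
     ((\<Prod>i\<in>J. rGamma (of_nat (a i) * s + of_nat m + 1)) * (\<integral>z. F s z * q z ^ m * t m s z \<partial>lborel))" for m s
  show ?thesis
  proof (rule holomorphic_glue_halfplanes)
    show "1 / (2 * A0) > 0" using A0_pos by simp
    show "f m holomorphic_on {s. Re s > - real m * (1 / (2 * A0))}" for m
      unfolding f_def using holomorphic_F_q_test_family[OF t(1), of m m] by (intro holomorphic_intros) auto
    fix m s assume s: "Re s > 0"
    have "(\<Prod>i\<in>I. rGamma (of_nat (a i) * s + 1)) =
      (\<Prod>i\<in>I-J. rGamma (of_nat (a i) * s + 1)) * (\<Prod>i\<in>J. rGamma (of_nat (a i) * s + 1))"
      by (rule prod.subset_diff[OF finJ(2) finI])
    thus "f m s = (\<Prod>i\<in>I. rGamma (of_nat (a i) * s + 1)) * (\<integral>z. F s z * \<tau> s z \<partial>lborel)"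
      unfolding f_def rGamma_D[of s m] t(2)[OF s, symmetric] by (simp add: mult_ac)
  qed
qed

end

section \<open>The order of the pole\<close>

lemma nonpos_Ints_Re: "x \<in> \<int>\<^sub>\<le>\<^sub>0 \<Longrightarrow> Re x \<le> 0"
  by (auto elim!: nonpos_Ints_cases)

lemma eventually_at_right_of_real:
  fixes x :: real
  assumes "\<forall>\<^sub>F s in at (of_real x :: complex). P s"
  shows "\<forall>\<^sub>F t in at_right x. P (of_real t)"
proof -
  have "filterlim (\<lambda>t. complex_of_real t) (at (of_real x)) (at_right x)"
    unfolding filterlim_at by (auto intro!: tendsto_intros simp: eventually_at_filter)
  thus ?thesis using assms filterlim_iff by blast
qed

text \<open>Serves both signs, with \<open>\<sigma>\<close> equal to 1 or -1. The limit in the plane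
  caps the order at 2. If the order is not 2, then \<open>g w * (w - p)\<close> has a limit, which
  can be computed along real \<open>t\<close> decreasing to \<open>x\<close>; there it is real, of
  sign \<open>\<sigma>\<close> and bounded away from 0.\<close>

lemma pole_conclusion:
  fixes g :: "complex \<Rightarrow> complex" and x :: real and h :: "real \<Rightarrow> real"
  assumes nice: "g nicely_meromorphic_on UNIV"
    and lim: "((\<lambda>s. (s - of_real x)^2 * g s) \<longlongrightarrow> L) (at (of_real x))"
    and c: "c > 0"
    and h: "((\<lambda>t. g (of_real t) * of_real (t - x) - of_real (h t)) \<longlongrightarrow> 0) (at_right x)"
    and ev: "\<forall>\<^sub>F t in at_right x. \<sigma> * h t \<ge> c"
  shows "pole_order g (of_real x) \<le> 2"
    and "pole_order g (of_real x) \<noteq> 2 \<Longrightarrow>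
      pole_order g (of_real x) = 1 \<and> residue g (of_real x) \<in> \<real> \<and> \<sigma> * Re (residue g (of_real x)) > 0"
proof -
  define p where "p = complex_of_real x"
  have evne: "\<forall>\<^sub>F w in at p. w \<noteq> p" by (simp add: eventually_at_filter)
  have pole: "\<exists>n h. pole_order g p = n \<and> n > 0 \<and> h p \<noteq> 0 \<and> isCont h p \<and> (\<forall>\<^sub>F w in at p. g w = h w / (w - p) ^ n)
      \<and> (\<exists>S. open S \<and> p \<in> S \<and> g holomorphic_on S - {p})" if P: "is_pole g p"
  proof -
    have "isolated_singularity_at g p"
      using nice unfolding nicely_meromorphic_on_def by (meson meromorphic_on_isolated_singularity meromorphic_on_subset subset_UNIV UNIV_I)
    then obtain r where r: "r > 0" "g analytic_on ball p r - {p}" unfolding isolated_singularity_at_def by blast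
    hence hol: "g holomorphic_on ball p r - {p}" by (simp add: analytic_imp_holomorphic)
    obtain r' where z: "zorder g p < 0" "zor_poly g p p \<noteq> 0" and r': "r' > 0" "zor_poly g p holomorphic_on cball p r'"
      "\<And>w. w \<in> cball p r' - {p} \<Longrightarrow> g w = zor_poly g p w / (w - p) ^ nat (- zorder g p)"
      using zorder_exist_pole[OF hol _ _ P] r(1) by auto
    have "isCont (zor_poly g p) p"
      using holomorphic_on_imp_continuous_on[OF r'(2)] r'(1) by (auto intro!: continuous_on_interior[of "cball p r'"])
    moreover have "\<forall>\<^sub>F w in at p. w \<in> ball p r' - {p}"
      using r'(1) eventually_at_ball'[of r' p UNIV] by auto
    hence "\<forall>\<^sub>F w in at p. g w = zor_poly g p w / (w - p) ^ nat (- zorder g p)"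
      by eventually_elim (use r'(3) in auto)
    ultimately show ?thesis using z P r(1) hol
      by (intro exI[of _ "nat (- zorder g p)"] exI[of _ "zor_poly g p"]) (auto simp: pole_order_def intro!: exI[of _ "ball p r"])
  qed
  have le2: "pole_order g p \<le> 2"
  proof (cases "is_pole g p")
    case True
    then obtain n h where nh: "pole_order g p = n" "h p \<noteq> 0" "isCont h p" "\<forall>\<^sub>F w in at p. g w = h w / (w - p) ^ n"
      using pole by blast
    show ?thesis
    proof (rule ccontr)
      assume "\<not> ?thesis"
      hence n: "n \<ge> 3" using nh by simp
      have "\<forall>\<^sub>F w in at p. (w - p) ^ (n - 2) * ((w - p)^2 * g w) = h w"
        using nh(4) evne
      proof eventually_elim
        case (elim w)
        have "(w - p) ^ (n - 2) * (w - p)^2 = (w - p) ^ n"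
        proof -
          have "n - 2 + 2 = n" using n by simp
          thus ?thesis by (metis power_add)
        qed
        thus ?case using elim by (cases "w = p") (auto simp: mult.assoc[symmetric])
      qed
      moreover have "((\<lambda>w. (w - p) ^ (n - 2) * ((w - p)^2 * g w)) \<longlongrightarrow> (p - p) ^ (n - 2) * L) (at p)"
        using lim unfolding p_def by (intro tendsto_intros)
      ultimately have "(h \<longlongrightarrow> (p - p) ^ (n - 2) * L) (at p)" using tendsto_cong by fast
      moreover have "(h \<longlongrightarrow> h p) (at p)" using nh(3) by (simp add: isCont_def)
      ultimately have "h p = (p - p) ^ (n - 2) * L" using LIM_unique by metis
      thus False using nh(2) n by (simp add: power_0_left)
    qed
  qed (simp add: pole_order_def)
  thus "pole_order g (of_real x) \<le> 2" by (simp add: p_def)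
  \<comment> \<open>Up to an error tending to 0, the values along the real axis lie in a closed set,
    the reals \<open>w\<close> with \<open>\<sigma> * Re w \<ge> c\<close>; so the limit lies in
    it.\<close>
  have real_lim: "K \<in> \<real> \<and> \<sigma> * Re K \<ge> c" if "((\<lambda>w. g w * (w - p)) \<longlongrightarrow> K) (at p)" for K
  proof -
    have fl: "filterlim (\<lambda>t. complex_of_real t) (at p) (at_right x)"
      unfolding filterlim_at p_def by (auto intro!: tendsto_intros simp: eventually_at_filter)
    have l: "((\<lambda>t. g (of_real t) * (of_real t - p)) \<longlongrightarrow> K) (at_right x)"
      by (rule filterlim_compose[OF that fl])
    have "((\<lambda>t. g (of_real t) * (of_real t - p) - (g (of_real t) * of_real (t - x) - of_real (h t))) \<longlongrightarrow> K - 0) (at_right x)"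
      by (rule tendsto_diff[OF l h])
    hence l: "((\<lambda>t. complex_of_real (h t)) \<longlongrightarrow> K) (at_right x)" by (simp add: p_def)
    have "\<forall>\<^sub>F t in at_right x. complex_of_real (h t) \<in> (\<real> \<inter> {w. \<sigma> * Re w \<ge> c})"
      using ev by eventually_elim auto
    moreover have "closed (\<real> \<inter> {w. \<sigma> * Re w \<ge> c})"
      by (intro closed_Int closed_complex_Reals closed_Collect_le continuous_intros)
    ultimately have "K \<in> \<real> \<inter> {w. \<sigma> * Re w \<ge> c}"
      by (intro Lim_in_closed_set[OF _ _ _ l]) auto
    thus ?thesis by simp
  qed
  assume "pole_order g (of_real x) \<noteq> 2"
  hence ne2: "pole_order g p \<noteq> 2" by (simp add: p_def)
  \<comment> \<open>Without a pole the product \<open>g w * (w - p)\<close> would tend to 0, against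
    \<open>c > 0\<close>.\<close>
  have P: "is_pole g p"
  proof (rule ccontr)
    assume "\<not> is_pole g p"
    hence "(g \<longlongrightarrow> g p) (at p)" using nice by (auto simp: nicely_meromorphic_on_def)
    hence "((\<lambda>w. g w * (w - p)) \<longlongrightarrow> g p * (p - p)) (at p)" by (intro tendsto_intros)
    from real_lim[OF this] show False using c by simp
  qed
  then obtain n h S where nh: "pole_order g p = n" "n > 0" "isCont h p" "\<forall>\<^sub>F w in at p. g w = h w / (w - p) ^ n"
    and S: "open S" "p \<in> S" "g holomorphic_on S - {p}"
    using pole by blast
  have n1: "n = 1" using nh le2 ne2 by simp
  have "\<forall>\<^sub>F w in at p. g w * (w - p) = h w"
    using nh(4) evne by eventually_elim (auto simp: n1)
  moreover have "(h \<longlongrightarrow> h p) (at p)" using nh(3) by (simp add: isCont_def)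
  ultimately have l: "((\<lambda>w. g w * (w - p)) \<longlongrightarrow> h p) (at p)" using tendsto_cong by fast
  have "residue g p = h p" by (rule residue_simple'[OF S l])
  thus "pole_order g (of_real x) = 1 \<and> residue g (of_real x) \<in> \<real> \<and> \<sigma> * Re (residue g (of_real x)) > 0"
    using real_lim[OF l] n1 nh(1) c by (auto simp: p_def)
qed

section \<open>Meromorphic continuation and the order at \<open>-2/d\<close>\<close>

locale lines_zeta = lines +
  fixes \<alpha> \<beta> :: "complex \<Rightarrow> complex" and \<phi> :: "complex^2 \<Rightarrow> complex" and \<rho> :: real
  assumes test: "\<alpha> \<in> Cc_infinity" "\<beta> \<in> Cc_infinity"
    and nonneg: "\<And>z. \<alpha> z \<in> \<real>\<^sub>\<ge>\<^sub>0" "\<And>z. \<beta> z \<in> \<real>\<^sub>\<ge>\<^sub>0"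
    and \<rho>: "\<rho> > 0" and one: "\<And>z. cmod z < \<rho> \<Longrightarrow> \<alpha> z = 1" "\<And>z. cmod z < \<rho> \<Longrightarrow> \<beta> z = 1"
    and \<phi>: "\<And>z. \<phi> z = \<alpha> (z $ 1) * \<beta> (z $ 2)"
begin

definition d :: nat where "d = (\<Sum>i\<in>I. a i)"
text \<open>The plain integral. Where the integrand is not integrable it has the default value 0 and
  no meaning; the continuation is \<open>zeta_mero\<close>.\<close>

definition Z :: "complex \<Rightarrow> complex" where "Z s = (\<integral>z. F s z * \<phi> z \<partial>lborel)"
definition E :: "complex \<Rightarrow> complex" where "E s = (\<Prod>i\<in>I. rGamma (of_nat (a i) * s + 1))"
definition E4 :: "complex \<Rightarrow> complex" where "E4 s = 1 - exp (- (of_real (ln 4) * (of_nat d * s + 2)))"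

lemma I_ne: "I \<noteq> {}" using card3 by auto

lemma other_line: "i \<in> I \<Longrightarrow> \<exists>l\<in>I. l \<noteq> i"
proof (rule ccontr)
  assume "i \<in> I" "\<not> (\<exists>l\<in>I. l \<noteq> i)"
  hence "I = {i}" by blast
  thus False using card3 by simp
qed

lemma third_line: "\<exists>m\<in>I. m \<noteq> i \<and> m \<noteq> l"
proof (rule ccontr)
  assume "\<not> (\<exists>m\<in>I. m \<noteq> i \<and> m \<noteq> l)"
  hence "I \<subseteq> {i, l}" by blast
  hence "card I \<le> card {i, l}" by (intro card_mono) auto
  also have "\<dots> \<le> 2" by (simp add: card_insert_if)
  finally show False using card3 by simp
qed

lemma c_nonzero: "i \<in> I \<Longrightarrow> c i \<noteq> 0"
proof
  assume i: "i \<in> I" and z: "c i = 0"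
  obtain l where "l \<in> I" "l \<noteq> i" using other_line[OF i] by blast
  thus False using indep[OF i, of l] z by simp
qed

lemma d_pos: "d > 0" using I_ne finI a_pos by (simp add: d_def sum_pos)

text \<open>This is where a third line is used for the order of the pole: two different exponents
  cannot both equal \<open>d/2\<close>.\<close>

lemma two_less_d: "i \<in> I \<Longrightarrow> l \<in> I \<Longrightarrow> i \<noteq> l \<Longrightarrow> a i + a l < d"
proof -
  assume il: "i \<in> I" "l \<in> I" "i \<noteq> l"
  obtain m where m: "m \<in> I" "m \<noteq> i" "m \<noteq> l" using third_line by blast
  have "a i + a l + a m = sum a {i, l, m}" using il m by simp
  also have "\<dots> \<le> d" unfolding d_def by (rule sum_mono2) (use finI il m in auto)
  finally show ?thesis using a_pos[OF m(1)] by simp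
qed

lemma a_less_d: "i \<in> I \<Longrightarrow> a i < d"
proof -
  assume i: "i \<in> I"
  obtain l where "l \<in> I" "l \<noteq> i" using other_line[OF i] by blast
  thus ?thesis using two_less_d[OF i, of l] by simp
qed

lemma F_homogeneous:
  assumes t: "t > 0"
  shows "F s (t *\<^sub>R z) = of_real t powr (2 * of_real (real d) * s) * F s z"
proof -
  have "F s (t *\<^sub>R z) = (\<Prod>i\<in>I. of_real t powr (2 * (of_nat (a i) * s))) * F s z"
    unfolding F_def using t by (simp add: abs_pow_of_real_mult prod.distrib)
  also have "(\<Prod>i\<in>I. complex_of_real t powr (2 * (of_nat (a i) * s))) = (\<Prod>i\<in>I. exp (2 * (of_nat (a i) * s) * ln (of_real t)))"
    using t by (simp add: powr_def)
  also have "\<dots> = exp (\<Sum>i\<in>I. 2 * (of_nat (a i) * s) * ln (of_real t))" by (simp add: exp_sum finI)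
  also have "(\<Sum>i\<in>I. 2 * (of_nat (a i) * s) * ln (complex_of_real t)) = 2 * of_real (real d) * s * ln (of_real t)"
    by (simp add: d_def sum_distrib_left sum_distrib_right mult_ac)
  finally show ?thesis using t by (simp add: powr_def)
qed

lemma \<phi>_continuous: "continuous_on UNIV \<phi>"
proof -
  have "continuous_on UNIV (\<lambda>z::complex^2. \<alpha> (z $ 1) * \<beta> (z $ 2))"
    by (intro continuous_intros continuous_on_nth_compose Cc_infinity_continuous test)
  thus ?thesis by (simp add: \<phi>[symmetric])
qed

lemma \<phi>_measurable [measurable]: "\<phi> \<in> borel_measurable borel"
  by (rule borel_measurable_continuous_onI[OF \<phi>_continuous])

lemma \<phi>_support: "\<exists>R. \<forall>z. norm z > R \<longrightarrow> \<phi> z = 0"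
proof -
  obtain R1 R2 where R: "\<And>w. norm w > R1 \<Longrightarrow> \<alpha> w = 0" "\<And>w. norm w > R2 \<Longrightarrow> \<beta> w = 0"
    using test Cc_infinity_supportE by metis
  have "\<phi> z = 0" if "norm z > R1 + R2" for z
  proof (rule ccontr)
    assume "\<phi> z \<noteq> 0"
    hence "\<alpha> (z $ 1) \<noteq> 0" "\<beta> (z $ 2) \<noteq> 0" by (auto simp: \<phi>)
    hence "cmod (z $ 1) \<le> R1" "cmod (z $ 2) \<le> R2" using R(1)[of "z $ 1"] R(2)[of "z $ 2"] by linarith+
    thus False using norm_vec2_le[of z] that by linarith
  qed
  thus ?thesis by blast
qed

lemma \<phi>_bounded: "\<exists>B. \<forall>z. norm (\<phi> z) \<le> B"
  using \<phi>_support continuous_compact_support_bounded[OF \<phi>_continuous] by metis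

lemma \<phi>_nonneg: "\<phi> z \<in> \<real>\<^sub>\<ge>\<^sub>0"
  unfolding \<phi> by (intro nonneg_Reals_mult_I nonneg)

lemma \<phi>_one: "norm z < \<rho> \<Longrightarrow> \<phi> z = 1"
  using one(1)[of "z $ 1"] one(2)[of "z $ 2"] norm_nth_le_vec[of z 1] norm_nth_le_vec[of z 2]
  by (simp add: \<phi>)

lemma integrable_F_continuous:
  assumes "Re s > 0" "continuous_on UNIV \<psi>" "\<And>z. norm z > R \<Longrightarrow> \<psi> z = 0"
  shows "integrable lborel (\<lambda>z. F s z * \<psi> z)"
proof -
  have c: "continuous_on UNIV (\<lambda>z. F s z * \<psi> z)" by (intro continuous_intros F_continuous assms)
  have z: "F s z * \<psi> z = 0" if "norm z > R" for z using assms(3)[OF that] by simp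
  obtain C where "\<And>z. norm (F s z * \<psi> z) \<le> C"
    using continuous_compact_support_bounded[OF c z] by blast
  thus ?thesis using z by (intro integrable_bounded_support borel_measurable_continuous_onI c) auto
qed

lemma dilation_identity:
  assumes s: "Re s > 0"
  shows "E4 s * Z s = (\<integral>z. F s z * (\<phi> z - \<phi> (2 *\<^sub>R z)) \<partial>lborel)"
proof -
  obtain R where R: "\<And>z. norm z > R \<Longrightarrow> \<phi> z = 0" using \<phi>_support by blast
  have i1: "integrable lborel (\<lambda>z. F s z * \<phi> z)"
    by (rule integrable_F_continuous[OF s \<phi>_continuous R])
  have i2: "integrable lborel (\<lambda>z. F s z * \<phi> (2 *\<^sub>R z))"
    by (rule integrable_F_continuous[OF s, where R="R / 2"])
      (auto intro!: continuous_on_compose2[OF \<phi>_continuous] continuous_intros R)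
  have "Z s = (2 ^ DIM(complex^2)) *\<^sub>R (\<integral>z. F s (2 *\<^sub>R z) * \<phi> (2 *\<^sub>R z) \<partial>lborel)"
    unfolding Z_def by (rule integral_lborel_scale) auto
  also have "(\<lambda>z. F s (2 *\<^sub>R z) * \<phi> (2 *\<^sub>R z)) = (\<lambda>z. of_real 2 powr (2 * of_real (real d) * s) * (F s z * \<phi> (2 *\<^sub>R z)))"
    using F_homogeneous[of 2 s] by (auto simp: mult.assoc)
  also have "integral\<^sup>L lborel \<dots> = of_real 2 powr (2 * of_real (real d) * s) * (\<integral>z. F s z * \<phi> (2 *\<^sub>R z) \<partial>lborel)"
    by (rule integral_mult_right_zero)
  finally have "Z s = (16 * of_real 2 powr (2 * of_real (real d) * s)) * (\<integral>z. F s z * \<phi> (2 *\<^sub>R z) \<partial>lborel)"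
    by (simp add: scaleR_conv_of_real mult.assoc)
  \<comment> \<open>\<open>16 = 2 ^ 4\<close> is the Jacobian in real dimension 4 and the other
    factor comes from homogeneity; together they are \<open>4 powr (d * s + 2)\<close>.\<close>
  also have "16 * of_real 2 powr (2 * of_real (real d) * s) = exp (of_real (ln 4) * (of_nat d * s + 2))"
  proof -
    have l4: "ln (4::real) = 2 * ln 2" using ln_realpow[of 2 2] by simp
    have "(16::complex) = of_real (exp (ln 4 * 2))" using exp_of_nat2_mult[of "ln (4::real)" 2] by (simp add: mult.commute)
    hence 16: "(16::complex) = exp (of_real (ln 4) * 2)"
      by (simp only: exp_of_real[symmetric] of_real_mult of_real_numeral)
    have "of_real 2 powr (2 * of_real (real d) * s) = exp (of_real (ln 4) * (of_nat d * s))"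
      unfolding powr_def using Ln_of_real[of 2] by (simp add: l4 mult_ac)
    thus ?thesis by (simp add: 16 exp_add[symmetric] algebra_simps)
  qed
  finally have fin: "Z s = exp (of_real (ln 4) * (of_nat d * s + 2)) * (\<integral>z. F s z * \<phi> (2 *\<^sub>R z) \<partial>lborel)" .
  have "exp (- y) * (exp y * w) = w" for y w :: complex
    by (simp add: mult.assoc[symmetric] exp_add[symmetric])
  hence "exp (- (of_real (ln 4) * (of_nat d * s + 2))) * Z s = (\<integral>z. F s z * \<phi> (2 *\<^sub>R z) \<partial>lborel)"
    unfolding fin .
  moreover have "(\<integral>z. F s z * (\<phi> z - \<phi> (2 *\<^sub>R z)) \<partial>lborel) = Z s - (\<integral>z. F s z * \<phi> (2 *\<^sub>R z) \<partial>lborel)"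
    unfolding Z_def right_diff_distrib by (rule Bochner_Integration.integral_diff[OF i1 i2])
  ultimately show ?thesis by (simp add: E4_def algebra_simps)
qed

lemma entire_numerator: "\<exists>X. X holomorphic_on UNIV \<and> (\<forall>s. Re s > 0 \<longrightarrow> X s = E s * E4 s * Z s)"
proof -
  interpret A: lines_dir I c a 1 2 by unfold_locales auto
  interpret B: lines_dir I c a 2 1 by unfold_locales auto
  define \<alpha>2 \<beta>2 where "\<alpha>2 = (\<lambda>w. \<alpha> (2 *\<^sub>R w))" and "\<beta>2 = (\<lambda>w. \<beta> (2 *\<^sub>R w))"
  have C2: "\<alpha>2 \<in> Cc_infinity" "\<beta>2 \<in> Cc_infinity" unfolding \<alpha>2_def \<beta>2_def by (intro Cc_infinity_dilation test, simp)+
  define \<gamma> \<delta> where "\<gamma> = (\<lambda>w. \<alpha> w - \<alpha>2 w)" and "\<delta> = (\<lambda>w. \<beta> w - \<beta>2 w)"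
  have C3: "\<gamma> \<in> Cc_infinity" "\<delta> \<in> Cc_infinity" unfolding \<gamma>_def \<delta>_def by (intro Cc_infinity_diff test C2)+
  \<comment> \<open>Half the radius, since both \<open>w\<close> and \<open>2 *\<^sub>R w\<close>
    must lie where the cutoffs are 1.\<close>
  have z0: "\<gamma> w = 0" "\<delta> w = 0" if "cmod w < \<rho> / 2" for w
    using that one[of w] one[of "2 *\<^sub>R w"] \<rho> by (auto simp: \<gamma>_def \<delta>_def \<alpha>2_def \<beta>2_def)
  obtain R1 R2 where R: "\<And>w. norm w > R1 \<Longrightarrow> \<gamma> w = 0" "\<And>w. norm w > R2 \<Longrightarrow> \<delta> w = 0"
    using C3 Cc_infinity_supportE by metis
  have T1: "test_family 1 2 (\<lambda>s z. \<gamma> (z $ 1) * \<beta> (z $ 2))"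
    by (rule test_family.base[where \<epsilon>="\<rho> / 2" and R=R1]) (use z0 R \<rho> Cc_infinity_continuous[OF C3(1)] test in auto)
  have T2: "test_family 2 1 (\<lambda>s z. \<delta> (z $ 2) * \<alpha>2 (z $ 1))"
    by (rule test_family.base[where \<epsilon>="\<rho> / 2" and R=R2]) (use z0 R \<rho> Cc_infinity_continuous[OF C3(2)] C2 in auto)
  obtain X1 where X1: "X1 holomorphic_on UNIV" "\<And>s. Re s > 0 \<Longrightarrow> X1 s = E s * (\<integral>z. F s z * (\<gamma> (z $ 1) * \<beta> (z $ 2)) \<partial>lborel)"
    using A.entire_extension[OF T1] unfolding E_def by blast
  obtain X2 where X2: "X2 holomorphic_on UNIV" "\<And>s. Re s > 0 \<Longrightarrow> X2 s = E s * (\<integral>z. F s z * (\<delta> (z $ 2) * \<alpha>2 (z $ 1)) \<partial>lborel)"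
    using B.entire_extension[OF T2] unfolding E_def by blast
  have "X1 s + X2 s = E s * E4 s * Z s" if s: "Re s > 0" for s
  proof -
    have i1: "integrable lborel (\<lambda>z. F s z * (\<gamma> (z $ 1) * \<beta> (z $ 2)))"
      using A.integrable_F_test_family[OF T1 s, of 0] by simp
    have i2: "integrable lborel (\<lambda>z. F s z * (\<delta> (z $ 2) * \<alpha>2 (z $ 1)))"
      using B.integrable_F_test_family[OF T2 s, of 0] by simp
    \<comment> \<open>Telescoping: the coordinates are dilated one at a time, so each term is a
      difference vanishing near 0 in one coordinate times a smooth function of the other.\<close>
    have "\<phi> z - \<phi> (2 *\<^sub>R z) = \<gamma> (z $ 1) * \<beta> (z $ 2) + \<delta> (z $ 2) * \<alpha>2 (z $ 1)" for z
      by (simp add: \<phi> \<gamma>_def \<delta>_def \<alpha>2_def \<beta>2_def algebra_simps)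
    hence "E4 s * Z s = (\<integral>z. F s z * (\<gamma> (z $ 1) * \<beta> (z $ 2)) \<partial>lborel) + (\<integral>z. F s z * (\<delta> (z $ 2) * \<alpha>2 (z $ 1)) \<partial>lborel)"
      unfolding dilation_identity[OF s] by (simp only: distrib_left) (rule Bochner_Integration.integral_add[OF i1 i2])
    thus ?thesis using X1(2)[OF s] X2(2)[OF s] by (simp add: distrib_left mult.assoc)
  qed
  moreover have "(\<lambda>s. X1 s + X2 s) holomorphic_on UNIV" using X1 X2 by (intro holomorphic_intros)
  ultimately show ?thesis by blast
qed

definition X :: "complex \<Rightarrow> complex" where
  "X = (SOME X. X holomorphic_on UNIV \<and> (\<forall>s. Re s > 0 \<longrightarrow> X s = E s * E4 s * Z s))"

lemma X: "X holomorphic_on UNIV" "Re s > 0 \<Longrightarrow> X s = E s * E4 s * Z s"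
  using someI_ex[OF entire_numerator] unfolding X_def by blast+

lemma E_holomorphic: "E holomorphic_on S" unfolding E_def by (intro holomorphic_intros)
lemma E4_holomorphic: "E4 holomorphic_on S" unfolding E4_def by (intro holomorphic_intros)

text \<open>\<open>remove_sings\<close> normalises the values at poles and removable points, as
  required by the definite description in \<open>arch_zeta\<close>.\<close>

definition zeta_mero :: "complex \<Rightarrow> complex" where "zeta_mero = remove_sings (\<lambda>s. X s / (E s * E4 s))"

lemma entire_meromorphic: "f holomorphic_on UNIV \<Longrightarrow> f meromorphic_on UNIV"
  by (intro analytic_on_imp_meromorphic_on) (simp add: analytic_on_open)

lemma zeta_mero_nicely: "zeta_mero nicely_meromorphic_on UNIV"
  unfolding zeta_mero_def
  by (intro remove_sings_nicely_meromorphic meromorphic_on_divide meromorphic_on_mult entire_meromorphic X E_holomorphic E4_holomorphic)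

lemma zeta_mero_eq: "E s * E4 s \<noteq> 0 \<Longrightarrow> zeta_mero s = X s / (E s * E4 s)"
proof -
  assume nz: "E s * E4 s \<noteq> 0"
  have "(\<lambda>s. X s / (E s * E4 s)) analytic_on {s}"
    using X(1) E_holomorphic[of UNIV] E4_holomorphic[of UNIV] nz
    by (intro analytic_intros) (auto simp: analytic_on_open intro: analytic_on_subset[of _ UNIV])
  thus ?thesis unfolding zeta_mero_def by (rule remove_sings_at_analytic)
qed

lemma zeta_mero_Re_pos: "Re s > 0 \<Longrightarrow> zeta_mero s = Z s"
proof -
  assume s: "Re s > 0"
  have "rGamma (of_nat (a i) * s + 1) \<noteq> 0" for i
  proof
    assume "rGamma (of_nat (a i) * s + 1) = 0"
    hence "of_nat (a i) * s + 1 \<in> \<int>\<^sub>\<le>\<^sub>0" by (simp add: rGamma_eq_zero_iff)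
    hence "Re (of_nat (a i) * s + 1) \<le> 0" by (rule nonpos_Ints_Re)
    hence "real (a i) * Re s + 1 \<le> 0" by simp
    moreover have "real (a i) * Re s \<ge> 0" using s by (intro mult_nonneg_nonneg) auto
    ultimately show False by linarith
  qed
  hence "E s \<noteq> 0" using finI by (simp add: E_def)
  moreover have "E4 s \<noteq> 0"
  proof
    assume "E4 s = 0"
    hence "norm (exp (- (of_real (ln 4) * (of_nat d * s + 2)))) = 1" by (simp add: E4_def)
    hence "ln 4 * (real d * Re s + 2) = 0" by (simp add: norm_exp_eq_Re)
    moreover have "real d * Re s + 2 > 0" using s by (simp add: add_nonneg_pos)
    ultimately show False by simp
  qed
  ultimately show ?thesis using zeta_mero_eq[of s] X(2)[OF s] by simp
qed

text \<open>The denominator \<open>E * E4\<close> vanishes at \<open>-2/d\<close> to order at most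
  two: once through \<open>E4\<close>, and at most once through \<open>E\<close>, because at most
  one \<open>a i\<close> equals \<open>d/2\<close>.\<close>

lemma near_pole:
  shows "\<forall>\<^sub>F s in at (of_real (- 2 / d)). E s * E4 s \<noteq> 0"
    and "\<exists>L. ((\<lambda>s. (s - of_real (- 2 / d))^2 * zeta_mero s) \<longlongrightarrow> L) (at (of_real (- 2 / d)))"
proof -
  define p where "p = complex_of_real (- 2 / d)"
  have dp: "of_nat d * p + 2 = 0" using d_pos by (simp add: p_def)
  have "(E4 has_field_derivative (of_real (ln 4) * of_nat d)) (at p)"
    unfolding E4_def by (auto intro!: derivative_eq_intros simp: dp)
  moreover have "E4 p = 0" by (simp add: E4_def dp)
  ultimately have "((\<lambda>s. E4 s / (s - p)) \<longlongrightarrow> of_real (ln 4) * of_nat d) (at p)"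
    by (simp add: has_field_derivative_iff)
  moreover have ne: "complex_of_real (ln 4) * of_nat d \<noteq> 0" using d_pos by simp
  ultimately have "((\<lambda>s. inverse (E4 s / (s - p))) \<longlongrightarrow> inverse (of_real (ln 4) * of_nat d)) (at p)"
    and ev4: "\<forall>\<^sub>F s in at p. E4 s / (s - p) \<noteq> 0"
    by (rule tendsto_inverse, rule tendsto_imp_eventually_ne)
  from this(1) have lim4: "((\<lambda>s. (s - p) / E4 s) \<longlongrightarrow> inverse (of_real (ln 4) * of_nat d)) (at p)" by simp
  \<comment> \<open>One linear factor is split off each reciprocal Gamma function. Since
    \<open>a i < d\<close>, the argument \<open>a i * p + 2\<close> has positive real part, so
    \<open>u p \<noteq> 0\<close> and any zero of \<open>E\<close> at \<open>p\<close> comes from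
    \<open>v\<close>.\<close>
  define u where "u s = (\<Prod>i\<in>I. rGamma (of_nat (a i) * s + 2))" for s :: complex
  define v where "v s = (\<Prod>i\<in>I. of_nat (a i) * s + 1)" for s :: complex
  have Euv: "E s = v s * u s" for s
  proof -
    have "rGamma (of_nat (a i) * s + 1) = (of_nat (a i) * s + 1) * rGamma (of_nat (a i) * s + 2)" for i
      using rGamma_plus1[of "of_nat (a i) * s + 1"] by (simp add: add.assoc)
    thus ?thesis by (simp add: E_def u_def v_def prod.distrib)
  qed
  have "rGamma (of_nat (a i) * p + 2) \<noteq> 0" if "i \<in> I" for i
  proof
    assume "rGamma (of_nat (a i) * p + 2) = 0"
    hence "of_nat (a i) * p + 2 \<in> \<int>\<^sub>\<le>\<^sub>0" by (simp add: rGamma_eq_zero_iff)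
    hence "Re (of_nat (a i) * p + 2) \<le> 0" by (rule nonpos_Ints_Re)
    thus False using a_less_d[OF that] d_pos by (simp add: p_def field_simps)
  qed
  hence up: "u p \<noteq> 0" using finI by (simp add: u_def)
  have "u holomorphic_on UNIV" unfolding u_def by (intro holomorphic_intros)
  hence "isCont u p"
    using holomorphic_on_imp_continuous_on continuous_on_eq_continuous_at[OF open_UNIV] by blast
  hence limu: "(u \<longlongrightarrow> u p) (at p)" by (simp add: isCont_def)
  hence evu: "\<forall>\<^sub>F s in at p. u s \<noteq> 0" using up by (rule tendsto_imp_eventually_ne)
  have limX: "(X \<longlongrightarrow> X p) (at p)"
    using X(1) by (metis UNIV_I holomorphic_on_imp_continuous_on continuous_on_def at_within_open open_UNIV)
  have evv: "\<forall>\<^sub>F s in at p. \<forall>i\<in>I. of_nat (a i) * s + 1 \<noteq> 0"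
  proof (rule eventually_ball_finite[OF finI], intro ballI)
    fix i assume i: "i \<in> I"
    show "\<forall>\<^sub>F s in at p. of_nat (a i) * s + 1 \<noteq> 0"
    proof (cases "of_nat (a i) * p + 1 = 0")
      case True
      have "of_nat (a i) * s + 1 \<noteq> 0" if "s \<noteq> p" for s
      proof
        assume "of_nat (a i) * s + 1 = 0"
        hence "of_nat (a i) * s = of_nat (a i) * p" using True by (metis add_right_cancel)
        thus False using that a_pos[OF i] by simp
      qed
      thus ?thesis by (auto simp: eventually_at_filter)
    next
      case False
      have "((\<lambda>s. of_nat (a i) * s + 1) \<longlongrightarrow> of_nat (a i) * p + 1) (at p)" by (intro tendsto_intros)
      thus ?thesis using False by (rule tendsto_imp_eventually_ne)
    qed
  qed
  have "\<exists>L. ((\<lambda>s. (s - p) / v s) \<longlongrightarrow> L) (at p)"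
  proof (cases "\<exists>i\<in>I. of_nat (a i) * p + 1 = 0")
    case False
    have "((\<lambda>s. (s - p) / v s) \<longlongrightarrow> (p - p) / v p) (at p)"
      unfolding v_def by (intro tendsto_intros) (use False finI in auto)
    thus ?thesis by blast
  next
    case True
    then obtain i where i: "i \<in> I" "of_nat (a i) * p + 1 = 0" by blast
    \<comment> \<open>A linear factor vanishing at \<open>-2/d\<close> forces its exponent to be
      half of the degree, which by \<open>two_less_d\<close> excludes a second one.\<close>
    have half: "2 * a i = d"
    proof -
      have "Re (of_nat (a i) * p + 1) = 0" using i by simp
      hence "2 * real (a i) = real d" using d_pos by (simp add: p_def field_simps)
      thus ?thesis by linarith
    qed
    have oth: "of_nat (a l) * p + 1 \<noteq> 0" if "l \<in> I - {i}" for l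
    proof
      assume "of_nat (a l) * p + 1 = 0"
      hence "Re (of_nat (a l) * p + 1) = 0" by simp
      hence "2 * real (a l) = real d" using d_pos by (simp add: p_def field_simps)
      thus False using two_less_d[of i l] i that half by auto
    qed
    define w where "w s = (\<Prod>l\<in>I-{i}. of_nat (a l) * s + 1)" for s :: complex
    have "((\<lambda>s. 1 / (of_nat (a i) * w s)) \<longlongrightarrow> 1 / (of_nat (a i) * w p)) (at p)"
      unfolding w_def by (intro tendsto_intros) (use oth finI a_pos[OF i(1)] in auto)
    moreover have "\<forall>\<^sub>F s in at p. 1 / (of_nat (a i) * w s) = (s - p) / v s"
    proof -
      have "1 / (of_nat (a i) * w s) = (s - p) / v s" if "s \<noteq> p" for s
      proof -
        have "of_nat (a i) * s + 1 = of_nat (a i) * (s - p)" using i(2) by (simp add: algebra_simps add_eq_0_iff)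
        hence "v s = of_nat (a i) * (s - p) * w s"
          unfolding v_def w_def using prod.remove[OF finI i(1), of "\<lambda>l. of_nat (a l) * s + 1"] by simp
        thus ?thesis using that by simp
      qed
      thus ?thesis by (auto simp: eventually_at_filter)
    qed
    ultimately show ?thesis using tendsto_cong by fast
  qed
  then obtain L where L: "((\<lambda>s. (s - p) / v s) \<longlongrightarrow> L) (at p)" by blast
  have ev: "\<forall>\<^sub>F s in at p. E s * E4 s \<noteq> 0"
    using evu evv ev4 by eventually_elim (auto simp: Euv v_def finI)
  thus "\<forall>\<^sub>F s in at (of_real (- 2 / d)). E s * E4 s \<noteq> 0" by (simp add: p_def)
  have "((\<lambda>s. X s * ((s - p) / E4 s) * ((s - p) / v s) / u s) \<longlongrightarrow>
     X p * inverse (of_real (ln 4) * of_nat d) * L / u p) (at p)"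
    by (intro tendsto_intros limX lim4 L limu up)
  moreover have "\<forall>\<^sub>F s in at p. X s * ((s - p) / E4 s) * ((s - p) / v s) / u s = (s - p)^2 * zeta_mero s"
    using ev by eventually_elim (auto simp: zeta_mero_eq Euv power2_eq_square mult_ac)
  ultimately have "((\<lambda>s. (s - p)^2 * zeta_mero s) \<longlongrightarrow> X p * inverse (of_real (ln 4) * of_nat d) * L / u p) (at p)"
    using tendsto_cong by fast
  thus "\<exists>L. ((\<lambda>s. (s - of_real (- 2 / d))^2 * zeta_mero s) \<longlongrightarrow> L) (at (of_real (- 2 / d)))"
    unfolding p_def by blast
qed

text \<open>The relation \<open>K * X = E * E4 * U\<close> extends from \<open>Re s > 0\<close> to
  the half-plane by the identity theorem, and near \<open>-2/d\<close> on the real axis one may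
  divide. \<open>K\<close> is 1 when the integral itself converges, and \<open>Kp\<close> when
  integration by parts is needed for the comparison functions.\<close>

lemma zeta_mero_eq_by_continuation:
  assumes U: "U holomorphic_on {s. Re s > - 2 / d}" and K: "K holomorphic_on {s. Re s > - 2 / d}"
    and eq: "\<And>s. Re s > 0 \<Longrightarrow> K s * Z s = U s"
    and Kne: "\<forall>\<^sub>F t in at_right (- 2 / d). K (of_real t) \<noteq> 0"
  shows "\<forall>\<^sub>F t in at_right (- 2 / d). zeta_mero (of_real t) = U (of_real t) / K (of_real t)"
proof -
  have XU: "K s * X s = E s * E4 s * U s" if "Re s > - 2 / d" for s
  proof (rule analytic_continuation_open[where s="{s. Re s > 0}" and s'="{s. Re s > - 2 / d}"
        and f="\<lambda>s. K s * X s" and g="\<lambda>s. E s * E4 s * U s"])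
    show "connected {s. Re s > - 2 / d}" by (intro convex_connected convex_halfspace_Re_gt)
    show "{s. Re s > 0} \<noteq> {}" by (auto intro: exI[of _ 1])
    show "{s. Re s > 0} \<subseteq> {s. Re s > - 2 / d}" by (auto intro: le_less_trans[of _ 0])
    show "(\<lambda>s. K s * X s) holomorphic_on {s. Re s > - 2 / d}"
      by (intro holomorphic_intros K holomorphic_on_subset[OF X(1)]) auto
    show "(\<lambda>s. E s * E4 s * U s) holomorphic_on {s. Re s > - 2 / d}"
      by (intro holomorphic_intros U E_holomorphic E4_holomorphic)
  qed (use that X(2) eq in \<open>auto simp: open_halfspace_Re_gt mult_ac\<close>)
  have "\<forall>\<^sub>F t in at_right (- 2 / real d). E (of_real t) * E4 (of_real t) \<noteq> 0"
    by (rule eventually_at_right_of_real[OF near_pole(1)])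
  moreover have "\<forall>\<^sub>F t in at_right (- 2 / real d). t \<in> {- 2 / real d <..< 0}"
    by (rule eventually_at_right_real) (use d_pos in auto)
  ultimately show ?thesis using Kne
  proof eventually_elim
    case (elim t)
    have "K (of_real t) * X (of_real t) = E (of_real t) * E4 (of_real t) * U (of_real t)"
      by (rule XU) (use elim in auto)
    thus ?case using elim by (simp add: zeta_mero_eq field_simps)
  qed
qed

end

section \<open>The sign of the residue\<close>

lemma isCont_abs_pow:
  assumes "isCont g x" "isCont h x" "g x \<noteq> 0"
  shows "isCont (\<lambda>x. abs_pow (g x) (h x)) x"
proof -
  have "isCont (\<lambda>x. exp (2 * h x * of_real (ln (cmod (g x))))) x"
    using assms by (intro continuous_intros) auto
  moreover have "\<forall>\<^sub>F y in nhds x. g y \<noteq> 0"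
  proof -
    have "(g \<longlongrightarrow> g x) (nhds x)" using assms(1) by (simp add: isCont_def tendsto_at_iff_tendsto_nhds)
    thus ?thesis using assms(3) by (rule tendsto_imp_eventually_ne)
  qed
  hence "\<forall>\<^sub>F y in nhds x. abs_pow (g y) (h y) = exp (2 * h y * of_real (ln (cmod (g y))))"
    by eventually_elim (rule abs_pow_eq_exp)
  ultimately show ?thesis by (subst isCont_cong)
qed

text \<open>The graph of \<open>exp\<close> lies above its tangent at the mean \<open>m\<close>,
  strictly away from the point of contact; in the weighted sum the linear terms cancel. With
  logarithms for \<open>X\<close> this is the inequality of arithmetic and geometric means.\<close>

lemma weighted_exp_mean:
  fixes X :: "'i \<Rightarrow> real"
  assumes "finite A" "\<And>i. i \<in> A \<Longrightarrow> p i > 0" "(\<Sum>i\<in>A. p i) = 1"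
  shows "exp (\<Sum>i\<in>A. p i * X i) \<le> (\<Sum>i\<in>A. p i * exp (X i))"
    and "\<exists>i\<in>A. X i \<noteq> (\<Sum>i\<in>A. p i * X i) \<Longrightarrow> exp (\<Sum>i\<in>A. p i * X i) < (\<Sum>i\<in>A. p i * exp (X i))"
proof -
  define m where "m = (\<Sum>i\<in>A. p i * X i)"
  have "(\<Sum>i\<in>A. p i * (exp m * (1 + (X i - m)))) = (\<Sum>i\<in>A. exp m * (1 - m) * p i + exp m * (p i * X i))"
    by (intro sum.cong refl) (simp add: algebra_simps)
  also have "\<dots> = exp m * (1 - m) * (\<Sum>i\<in>A. p i) + exp m * (\<Sum>i\<in>A. p i * X i)"
    by (simp add: sum.distrib sum_distrib_left)
  also have "\<dots> = exp m" unfolding m_def[symmetric] assms(3) by (simp add: algebra_simps)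
  finally have eq: "(\<Sum>i\<in>A. p i * (exp m * (1 + (X i - m)))) = exp m" .
  have le: "p i * (exp m * (1 + (X i - m))) \<le> p i * exp (X i)" if "i \<in> A" for i
  proof -
    have "exp m * (1 + (X i - m)) \<le> exp m * exp (X i - m)"
      by (intro mult_left_mono) (auto simp: exp_ge_add_one_self add.commute)
    also have "\<dots> = exp (X i)" by (simp flip: exp_add)
    finally show ?thesis using assms(2)[OF that] by (intro mult_left_mono) auto
  qed
  show "exp (\<Sum>i\<in>A. p i * X i) \<le> (\<Sum>i\<in>A. p i * exp (X i))"
  proof -
    have "(\<Sum>i\<in>A. p i * (exp m * (1 + (X i - m)))) \<le> (\<Sum>i\<in>A. p i * exp (X i))"
      by (rule sum_mono) (rule le)
    thus ?thesis unfolding eq by (simp add: m_def)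
  qed
  assume "\<exists>i\<in>A. X i \<noteq> (\<Sum>i\<in>A. p i * X i)"
  then obtain i where i: "i \<in> A" "X i \<noteq> m" by (auto simp: m_def)
  have "1 + (X i - m) < exp (X i - m)"
    using exp_minus_greater[of "m - X i"] i(2) by simp
  hence "exp m * (1 + (X i - m)) < exp m * exp (X i - m)" by (intro mult_strict_left_mono) auto
  also have "\<dots> = exp (X i)" by (simp flip: exp_add)
  finally have "p i * (exp m * (1 + (X i - m))) < p i * exp (X i)"
    using assms(2)[OF i(1)] by (intro mult_strict_left_mono) auto
  hence "(\<Sum>i\<in>A. p i * (exp m * (1 + (X i - m)))) < (\<Sum>i\<in>A. p i * exp (X i))"
    using le i(1) assms(1) by (intro sum_strict_mono_ex1) auto
  thus "exp (\<Sum>i\<in>A. p i * X i) < (\<Sum>i\<in>A. p i * exp (X i))" using eq by (simp add: m_def)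
qed

text \<open>The complex counterpart: the linear terms cancel, so the defect in Jensen's inequality
  is quadratic.\<close>

lemma weighted_exp_mean_defect:
  fixes h :: "'i \<Rightarrow> complex"
  assumes "finite A" "\<And>i. i \<in> A \<Longrightarrow> p i > 0" "(\<Sum>i\<in>A. p i) = 1"
    and "\<And>i. i \<in> A \<Longrightarrow> norm (h i) \<le> \<eta>" "\<eta> \<le> 1"
  shows "norm ((\<Sum>i\<in>A. of_real (p i) * exp (h i)) - exp (\<Sum>i\<in>A. of_real (p i) * h i)) \<le> 6 * \<eta>\<^sup>2"
proof -
  \<comment> \<open>Used for each \<open>h i\<close> and once more for their mean, whose norm is
    also at most \<open>\<eta>\<close>; hence the constant 6. The 3 is an upper bound for
    \<open>exp 1\<close>.\<close>
  have e: "norm (exp u - 1 - u) \<le> 3 * \<eta>\<^sup>2" if "norm u \<le> \<eta>" for u :: complex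
  proof -
    have "norm (exp u - (\<Sum>k\<le>1. u ^ k / fact k)) \<le> exp \<bar>Re u\<bar> * (norm u) ^ Suc 1 / fact 1"
      by (rule Taylor_exp)
    hence "norm (exp u - 1 - u) \<le> exp \<bar>Re u\<bar> * (norm u)\<^sup>2" by (simp add: algebra_simps power2_eq_square)
    also have "\<dots> \<le> 3 * \<eta>\<^sup>2"
    proof (intro mult_mono power_mono that)
      have "exp \<bar>Re u\<bar> \<le> exp 1" using abs_Re_le_cmod[of u] that assms(5) by simp
      thus "exp \<bar>Re u\<bar> \<le> 3" using exp_le by linarith
    qed auto
    finally show ?thesis .
  qed
  define m where "m = (\<Sum>i\<in>A. of_real (p i) * h i)"
  have "norm m \<le> (\<Sum>i\<in>A. p i * \<eta>)" unfolding m_def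
    by (intro order_trans[OF norm_sum] sum_mono) (use assms in \<open>auto simp: norm_mult less_imp_le mult_left_mono\<close>)
  also have "\<dots> = \<eta>" using assms(3) by (simp flip: sum_distrib_right)
  finally have m: "norm m \<le> \<eta>" .
  have "(\<Sum>i\<in>A. of_real (p i) * (exp (h i) - 1 - h i)) = (\<Sum>i\<in>A. of_real (p i) * exp (h i)) - of_real (\<Sum>i\<in>A. p i) - m"
    by (simp add: m_def algebra_simps sum_subtractf sum.distrib)
  hence "(\<Sum>i\<in>A. of_real (p i) * exp (h i)) - exp m = (\<Sum>i\<in>A. of_real (p i) * (exp (h i) - 1 - h i)) - (exp m - 1 - m)"
    using assms(3) by simp
  also have "norm \<dots> \<le> norm (\<Sum>i\<in>A. of_real (p i) * (exp (h i) - 1 - h i)) + norm (exp m - 1 - m)"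
    by (rule norm_triangle_ineq4)
  also have "norm (\<Sum>i\<in>A. of_real (p i) * (exp (h i) - 1 - h i)) \<le> (\<Sum>i\<in>A. p i * (3 * \<eta>\<^sup>2))"
    by (intro order_trans[OF norm_sum] sum_mono) (use assms e in \<open>auto simp: norm_mult less_imp_le intro!: mult_left_mono\<close>)
  also have "\<dots> = 3 * \<eta>\<^sup>2" using assms(3) by (simp flip: sum_distrib_right)
  also have "norm (exp m - 1 - m) \<le> 3 * \<eta>\<^sup>2" by (rule e[OF m])
  finally show ?thesis by (simp add: m_def)
qed

lemma abs_ln_norm_one_plus:
  fixes v :: complex
  assumes "norm v \<le> 1 / 2"
  shows "\<bar>ln (cmod (1 + v))\<bar> \<le> 2 * norm v"
proof -
  have 1: "cmod (1 + v) \<ge> 1 - norm v" using norm_triangle_ineq2[of 1 "- v"] by simp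
  have 2: "cmod (1 + v) \<le> 1 + norm v" using norm_triangle_ineq[of 1 v] by simp
  have pos: "cmod (1 + v) > 0" using 1 assms by linarith
  have "ln (cmod (1 + v)) \<le> cmod (1 + v) - 1" by (rule ln_le_minus_one[OF pos])
  hence "ln (cmod (1 + v)) \<le> 2 * norm v" using 2 norm_ge_zero[of v] by linarith
  moreover have "- norm v - 2 * (norm v)\<^sup>2 \<le> ln (1 - norm v)"
    by (rule ln_one_minus_pos_lower_bound) (use assms in auto)
  moreover have "2 * (norm v)\<^sup>2 \<le> norm v"
    using mult_right_mono[OF assms, of "norm v"] by (simp add: power2_eq_square)
  moreover have "ln (1 - norm v) \<le> ln (cmod (1 + v))" using 1 assms by (intro ln_mono) auto
  ultimately show ?thesis by (auto simp: abs_le_iff)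
qed

context lines_zeta
begin

section \<open>Linear forms on the unit sphere\<close>

lemma avoid_lines:
  assumes "open U" "U \<noteq> {}"
  shows "\<exists>z\<in>U. \<forall>i\<in>I. lform (c i) z \<noteq> 0"
proof (rule ccontr)
  assume "\<not> ?thesis"
  hence n: "\<forall>z\<in>U. \<exists>i\<in>I. lform (c i) z = 0" by blast
  have "AE z in lborel. \<forall>i\<in>I. lform (c i) z \<noteq> 0"
    by (intro AE_finite_allI finI AE_lform_nonzero c_nonzero)
  hence "AE z in lborel. z \<notin> U" by eventually_elim (use n in blast)
  moreover have "U \<in> sets lborel" using assms(1) by simp
  ultimately have "U \<in> null_sets lborel" by (simp add: AE_iff_null_sets)
  hence "negligible U" by (simp add: negligible_iff_null_sets null_sets_completionI)
  thus False using open_not_negligible[OF assms] by simp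
qed

text \<open>Two independent forms vanish together only at 0, so the maximum of their absolute values
  has a positive minimum on the compact sphere; \<open>\<kappa>\<close> is the least of these
  finitely many minima, capped at 1.\<close>

lemma lines_separated:
  "\<exists>\<kappa>>0. \<kappa> \<le> 1 \<and> (\<forall>z i l. norm z = 1 \<longrightarrow> i \<in> I \<longrightarrow> l \<in> I \<longrightarrow> i \<noteq> l \<longrightarrow> cmod (lform (c i) z) < \<kappa> \<longrightarrow> \<kappa> \<le> cmod (lform (c l) z))"
proof -
  have pair: "\<exists>\<kappa>>0. \<forall>z. norm z = 1 \<longrightarrow> \<kappa> \<le> max (cmod (lform (c i) z)) (cmod (lform (c l) z))"
    if il: "i \<in> I" "l \<in> I" "i \<noteq> l" for i l
  proof -
    define m where "m z = max (cmod (lform (c i) z)) (cmod (lform (c l) z))" for z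
    have ne: "sphere (0::complex^2) 1 \<noteq> {}" by simp
    have "continuous_on (sphere 0 1) m" unfolding m_def by (intro continuous_intros)
    then obtain z0 where z0: "z0 \<in> sphere 0 1" "\<And>z. z \<in> sphere 0 1 \<Longrightarrow> m z0 \<le> m z"
      using continuous_attains_inf[OF compact_sphere ne] by blast
    have "m z0 > 0"
    proof (rule ccontr)
      assume "\<not> m z0 > 0"
      hence z: "lform (c i) z0 = 0" "lform (c l) z0 = 0" by (auto simp: m_def max_def split: if_splits)
      have "(c i $ 1 * c l $ 2 - c i $ 2 * c l $ 1) * z0 $ 1 = c l $ 2 * lform (c i) z0 - c i $ 2 * lform (c l) z0"
        "(c i $ 1 * c l $ 2 - c i $ 2 * c l $ 1) * z0 $ 2 = c i $ 1 * lform (c l) z0 - c l $ 1 * lform (c i) z0"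
        by (auto simp: lform_def algebra_simps)
      hence "z0 = 0" using z indep[OF il] by (auto simp: vec2_eq_iff)
      thus False using z0(1) by simp
    qed
    thus ?thesis using z0(2) by (intro exI[of _ "m z0"]) (auto simp: m_def)
  qed
  have "\<forall>p. \<exists>\<kappa>>0. fst p \<in> I \<longrightarrow> snd p \<in> I \<longrightarrow> fst p \<noteq> snd p \<longrightarrow>
     (\<forall>z. norm z = 1 \<longrightarrow> \<kappa> \<le> max (cmod (lform (c (fst p)) z)) (cmod (lform (c (snd p)) z)))"
    using pair by (metis zero_less_one)
  then obtain k where k: "\<And>p. k p > 0" "\<And>p z. fst p \<in> I \<Longrightarrow> snd p \<in> I \<Longrightarrow> fst p \<noteq> snd p \<Longrightarrow> norm z = 1 \<Longrightarrow>
      k p \<le> max (cmod (lform (c (fst p)) z)) (cmod (lform (c (snd p)) z))"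
    by metis
  define \<kappa> where "\<kappa> = Min (insert 1 (k ` (I \<times> I)))"
  have fin: "finite (insert 1 (k ` (I \<times> I)))" using finI by simp
  have "\<kappa> > 0" unfolding \<kappa>_def using fin k(1) by (subst Min_gr_iff) auto
  moreover have "\<kappa> \<le> 1" unfolding \<kappa>_def using fin by simp
  moreover have "\<kappa> \<le> cmod (lform (c l) z)" if "norm z = 1" "i \<in> I" "l \<in> I" "i \<noteq> l" "cmod (lform (c i) z) < \<kappa>" for z i l
  proof -
    have "\<kappa> \<le> k (i, l)" unfolding \<kappa>_def by (rule Min_le[OF fin]) (use that in auto)
    also have "\<dots> \<le> max (cmod (lform (c i) z)) (cmod (lform (c l) z))" using k(2)[of "(i, l)" z] that by simp
    finally show ?thesis using that(5) by (auto simp: max_def split: if_splits)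
  qed
  ultimately show ?thesis by blast
qed

definition M :: real where "M = Max (insert 1 ((\<lambda>i. cmod (c i $ 1) + cmod (c i $ 2)) ` I))"

lemma M: "M \<ge> 1" "i \<in> I \<Longrightarrow> norm z = 1 \<Longrightarrow> cmod (lform (c i) z) \<le> M"
proof -
  have fin: "finite (insert 1 ((\<lambda>i. cmod (c i $ 1) + cmod (c i $ 2)) ` I))" using finI by simp
  show "M \<ge> 1" unfolding M_def using fin by (intro Max_ge) auto
  assume "i \<in> I" "norm z = 1"
  hence "cmod (c i $ 1) + cmod (c i $ 2) \<le> M" unfolding M_def using fin by (intro Max_ge) auto
  thus "cmod (lform (c i) z) \<le> M" using lform_bound[of "c i" z] \<open>norm z = 1\<close> by simp
qed

text \<open>At most one linear form is small at a point of the unit sphere, so a product of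
  powers of the forms is dominated by a sum.\<close>

lemma sphere_bound:
  assumes y: "0 \<le> y" "y \<le> N"
  shows "\<exists>C>0. \<forall>z e. norm z = 1 \<longrightarrow> (\<forall>i\<in>I. lform (c i) z \<noteq> 0) \<longrightarrow> (\<forall>i\<in>I. - y \<le> e i \<and> e i \<le> N) \<longrightarrow>
    (\<Prod>i\<in>I. cmod (lform (c i) z) powr e i) \<le> C * (\<Sum>i\<in>I. cmod (lform (c i) z) powr - y)"
proof -
  obtain \<kappa> where \<kappa>: "\<kappa> > 0" "\<kappa> \<le> 1" and sep: "\<And>z i l. norm z = 1 \<Longrightarrow> i \<in> I \<Longrightarrow> l \<in> I \<Longrightarrow> i \<noteq> l \<Longrightarrow>
      cmod (lform (c i) z) < \<kappa> \<Longrightarrow> \<kappa> \<le> cmod (lform (c l) z)"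
    using lines_separated by blast
  define B where "B = M powr N + \<kappa> powr - N"
  have "1 \<le> M powr N" using M(1) y by (simp add: ge_one_powr_ge_zero)
  hence B: "B \<ge> 1" by (simp add: B_def add_increasing2)
  \<comment> \<open>Each form that is not small contributes at most \<open>B\<close>. The possibly
    small one has its exponent lowered to \<open>- y\<close>, at the cost of
    \<open>M powr (2 * N)\<close>.\<close>
  define C where "C = B ^ card I * M powr (2 * N)"
  have "C > 0" using B M(1) by (simp add: C_def)
  moreover have "(\<Prod>i\<in>I. cmod (lform (c i) z) powr e i) \<le> C * (\<Sum>i\<in>I. cmod (lform (c i) z) powr - y)"
    if z: "norm z = 1" and nz: "\<forall>i\<in>I. lform (c i) z \<noteq> 0" and e: "\<forall>i\<in>I. - y \<le> e i \<and> e i \<le> N" for z e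
  proof -
    obtain i where i: "i \<in> I" and far: "\<And>l. l \<in> I - {i} \<Longrightarrow> \<kappa> \<le> cmod (lform (c l) z)"
    proof (cases "\<exists>i\<in>I. cmod (lform (c i) z) < \<kappa>")
      case True
      then obtain i where "i \<in> I" "cmod (lform (c i) z) < \<kappa>" by blast
      thus ?thesis using sep[OF z] by (intro that[of i]) auto
    next
      case False
      obtain i where "i \<in> I" using I_ne by blast
      thus ?thesis using False by (intro that[of i]) (auto simp: not_less)
    qed
    have "(\<Prod>l\<in>I-{i}. cmod (lform (c l) z) powr e l) \<le> (\<Prod>l\<in>I-{i}. B)"
    proof (intro prod_mono conjI)
      fix l assume l: "l \<in> I - {i}"
      show "cmod (lform (c l) z) powr e l \<le> B" unfolding B_def
      proof (rule powr_le_bound[OF \<kappa> far[OF l]])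
        show "\<bar>e l\<bar> \<le> N" using e l y by (force simp: abs_le_iff)
      qed (use M z l in auto)
    qed auto
    also have "\<dots> \<le> B ^ card I" using B by (simp, intro power_increasing card_mono) (auto simp: finI)
    finally have 1: "(\<Prod>l\<in>I-{i}. cmod (lform (c l) z) powr e l) \<le> B ^ card I" .
    have "cmod (lform (c i) z) powr e i = cmod (lform (c i) z) powr - y * cmod (lform (c i) z) powr (e i + y)"
      by (simp flip: powr_add)
    also have "cmod (lform (c i) z) powr (e i + y) \<le> M powr (e i + y)"
      by (rule powr_mono2) (use e i M z in auto)
    also have "\<dots> \<le> M powr (2 * N)"
    proof (rule powr_mono)
      show "e i + y \<le> 2 * N" using e i y by force
    qed (use M in auto)
    finally have 2: "cmod (lform (c i) z) powr e i \<le> cmod (lform (c i) z) powr - y * M powr (2 * N)"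
      by (simp add: mult_left_mono)
    have "cmod (lform (c i) z) powr - y \<le> (\<Sum>i\<in>I. cmod (lform (c i) z) powr - y)"
      by (rule member_le_sum[OF i]) (auto simp: finI)
    hence "cmod (lform (c i) z) powr - y * M powr (2 * N) \<le> (\<Sum>i\<in>I. cmod (lform (c i) z) powr - y) * M powr (2 * N)"
      by (intro mult_right_mono) auto
    with 2 have 3: "cmod (lform (c i) z) powr e i \<le> (\<Sum>i\<in>I. cmod (lform (c i) z) powr - y) * M powr (2 * N)" by linarith
    have "(\<Prod>i\<in>I. cmod (lform (c i) z) powr e i) = cmod (lform (c i) z) powr e i * (\<Prod>l\<in>I-{i}. cmod (lform (c l) z) powr e l)"
      by (rule prod.remove[OF finI i])
    also have "\<dots> \<le> ((\<Sum>i\<in>I. cmod (lform (c i) z) powr - y) * M powr (2 * N)) * B ^ card I"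
      by (intro mult_mono 1 3 mult_nonneg_nonneg sum_nonneg prod_nonneg) auto
    finally show ?thesis by (simp add: C_def mult_ac)
  qed
  ultimately show ?thesis by blast
qed

lemma norm_F: "norm (F t z) = (\<Prod>i\<in>I. cmod (lform (c i) z) powr (2 * (real (a i) * Re t)))"
  unfolding F_def by (simp add: prod_norm[symmetric] norm_abs_pow)

lemma Re_ball: "t \<in> ball s r \<Longrightarrow> \<bar>Re t - Re s\<bar> < r" "t \<in> ball s r \<Longrightarrow> \<bar>Re t\<bar> \<le> cmod s + r"
proof -
  assume t: "t \<in> ball s r"
  show "\<bar>Re t - Re s\<bar> < r" using t abs_Re_le_cmod[of "t - s"] by (auto simp: dist_norm norm_minus_commute)
  have "\<bar>Re t\<bar> \<le> cmod t" by (rule abs_Re_le_cmod)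
  also have "\<dots> \<le> cmod s + r" using t norm_triangle_ineq2[of t s] by (auto simp: dist_norm norm_minus_commute)
  finally show "\<bar>Re t\<bar> \<le> cmod s + r" .
qed

lemma exponent_bounds:
  fixes k \<sigma> x T :: real
  assumes "0 \<le> k" "k \<le> n" "\<sigma> < x" "\<bar>x\<bar> \<le> T" "- (n * \<sigma>) \<le> y" "0 \<le> y"
  shows "- y \<le> k * x" "k * x \<le> n * T"
proof -
  show "k * x \<le> n * T" using assms by (intro order_trans[OF mult_left_mono mult_right_mono]) auto
  show "- y \<le> k * x"
  proof (cases "x \<ge> 0")
    case True
    thus ?thesis using assms mult_nonneg_nonneg[of k x] by linarith
  next
    case False
    have "n * x \<le> k * x" using False assms by (intro mult_right_mono_neg) auto
    moreover have "n * \<sigma> \<le> n * x" using assms by (intro mult_left_mono) auto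
    ultimately show ?thesis using assms by linarith
  qed
qed

section \<open>No exponent above half of the degree\<close>

text \<open>For \<open>a i \<le> d/2\<close> the exponent \<open>2 * a i * Re t\<close> is at least
  \<open>d * \<sigma>\<close> when \<open>\<sigma> < Re t\<close> is negative, and
  \<open>d * \<sigma> > -2\<close>. So no single line causes divergence before the origin
  does.\<close>

lemma F_bound_small:
  assumes small: "\<And>i. i \<in> I \<Longrightarrow> real (a i) \<le> real d / 2" and s: "Re s > - 2 / real d"
  shows "\<exists>r>0. \<exists>C y. 0 \<le> y \<and> y < 2 \<and> (\<forall>t\<in>ball s r. \<forall>z. norm z = 1 \<longrightarrow> (\<forall>i\<in>I. lform (c i) z \<noteq> 0)
              \<longrightarrow> norm (F t z) \<le> C * (\<Sum>i\<in>I. cmod (lform (c i) z) powr - y))"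
proof -
  define \<sigma> where "\<sigma> = (Re s + (- 2 / real d)) / 2"
  define r where "r = Re s - \<sigma>"
  have \<sigma>: "- 2 / real d < \<sigma>" and r: "r > 0" using s by (auto simp: \<sigma>_def r_def field_simps)
  define y where "y = max 0 (- (real d * \<sigma>))"
  define T where "T = cmod s + r"
  define N where "N = max y (real d * T)"
  have y: "0 \<le> y" "y < 2" using \<sigma> d_pos by (auto simp: y_def field_simps)
  have yE: "y \<le> N" by (simp add: N_def)
  obtain C where C: "\<And>z e. norm z = 1 \<Longrightarrow> \<forall>i\<in>I. lform (c i) z \<noteq> 0 \<Longrightarrow> \<forall>i\<in>I. - y \<le> e i \<and> e i \<le> N \<Longrightarrow>
    (\<Prod>i\<in>I. cmod (lform (c i) z) powr e i) \<le> C * (\<Sum>i\<in>I. cmod (lform (c i) z) powr - y)"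
    using sphere_bound[OF y(1) yE] by blast
  have "norm (F t z) \<le> C * (\<Sum>i\<in>I. cmod (lform (c i) z) powr - y)"
    if t: "t \<in> ball s r" and z: "norm z = 1" "\<forall>i\<in>I. lform (c i) z \<noteq> 0" for t z
    unfolding norm_F
  proof (rule C[OF z], intro ballI)
    fix i assume i: "i \<in> I"
    have "\<sigma> < Re t" using Re_ball(1)[OF t] by (simp add: r_def)
    hence "- y \<le> (2 * real (a i)) * Re t" "(2 * real (a i)) * Re t \<le> real d * T"
      using exponent_bounds[of "2 * real (a i)" "real d" \<sigma> "Re t" T y] small[OF i] Re_ball(2)[OF t] y
      by (auto simp: T_def y_def)
    thus "- y \<le> 2 * (real (a i) * Re t) \<and> 2 * (real (a i) * Re t) \<le> N" by (auto simp: N_def mult.assoc)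
  qed
  thus ?thesis using r y by blast
qed

lemma F_nonneg: "F (of_real s) z \<in> \<real>\<^sub>\<ge>\<^sub>0"
proof -
  have "F (of_real s) z = of_real (\<Prod>i\<in>I. cmod (lform (c i) z) powr (2 * (real (a i) * s)))"
  proof -
    have "abs_pow w (of_nat n * of_real s) = of_real (cmod w powr (2 * (real n * s)))" for w n
      using abs_pow_of_real[of w "real n * s"] by simp
    thus ?thesis by (simp add: F_def)
  qed
  thus ?thesis by (simp only: nonneg_Reals_of_real_iff) (simp add: prod_nonneg)
qed

lemma isCont_F:
  assumes "\<forall>i\<in>I. lform (c i) z0 \<noteq> 0"
  shows "isCont (\<lambda>p. F (of_real (fst p)) (snd p)) (x, z0)"
  unfolding F_def
proof (intro continuous_prod isCont_abs_pow)
  show "isCont (\<lambda>p::real \<times> (complex^2). lform (c i) (snd p)) (x, z0)" for i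
    using continuous_on_eq_continuous_at[OF open_UNIV, of "\<lambda>p::real \<times> (complex^2). lform (c i) (snd p)"]
    by (auto intro!: continuous_intros)
  show "isCont (\<lambda>p::real \<times> (complex^2). of_nat (a i) * complex_of_real (fst p)) (x, z0)" for i
    by (intro continuous_intros)
qed (use assms in auto)

lemma F_nonzero: "\<forall>i\<in>I. lform (c i) z0 \<noteq> 0 \<Longrightarrow> F s z0 \<noteq> 0"
  unfolding F_def using finI by (auto simp: abs_pow_eq_exp)

text \<open>The integral converges up to \<open>-2/d\<close>, so the continuation is
  \<open>Z\<close> there; the witness for \<open>h\<close> is \<open>(t - p) * Re (Z t)\<close>,
  with \<open>p = -2/d\<close>.\<close>

lemma sign_small:
  assumes small: "\<And>i. i \<in> I \<Longrightarrow> real (a i) \<le> real d / 2"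
  shows "\<exists>h c. c > 0 \<and> ((\<lambda>t. zeta_mero (of_real t) * of_real (t - (- 2 / real d)) - of_real (h t)) \<longlongrightarrow> 0) (at_right (- 2 / real d))
     \<and> (\<forall>\<^sub>F t in at_right (- 2 / real d). 1 * h t \<ge> c)"
proof -
  obtain R where R: "\<And>z. norm z > R \<Longrightarrow> \<phi> z = 0" using \<phi>_support by blast
  obtain B where B: "\<And>z. norm (\<phi> z) \<le> B" using \<phi>_bounded by blast
  have dp: "real d > 0" using d_pos by simp
  note fam = F_measurable \<phi>_measurable F_holomorphic F_homogeneous F_bound_small[OF small] B R
  have hol: "Z holomorphic_on {s. Re s > - 2 / real d}"
    unfolding Z_def by (rule homogeneous_family_holomorphic(1)[OF dp finI I_ne c_nonzero fam])
  have "\<forall>\<^sub>F t in at_right (- 2 / real d). zeta_mero (of_real t) = Z (of_real t) / 1"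
    by (rule zeta_mero_eq_by_continuation[OF hol, of "\<lambda>_. 1"]) auto
  hence ZmZ: "\<forall>\<^sub>F t in at_right (- 2 / real d). zeta_mero (of_real t) = Z (of_real t)" by simp
  obtain z0 where z0: "z0 \<in> - {0}" "\<forall>i\<in>I. lform (c i) z0 \<noteq> 0"
    using avoid_lines[of "- {0}"] by auto
  have pos: "Re (F (of_real (- 2 / real d)) z0) > 0"
    using F_nonzero[OF z0(2), of "of_real (- 2 / real d)"] F_nonneg[of "- 2 / real d" z0]
    by (auto simp: complex_nonneg_Reals_iff complex_eq_iff less_le)
  obtain c0 where c0: "c0 > 0" "\<forall>\<^sub>F t in at_right (- 2 / real d). (\<integral>z. F (of_real t) z * \<phi> z \<partial>lborel) \<in> \<real> \<and>
           (2 + real d * t) * Re (\<integral>z. F (of_real t) z * \<phi> z \<partial>lborel) \<ge> c0"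
    using homogeneous_family_lower_bound[OF dp finI I_ne c_nonzero fam \<phi>_nonneg \<rho> \<phi>_one F_nonneg isCont_F[OF z0(2)] pos] z0(1)
    by auto
  define h where "h t = (t - (- 2 / real d)) * Re (Z (of_real t))" for t
  have "\<forall>\<^sub>F t in at_right (- 2 / real d). zeta_mero (of_real t) * of_real (t - (- 2 / real d)) - of_real (h t) = 0"
    using ZmZ c0(2) by eventually_elim (auto simp: h_def Z_def[symmetric] complex_is_Real_iff complex_eq_iff)
  hence "((\<lambda>t. zeta_mero (of_real t) * of_real (t - (- 2 / real d)) - of_real (h t)) \<longlongrightarrow> 0) (at_right (- 2 / real d))"
    by (rule tendsto_eventually)
  moreover have "\<forall>\<^sub>F t in at_right (- 2 / real d). 1 * h t \<ge> c0 / real d"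
    using c0(2) by eventually_elim (use dp in \<open>auto simp: h_def Z_def field_simps\<close>)
  moreover have "c0 / real d > 0" using c0 dp by simp
  ultimately show ?thesis by blast
qed

end

lemma wirt_zero_outside:
  assumes "\<And>x. norm x > R \<Longrightarrow> f x = 0" "norm w > R"
  shows "wirt f w = 0"
  using frechet_derivative_zero_outside[OF assms] by (simp add: wirt_def)

lemma wirt_zero_inside:
  assumes "\<And>x. norm x < \<rho> \<Longrightarrow> f x = k" "norm w < \<rho>"
  shows "wirt f w = 0"
proof -
  have "frechet_derivative f (at w) = (\<lambda>_. 0)"
  proof (rule frechet_derivative_at[symmetric])
    have o: "open {x::complex. norm x < \<rho>}" by (intro open_Collect_less continuous_intros)
    have k: "((\<lambda>_. k) has_derivative (\<lambda>_. 0)) (at w)" by simp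
    show "(f has_derivative (\<lambda>_. 0)) (at w)"
      by (rule has_derivative_transform_within_open[OF k o]) (use assms in auto)
  qed
  thus ?thesis by (simp add: wirt_def)
qed

lemma wirt_along_test_product:
  assumes "A \<in> Cc_infinity" "B \<in> Cc_infinity"
  shows "wirt_along e (\<lambda>z. A (z $ 1) * B (z $ 2)) (\<lambda>z. e $ 1 * (wirt A (z $ 1) * B (z $ 2)) + e $ 2 * (A (z $ 1) * wirt B (z $ 2)))"
  using wirt_along_mult[OF wirt_along_test[OF assms(1)] wirt_along_test[OF assms(2)], of e 1 2] by (simp add: mult_ac)

lemma wirt_along_cmult: "wirt_along e f f' \<Longrightarrow> wirt_along e (\<lambda>z. k * f z) (\<lambda>z. k * f' z)"
  using wirt_along_mult[OF wirt_along_const, of e f f' k] by simp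

lemma continuous_test_product:
  assumes "A \<in> Cc_infinity" "B \<in> Cc_infinity"
  shows "continuous_on UNIV (\<lambda>z::complex^2. A (z $ 1) * B (z $ 2))"
  by (intro continuous_intros continuous_on_nth_compose Cc_infinity_continuous assms)

lemma real_powr_bound:
  fixes x :: real
  assumes "x > 0"
  shows "\<exists>C>0. \<forall>y. \<bar>y\<bar> \<le> T \<longrightarrow> x powr y \<le> C"
proof (intro exI[of _ "max 1 x powr T + min 1 x powr - T"] conjI allI impI)
  show "max 1 x powr T + min 1 x powr - T > 0" using assms by (simp add: add_pos_pos)
  show "x powr y \<le> max 1 x powr T + min 1 x powr - T" if "\<bar>y\<bar> \<le> T" for y
    by (rule powr_le_bound) (use assms that in auto)
qed

section \<open>One exponent above half of the degree\<close>

locale lines_dominant = lines_zeta +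
  fixes i1 :: nat
  assumes i1: "i1 \<in> I" and dominant: "2 * a i1 > d"
begin

definition I' :: "nat set" where "I' = I - {i1}"
definition b :: nat where "b = d - a i1"
text \<open>Spans the line \<open>i1\<close>. The number \<open>\<mu> i\<close> is the value there
  of the form \<open>c i\<close>, so that all the \<open>x i\<close> restrict to the same coordinate
  on that line; \<open>K\<close> collects the constants taken out by this normalisation.\<close>

definition e0 :: "complex^2" where "e0 = vec2 (c i1 $ 2) (- (c i1 $ 1))"
definition \<mu> :: "nat \<Rightarrow> complex" where "\<mu> i = lform (c i) e0"
definition K :: complex where "K = (\<Prod>i\<in>I'. \<mu> i ^ a i)"
definition x :: "nat \<Rightarrow> complex^2 \<Rightarrow> complex" where "x i z = lform (c i) z / \<mu> i"
definition wt :: "nat \<Rightarrow> real" where "wt i = real (a i) / real b"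
text \<open>All the weight \<open>b\<close> of the lines other than \<open>i1\<close> is put on the
  single line \<open>i\<close>, so \<open>H i\<close> has two lines and the same degree of
  homogeneity as \<open>F\<close>.\<close>

definition H :: "nat \<Rightarrow> complex \<Rightarrow> complex^2 \<Rightarrow> complex" where
  "H i s z = abs_pow (lform (c i1) z) (of_nat (a i1) * s) * (abs_pow K s * abs_pow (x i z) (of_nat b * s))"

text \<open>The difference in the inequality of weighted arithmetic and geometric means. The forms
  \<open>x i\<close> are normalised to agree on the line \<open>i1\<close>, so that the difference vanishes there to
  second order; this compensates the pole of \<open>abs_pow (lform (c i1) z) (a i1 * s)\<close>.\<close>

definition G :: "complex \<Rightarrow> complex^2 \<Rightarrow> complex" where
  "G s z = (\<Sum>i\<in>I'. of_real (wt i) * H i s z) - F s z"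

lemma I': "finite I'" "i1 \<notin> I'" "I = insert i1 I'" "I' \<subseteq> I"
  using finI i1 by (auto simp: I'_def)

lemma sum_a: "(\<Sum>i\<in>I'. a i) = b" "a i1 + b = d"
proof -
  have "d = a i1 + (\<Sum>i\<in>I'. a i)" unfolding d_def I'_def by (rule sum.remove[OF finI i1])
  thus "(\<Sum>i\<in>I'. a i) = b" "a i1 + b = d" by (simp_all add: b_def)
qed

lemma b_bounds: "b > 0" "2 * b < d" "i \<in> I' \<Longrightarrow> a i \<le> b"
proof -
  show "b > 0" using a_less_d[OF i1] by (simp add: b_def)
  show "2 * b < d" using dominant sum_a(2) by linarith
  show "i \<in> I' \<Longrightarrow> a i \<le> b" using member_le_sum[of i I' a] I' sum_a(1) by simp
qed

lemma \<mu>_nonzero: "i \<in> I' \<Longrightarrow> \<mu> i \<noteq> 0"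
  using indep[of i i1] i1 by (auto simp: \<mu>_def e0_def lform_def I'_def mult.commute)

lemma e0: "lform (c i1) e0 = 0" "e0 \<noteq> 0"
  using c_nonzero[OF i1] by (auto simp: e0_def lform_def vec2_eq_iff)

lemma K_nonzero: "K \<noteq> 0"
  using I' \<mu>_nonzero by (simp add: K_def)

lemma wt: "i \<in> I' \<Longrightarrow> wt i > 0" "(\<Sum>i\<in>I'. wt i) = 1"
proof -
  show "i \<in> I' \<Longrightarrow> wt i > 0" using a_pos b_bounds I' by (auto simp: wt_def)
  have "(\<Sum>i\<in>I'. wt i) = real (\<Sum>i\<in>I'. a i) / real b" by (simp add: wt_def sum_divide_distrib)
  thus "(\<Sum>i\<in>I'. wt i) = 1" using sum_a b_bounds by simp
qed

lemma abs_pow_prod_powers: "(\<Prod>i\<in>I'. abs_pow w (of_nat (a i) * s)) = abs_pow w (of_nat b * s)"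
proof (cases "w = 0")
  case True
  have "I' \<noteq> {}" using sum_a b_bounds by auto
  thus ?thesis using True I' by (simp add: power_0_left)
next
  case False
  have "(\<Prod>i\<in>I'. abs_pow w (of_nat (a i) * s)) = exp (\<Sum>i\<in>I'. 2 * (of_nat (a i) * s) * of_real (ln (cmod w)))"
    using False I' by (simp add: abs_pow_eq_exp exp_sum)
  also have "(\<Sum>i\<in>I'. 2 * (of_nat (a i) * s) * of_real (ln (cmod w))) = 2 * (of_nat (\<Sum>i\<in>I'. a i) * s) * of_real (ln (cmod w))"
    by (simp add: sum_distrib_left sum_distrib_right mult_ac)
  finally show ?thesis using False by (simp add: sum_a abs_pow_eq_exp)
qed

lemma F_factor: "F s z = abs_pow (lform (c i1) z) (of_nat (a i1) * s) * (abs_pow K s * (\<Prod>i\<in>I'. abs_pow (x i z) (of_nat (a i) * s)))"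
proof -
  have "abs_pow K s = (\<Prod>i\<in>I'. abs_pow (\<mu> i) (of_nat (a i) * s))"
    unfolding K_def abs_pow_prod by (intro prod.cong refl abs_pow_power) (use a_pos I' in auto)
  hence "abs_pow K s * (\<Prod>i\<in>I'. abs_pow (x i z) (of_nat (a i) * s)) = (\<Prod>i\<in>I'. abs_pow (\<mu> i) (of_nat (a i) * s) * abs_pow (x i z) (of_nat (a i) * s))"
    by (simp add: prod.distrib)
  also have "\<dots> = (\<Prod>i\<in>I'. abs_pow (lform (c i) z) (of_nat (a i) * s))"
    by (intro prod.cong refl) (simp add: abs_pow_mult[symmetric] x_def \<mu>_nonzero)
  finally show ?thesis
    using prod.remove[OF finI i1, of "\<lambda>i. abs_pow (lform (c i) z) (of_nat (a i) * s)"] by (simp add: F_def I'_def)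
qed

lemma G_factor: "G s z = abs_pow (lform (c i1) z) (of_nat (a i1) * s) * (abs_pow K s *
    ((\<Sum>i\<in>I'. of_real (wt i) * abs_pow (x i z) (of_nat b * s)) - (\<Prod>i\<in>I'. abs_pow (x i z) (of_nat (a i) * s))))"
  unfolding G_def H_def F_factor by (simp add: right_diff_distrib sum_distrib_left mult_ac)

lemma x_measurable [measurable]: "x i \<in> borel_measurable borel"
  unfolding x_def by measurable

lemma H_measurable [measurable]: "H i s \<in> borel_measurable borel"
  unfolding H_def by measurable

lemma G_measurable [measurable]: "G s \<in> borel_measurable borel"
  unfolding G_def by measurable

lemma H_holomorphic: "(\<lambda>s. H i s z) holomorphic_on S"
  unfolding H_def by (intro holomorphic_intros)

lemma G_holomorphic: "(\<lambda>s. G s z) holomorphic_on S"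
  unfolding G_def by (intro holomorphic_intros H_holomorphic F_holomorphic)

lemma H_homogeneous:
  assumes t: "t > 0"
  shows "H i s (t *\<^sub>R z) = of_real t powr (2 * of_real (real d) * s) * H i s z"
proof -
  have "x i (t *\<^sub>R z) = of_real t * x i z" by (simp add: x_def)
  hence "H i s (t *\<^sub>R z) = (of_real t powr (2 * (of_nat (a i1) * s)) * of_real t powr (2 * (of_nat b * s))) * H i s z"
    using t by (simp add: H_def abs_pow_of_real_mult)
  also have "of_real t powr (2 * (of_nat (a i1) * s)) * complex_of_real t powr (2 * (of_nat b * s)) =
     of_real t powr (2 * (of_nat (a i1) * s) + 2 * (of_nat b * s))"
    using t by (simp add: powr_add)
  also have "2 * (of_nat (a i1) * s) + 2 * (of_nat b * s) = 2 * of_real (real d) * s"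
    unfolding sum_a(2)[symmetric] by (simp add: algebra_simps)
  finally show ?thesis .
qed

lemma G_homogeneous: "t > 0 \<Longrightarrow> G s (t *\<^sub>R z) = of_real t powr (2 * of_real (real d) * s) * G s z"
  unfolding G_def by (simp add: H_homogeneous F_homogeneous sum_distrib_left algebra_simps)

lemma abs_pow_of_nat_real: "abs_pow w (of_nat n * of_real s) = of_real (cmod w powr (2 * (real n * s)))"
  using abs_pow_of_real[of w "real n * s"] by simp

lemma G_real: "G (of_real s) z = of_real (cmod (lform (c i1) z) powr (2 * (real (a i1) * s)) * (cmod K powr (2 * s) *
    ((\<Sum>i\<in>I'. wt i * cmod (x i z) powr (2 * (real b * s))) - (\<Prod>i\<in>I'. cmod (x i z) powr (2 * (real (a i) * s))))))"
  unfolding G_factor by (simp add: abs_pow_of_nat_real abs_pow_of_real)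

lemma means:
  fixes s :: real
  assumes nz: "\<forall>i\<in>I'. x i z \<noteq> 0"
  defines "P \<equiv> \<lambda>i. 2 * (real b * s) * ln (cmod (x i z))"
  shows "(\<Prod>i\<in>I'. cmod (x i z) powr (2 * (real (a i) * s))) = exp (\<Sum>i\<in>I'. wt i * P i)"
    and "(\<Sum>i\<in>I'. wt i * cmod (x i z) powr (2 * (real b * s))) = (\<Sum>i\<in>I'. wt i * exp (P i))"
proof -
  have "(\<Prod>i\<in>I'. cmod (x i z) powr (2 * (real (a i) * s))) = exp (\<Sum>i\<in>I'. 2 * (real (a i) * s) * ln (cmod (x i z)))"
    using nz I' by (simp add: powr_def exp_sum)
  also have "(\<Sum>i\<in>I'. 2 * (real (a i) * s) * ln (cmod (x i z))) = (\<Sum>i\<in>I'. wt i * P i)"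
    using b_bounds by (intro sum.cong refl) (simp add: P_def wt_def)
  finally show "(\<Prod>i\<in>I'. cmod (x i z) powr (2 * (real (a i) * s))) = exp (\<Sum>i\<in>I'. wt i * P i)" .
  show "(\<Sum>i\<in>I'. wt i * cmod (x i z) powr (2 * (real b * s))) = (\<Sum>i\<in>I'. wt i * exp (P i))"
    using nz by (intro sum.cong refl) (simp add: powr_def P_def)
qed

lemma G_nonneg: "G (of_real s) z \<in> \<real>\<^sub>\<ge>\<^sub>0"
proof -
  have "(\<Prod>i\<in>I'. cmod (x i z) powr (2 * (real (a i) * s))) \<le> (\<Sum>i\<in>I'. wt i * cmod (x i z) powr (2 * (real b * s)))"
  proof (cases "\<forall>i\<in>I'. x i z \<noteq> 0")
    case True
    show ?thesis unfolding means[OF True] by (rule weighted_exp_mean(1)[OF I'(1) wt])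
  next
    case False
    then obtain i where "i \<in> I'" "x i z = 0" by blast
    hence "(\<Prod>i\<in>I'. cmod (x i z) powr (2 * (real (a i) * s))) = 0"
      using I' by (intro prod_zero) auto
    moreover have "0 \<le> (\<Sum>i\<in>I'. wt i * cmod (x i z) powr (2 * (real b * s)))"
      by (intro sum_nonneg mult_nonneg_nonneg less_imp_le[OF wt(1)]) auto
    ultimately show ?thesis by simp
  qed
  thus ?thesis unfolding G_real nonneg_Reals_of_real_iff by (intro mult_nonneg_nonneg) auto
qed

text \<open>Equality of the means would force all \<open>x i\<close> to have the same absolute
  value. Two of them are available thanks to the third line, and they differ where one vanishes; the
  open set where they differ contains a point off all lines. With only one form besides
  \<open>i1\<close> the function \<open>G\<close> would vanish identically.\<close>

lemma G_positive: "\<exists>z0. z0 \<noteq> 0 \<and> (\<forall>i\<in>I. lform (c i) z0 \<noteq> 0) \<and> Re (G (of_real (- 2 / real d)) z0) > 0"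
proof -
  obtain i where i: "i \<in> I" "i \<noteq> i1" using other_line[OF i1] by blast
  obtain l where l: "l \<in> I" "l \<noteq> i" "l \<noteq> i1" using third_line[of i i1] by blast
  have il: "i \<in> I'" "l \<in> I'" using i l by (auto simp: I'_def)
  define U where "U = {z. cmod (x i z) < cmod (x l z)}"
  have "open U" unfolding U_def x_def
    by (intro open_Collect_less continuous_intros) (use \<mu>_nonzero il in auto)
  moreover have "vec2 (c i $ 2) (- (c i $ 1)) \<in> U"
    using indep[of l i] i l \<mu>_nonzero[OF il(2)] by (simp add: U_def x_def lform_def mult.commute)
  hence "U \<noteq> {}" by blast
  ultimately obtain z0 where z0: "z0 \<in> U" "\<forall>i\<in>I. lform (c i) z0 \<noteq> 0" using avoid_lines by blast
  have nz: "\<forall>i\<in>I'. x i z0 \<noteq> 0" using z0(2) I' \<mu>_nonzero by (auto simp: x_def)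
  define s where "s = - 2 / real d"
  define P where "P i = 2 * (real b * s) * ln (cmod (x i z0))" for i
  have "ln (cmod (x i z0)) < ln (cmod (x l z0))"
    using z0(1) nz il by (simp add: U_def)
  moreover have "2 * (real b * s) \<noteq> 0" using b_bounds d_pos by (simp add: s_def)
  ultimately have "P i \<noteq> P l" by (simp add: P_def)
  hence ex: "\<exists>i\<in>I'. P i \<noteq> (\<Sum>i\<in>I'. wt i * P i)" using il by metis
  have "exp (\<Sum>i\<in>I'. wt i * P i) < (\<Sum>i\<in>I'. wt i * exp (P i))"
    by (rule weighted_exp_mean(2)[OF I'(1) wt ex])
  moreover have "lform (c i1) z0 \<noteq> 0" using z0(2) i1 by blast
  ultimately have "Re (G (of_real s) z0) > 0"
    unfolding G_real means[OF nz] P_def[symmetric] using K_nonzero by simp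
  moreover have "z0 \<noteq> 0" using \<open>lform (c i1) z0 \<noteq> 0\<close> by auto
  ultimately show ?thesis using z0(2) by (auto simp: s_def)
qed

lemma isCont_G:
  assumes "\<forall>i\<in>I. lform (c i) z0 \<noteq> 0"
  shows "isCont (\<lambda>p. G (of_real (fst p)) (snd p)) (y, z0)"
proof -
  have l: "isCont (\<lambda>p::real \<times> (complex^2). lform v (snd p)) (y, z0)" for v
    using continuous_on_eq_continuous_at[OF open_UNIV, of "\<lambda>p::real \<times> (complex^2). lform v (snd p)"]
    by (auto intro!: continuous_intros)
  have "isCont (\<lambda>p. H i (of_real (fst p)) (snd p)) (y, z0)" if "i \<in> I'" for i
    unfolding H_def x_def
    by (intro continuous_intros isCont_abs_pow l) (use that assms i1 I' K_nonzero \<mu>_nonzero in auto)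
  thus ?thesis unfolding G_def by (intro continuous_intros isCont_F assms) auto
qed

lemma e1_exists: "\<exists>e1. lform (c i1) e1 = 1"
proof (cases "c i1 $ 1 = 0")
  case True
  hence "c i1 $ 2 \<noteq> 0" using c_nonzero[OF i1] by (auto simp: vec2_eq_iff)
  thus ?thesis by (intro exI[of _ "vec2 0 (1 / c i1 $ 2)"]) (simp add: lform_def)
next
  case False
  thus ?thesis by (intro exI[of _ "vec2 (1 / c i1 $ 1) 0"]) (simp add: lform_def)
qed

lemma kernel_line:
  assumes "lform (c i1) v = 0"
  shows "\<exists>\<xi>. v = \<xi> *s e0"
proof (cases "c i1 $ 1 = 0")
  case True
  hence "c i1 $ 2 \<noteq> 0" using c_nonzero[OF i1] by (auto simp: vec2_eq_iff)
  thus ?thesis using assms True by (intro exI[of _ "v $ 1 / c i1 $ 2"]) (auto simp: vec2_eq_iff e0_def lform_def)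
next
  case False
  have "c i1 $ 1 * v $ 1 = - (c i1 $ 2 * v $ 2)" using assms by (simp add: lform_def add_eq_0_iff2)
  thus ?thesis using False
    by (intro exI[of _ "- v $ 2 / c i1 $ 1"]) (auto simp: vec2_eq_iff e0_def field_simps)
qed

lemma norm_smult_vec: "norm (w *s (v :: complex^2)) = cmod w * norm v"
  by (simp add: norm_vec_def L2_set_def norm_mult power_mult_distrib sum_distrib_left[symmetric] real_sqrt_mult)

text \<open>In coordinates \<open>z = \<xi> *s e0 + u *s e1\<close> with
  \<open>u = lform (c i1) z\<close>, the normalised forms are
  \<open>x i z = \<xi> * (1 + w * \<nu> i)\<close> with \<open>w = u / \<xi>\<close>. Near the line
  \<open>\<xi>\<close> is bounded above and below, both means share the factor
  \<open>abs_pow \<xi> (b * t)\<close>, and the rest is the defect of the exponential mean at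
  arguments of size \<open>cmod w\<close>, hence of order \<open>(cmod u)\<^sup>2\<close>.\<close>

lemma G_near_line:
  assumes T: "T > 0"
  shows "\<exists>\<kappa>>0. \<kappa> \<le> 1 \<and> (\<exists>C>0. \<forall>t z. cmod t \<le> T \<longrightarrow> norm z = 1 \<longrightarrow> cmod (lform (c i1) z) < \<kappa> \<longrightarrow>
    norm (G t z) \<le> C * (norm (abs_pow (lform (c i1) z) (of_nat (a i1) * t)) * (cmod (lform (c i1) z))\<^sup>2))"
proof -
  obtain e1 where e1: "lform (c i1) e1 = 1" using e1_exists by blast
  define \<nu> where "\<nu> i = lform (c i) e1 / \<mu> i" for i
  define V where "V = Max (insert 1 ((\<lambda>i. cmod (\<nu> i)) ` I'))"
  have fin: "finite (insert 1 ((\<lambda>i. cmod (\<nu> i)) ` I'))" using I' by simp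
  have V: "V \<ge> 1" "\<And>i. i \<in> I' \<Longrightarrow> cmod (\<nu> i) \<le> V" unfolding V_def using fin by (auto intro: Max_ge)
  define ne where "ne = norm e0"
  have ne: "ne > 0" using e0 by (simp add: ne_def)
  \<comment> \<open>The sum of two demands: \<open>cmod w * W \<le> 1\<close> yields both
    \<open>cmod w * V \<le> 1/2\<close>, for the logarithm estimate, and
    \<open>\<eta> \<le> 1\<close>, for the defect estimate.\<close>
  define W where "W = V * (4 * real b * T + 2)"
  have W: "W > 0" using V T by (simp add: W_def add_nonneg_pos)
  \<comment> \<open>The first entry keeps \<open>cmod \<xi> * ne \<ge> 1/2\<close>; given this, the
    second ensures \<open>cmod w * W \<le> 1\<close>.\<close>
  define \<kappa> where "\<kappa> = min (1 / (2 * (norm e1 + 1))) (1 / (2 * ne * W))"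
  have \<kappa>0: "\<kappa> > 0" using ne W by (simp add: \<kappa>_def add_nonneg_pos)
  have "1 / (2 * (norm e1 + 1)) \<le> 1"
  proof -
    have "1 \<le> 2 * (norm e1 + 1)" using norm_ge_zero[of e1] by (simp del: norm_ge_zero)
    hence "inverse (2 * (norm e1 + 1)) \<le> 1" by (rule inverse_le_1_iff[THEN iffD2, OF disjI2])
    thus ?thesis by (simp only: inverse_eq_divide)
  qed
  hence \<kappa>1: "\<kappa> \<le> 1" unfolding \<kappa>_def by (rule min.coboundedI1)
  have \<kappa>2: "\<kappa> * norm e1 \<le> 1 / 2"
  proof -
    have "\<kappa> * norm e1 \<le> (1 / (2 * (norm e1 + 1))) * norm e1" by (intro mult_right_mono) (auto simp: \<kappa>_def)
    also have "\<dots> \<le> (1 / (2 * (norm e1 + 1))) * (norm e1 + 1)" by (intro mult_left_mono) auto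
    also have "\<dots> = 1 / 2"
    proof -
      have "norm e1 + 1 \<noteq> 0" using norm_ge_zero[of e1] by (simp add: add_nonneg_eq_0_iff)
      thus ?thesis by simp
    qed
    finally show ?thesis .
  qed
  have \<kappa>3: "\<kappa> * (2 * ne) * W \<le> 1"
  proof -
    have "\<kappa> * (2 * ne * W) \<le> (1 / (2 * ne * W)) * (2 * ne * W)" by (intro mult_right_mono) (use ne W in \<open>auto simp: \<kappa>_def\<close>)
    thus ?thesis using ne W by (simp add: mult.assoc)
  qed
  obtain AK where AK: "AK > 0" "\<And>y. \<bar>y\<bar> \<le> 2 * T \<Longrightarrow> cmod K powr y \<le> AK"
    using real_powr_bound[of "cmod K" "2 * T"] K_nonzero by auto
  define lo where "lo = min 1 (1 / (2 * ne))"
  define hi where "hi = max 1 ((1 + norm e1) / ne)"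
  define A\<xi> where "A\<xi> = hi powr (2 * real b * T) + lo powr - (2 * real b * T)"
  have lo: "lo > 0" "lo \<le> 1" and hi: "hi \<ge> 1" using ne by (auto simp: lo_def hi_def)
  have A\<xi>: "A\<xi> > 0" using lo hi by (simp add: A\<xi>_def add_pos_pos)
  \<comment> \<open>\<open>AK\<close> and \<open>A\<xi>\<close> bound the powers of \<open>K\<close>
    and \<open>\<xi>\<close>; the last factor is \<open>6 * \<eta>\<^sup>2\<close> with
    \<open>cmod w\<close> replaced by its bound \<open>2 * ne * cmod u\<close>, without
    \<open>cmod u\<close>.\<close>
  define C where "C = AK * A\<xi> * (6 * (4 * real b * T * V * (2 * ne))\<^sup>2)"
  have C: "C > 0" using AK A\<xi> b_bounds T V ne by (simp add: C_def)
  have "norm (G t z) \<le> C * (norm (abs_pow (lform (c i1) z) (of_nat (a i1) * t)) * (cmod (lform (c i1) z))\<^sup>2)"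
    if t: "cmod t \<le> T" and z: "norm z = 1" and u\<kappa>: "cmod (lform (c i1) z) < \<kappa>" for t z
  proof -
    define u where "u = lform (c i1) z"
    have u1: "cmod u < \<kappa>" using u\<kappa> by (simp add: u_def)
    have "lform (c i1) (z + (- u) *s e1) = u + (- u) * lform (c i1) e1"
      unfolding u_def by (simp add: lform_def algebra_simps)
    hence "lform (c i1) (z + (- u) *s e1) = 0" using e1 by simp
    then obtain \<xi> where \<xi>: "z + (- u) *s e1 = \<xi> *s e0" using kernel_line by blast
    have z_eq: "z = \<xi> *s e0 + u *s e1" using \<xi> by (simp add: vec_eq_iff algebra_simps)
    have n\<xi>: "cmod \<xi> * ne = norm (z + (- u) *s e1)" unfolding \<xi> by (simp add: norm_smult_vec ne_def)
    have nue: "norm ((- u) *s e1) \<le> \<kappa> * norm e1" using u1 by (simp add: norm_smult_vec mult_right_mono)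
    have "cmod \<xi> * ne \<ge> 1 - \<kappa> * norm e1" unfolding n\<xi> using norm_diff_ineq[of z "(- u) *s e1"] nue z by linarith
    hence \<xi>ge: "cmod \<xi> * ne \<ge> 1 / 2" using \<kappa>2 by linarith
    have "cmod \<xi> * ne \<le> 1 + norm e1"
    proof -
      have "\<kappa> * norm e1 \<le> 1 * norm e1" using \<kappa>1 by (intro mult_right_mono) auto
      thus ?thesis unfolding n\<xi> using norm_triangle_ineq[of z "(- u) *s e1"] nue z by linarith
    qed
    hence "cmod \<xi> \<le> (1 + norm e1) / ne" by (simp add: pos_le_divide_eq[OF ne])
    hence \<xi>hi: "cmod \<xi> \<le> hi" unfolding hi_def by (rule max.coboundedI2)
    have "1 / (2 * ne) \<le> cmod \<xi>" using \<xi>ge ne by (simp add: field_simps)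
    hence \<xi>lo: "lo \<le> cmod \<xi>" unfolding lo_def by (rule min.coboundedI2)
    hence \<xi>0: "\<xi> \<noteq> 0" using lo by auto
    define w where "w = u / \<xi>"
    have wu: "cmod w \<le> cmod u * (2 * ne)"
    proof -
      have "cmod u * 1 \<le> cmod u * (2 * ne * cmod \<xi>)" using \<xi>ge by (intro mult_left_mono) (auto simp: mult_ac)
      thus ?thesis using \<xi>0 by (simp add: w_def norm_divide field_simps)
    qed
    have xi: "x i z = \<xi> * (1 + w * \<nu> i)" if "i \<in> I'" for i
    proof -
      have "lform (c i) z = \<xi> * \<mu> i + u * lform (c i) e1"
        unfolding z_eq \<mu>_def by (simp add: lform_def algebra_simps)
      thus ?thesis using \<xi>0 \<mu>_nonzero[OF that] by (simp add: x_def w_def \<nu>_def field_simps)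
    qed
    have wW: "cmod w * W \<le> 1"
    proof -
      have "cmod w * W \<le> (\<kappa> * (2 * ne)) * W"
        using wu u1 ne W by (intro mult_right_mono order_trans[OF wu] mult_right_mono) auto
      thus ?thesis using \<kappa>3 by linarith
    qed
    have w\<nu>: "cmod (w * \<nu> i) \<le> cmod w * V" if "i \<in> I'" for i
      using V(2)[OF that] by (simp add: norm_mult mult_left_mono)
    have wV: "cmod w * V * (4 * real b * T) + cmod w * V * 2 \<le> 1"
      using wW by (simp add: W_def algebra_simps)
    have half: "cmod w * V \<le> 1 / 2"
    proof -
      have "0 \<le> cmod w * V * (4 * real b * T)" using V T by (intro mult_nonneg_nonneg) auto
      thus ?thesis using wV by linarith
    qed
    define \<eta> where "\<eta> = 4 * real b * T * V * cmod w"
    have \<eta>1: "\<eta> \<le> 1"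
    proof -
      have "0 \<le> cmod w * V * 2" using V by auto
      thus ?thesis using wV by (simp add: \<eta>_def mult_ac)
    qed
    define h where "h i = 2 * (of_nat b * t) * of_real (ln (cmod (1 + w * \<nu> i)))" for i
    have h: "norm (h i) \<le> \<eta>" if "i \<in> I'" for i
    proof -
      have "\<bar>ln (cmod (1 + w * \<nu> i))\<bar> \<le> 2 * cmod (w * \<nu> i)"
        by (rule abs_ln_norm_one_plus) (use w\<nu>[OF that] half in linarith)
      hence "\<bar>ln (cmod (1 + w * \<nu> i))\<bar> \<le> 2 * (cmod w * V)" using w\<nu>[OF that] by linarith
      hence "2 * (real b * cmod t) * \<bar>ln (cmod (1 + w * \<nu> i))\<bar> \<le> 2 * (real b * T) * (2 * (cmod w * V))"
        using t T by (intro mult_mono mult_left_mono) auto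
      thus ?thesis by (simp add: h_def \<eta>_def norm_mult mult_ac)
    qed
    have nz1: "1 + w * \<nu> i \<noteq> 0" if "i \<in> I'" for i
    proof
      assume "1 + w * \<nu> i = 0"
      hence "cmod (w * \<nu> i) = 1" by (metis add_eq_0_iff norm_minus_cancel norm_one)
      thus False using w\<nu>[OF that] half by linarith
    qed
    have 1: "abs_pow (x i z) (of_nat b * t) = abs_pow \<xi> (of_nat b * t) * exp (h i)" if "i \<in> I'" for i
      using nz1[OF that] by (simp add: xi[OF that] abs_pow_mult abs_pow_eq_exp[of "1 + w * \<nu> i"] h_def)
    have 2: "(\<Prod>i\<in>I'. abs_pow (x i z) (of_nat (a i) * t)) = abs_pow \<xi> (of_nat b * t) * exp (\<Sum>i\<in>I'. of_real (wt i) * h i)"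
    proof -
      have "(\<Prod>i\<in>I'. abs_pow (x i z) (of_nat (a i) * t)) = (\<Prod>i\<in>I'. abs_pow \<xi> (of_nat (a i) * t) * exp (of_real (wt i) * h i))"
      proof (intro prod.cong refl)
        fix i assume i: "i \<in> I'"
        have "of_real (wt i) * h i = 2 * (of_nat (a i) * t) * of_real (ln (cmod (1 + w * \<nu> i)))"
          using b_bounds by (simp add: wt_def h_def)
        thus "abs_pow (x i z) (of_nat (a i) * t) = abs_pow \<xi> (of_nat (a i) * t) * exp (of_real (wt i) * h i)"
          using nz1[OF i] by (simp add: xi[OF i] abs_pow_mult abs_pow_eq_exp[of "1 + w * \<nu> i"])
      qed
      thus ?thesis using I' by (simp add: prod.distrib abs_pow_prod_powers exp_sum)
    qed
    define \<Delta> where "\<Delta> = (\<Sum>i\<in>I'. of_real (wt i) * exp (h i)) - exp (\<Sum>i\<in>I'. of_real (wt i) * h i)"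
    have \<Delta>: "norm \<Delta> \<le> 6 * \<eta>\<^sup>2" unfolding \<Delta>_def
      by (rule weighted_exp_mean_defect[OF I'(1) wt h \<eta>1])
    have "(\<Sum>i\<in>I'. of_real (wt i) * abs_pow (x i z) (of_nat b * t)) = abs_pow \<xi> (of_nat b * t) * (\<Sum>i\<in>I'. of_real (wt i) * exp (h i))"
      unfolding sum_distrib_left by (intro sum.cong refl) (simp add: 1)
    hence "G t z = abs_pow u (of_nat (a i1) * t) * (abs_pow K t * (abs_pow \<xi> (of_nat b * t) * \<Delta>))"
      unfolding G_factor 2 by (simp add: \<Delta>_def right_diff_distrib u_def)
    hence "norm (G t z) = norm (abs_pow u (of_nat (a i1) * t)) * (norm (abs_pow K t) * (norm (abs_pow \<xi> (of_nat b * t)) * norm \<Delta>))"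
      by (simp add: norm_mult)
    also have "\<dots> \<le> norm (abs_pow u (of_nat (a i1) * t)) * (AK * (A\<xi> * (6 * (4 * real b * T * V * (2 * ne))\<^sup>2 * (cmod u)\<^sup>2)))"
    proof (intro mult_mono mult_nonneg_nonneg order_refl)
      have Ret: "\<bar>Re t\<bar> \<le> T" using t abs_Re_le_cmod[of t] by linarith
      show "norm (abs_pow K t) \<le> AK" unfolding norm_abs_pow using Ret by (intro AK) auto
      show "norm (abs_pow \<xi> (of_nat b * t)) \<le> A\<xi>" unfolding norm_abs_pow A\<xi>_def
      proof (rule powr_le_bound[OF lo \<xi>lo \<xi>hi hi])
        have "real b * \<bar>Re t\<bar> \<le> real b * T" using Ret by (intro mult_left_mono) auto
        thus "\<bar>2 * Re (of_nat b * t)\<bar> \<le> 2 * real b * T" by (simp add: abs_mult)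
      qed
      have "\<eta> \<le> 4 * real b * T * V * (cmod u * (2 * ne))" unfolding \<eta>_def
        using wu T V by (intro mult_left_mono) auto
      moreover have "0 \<le> \<eta>" using T V by (simp add: \<eta>_def)
      ultimately have "\<eta>\<^sup>2 \<le> (4 * real b * T * V * (cmod u * (2 * ne)))\<^sup>2" by (intro power_mono)
      also have "\<dots> = (4 * real b * T * V * (2 * ne))\<^sup>2 * (cmod u)\<^sup>2" by (simp add: power_mult_distrib mult_ac)
      finally show "norm \<Delta> \<le> 6 * (4 * real b * T * V * (2 * ne))\<^sup>2 * (cmod u)\<^sup>2" using \<Delta> by linarith
    qed (use AK A\<xi> in auto)
    also have "\<dots> = C * (norm (abs_pow u (of_nat (a i1) * t)) * (cmod u)\<^sup>2)" by (simp add: C_def mult_ac)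
    finally show ?thesis by (simp add: u_def)
  qed
  thus ?thesis using \<kappa>0 \<kappa>1 C by blast
qed

text \<open>Pads with exponent 0, so that \<open>sphere_bound\<close> applies to products over fewer
  lines. The forms must not vanish because \<open>0 powr 0 = 0\<close>.\<close>

lemma prod_supported_exponents:
  assumes "\<forall>l\<in>I. lform (c l) z \<noteq> 0" "A \<subseteq> I"
  shows "(\<Prod>l\<in>I. cmod (lform (c l) z) powr (if l \<in> A then e l else 0)) = (\<Prod>l\<in>A. cmod (lform (c l) z) powr e l)"
  using assms finI by (intro prod.mono_neutral_cong_right) auto

text \<open>Near the line \<open>i1\<close> the double zero leaves the exponent
  \<open>2 * a i1 * Re t + 2\<close>, which exceeds -2 because \<open>a i1 < d\<close>. Away from it
  \<open>lform (c i1)\<close> is bounded below, and the remaining exponents have coefficient at most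
  \<open>d\<close> because \<open>2 * b < d\<close>; these too exceed -2.\<close>

lemma G_bound:
  assumes s: "Re s > - 2 / real d"
  shows "\<exists>r>0. \<exists>C y. 0 \<le> y \<and> y < 2 \<and> (\<forall>t\<in>ball s r. \<forall>z. norm z = 1 \<longrightarrow> (\<forall>i\<in>I. lform (c i) z \<noteq> 0)
              \<longrightarrow> norm (G t z) \<le> C * (\<Sum>i\<in>I. cmod (lform (c i) z) powr - y))"
proof -
  define \<sigma> where "\<sigma> = (Re s + (- 2 / real d)) / 2"
  define r where "r = Re s - \<sigma>"
  have dp: "real d > 0" using d_pos by simp
  have \<sigma>: "- 2 / real d < \<sigma>" and r: "r > 0" using s by (auto simp: \<sigma>_def r_def field_simps)
  have d\<sigma>: "- (real d * \<sigma>) < 2" using \<sigma> dp by (simp add: field_simps)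
  define T where "T = cmod s + r"
  have T: "T > 0" using r by (simp add: T_def add_nonneg_pos)
  define a1 where "a1 = 2 * real (a i1)"
  have a1: "0 \<le> a1" "a1 < 2 * real d" using a_less_d[OF i1] by (auto simp: a1_def)
  define y where "y = max 0 (max (- (real d * \<sigma>)) (- (a1 * \<sigma>) - 2))"
  have "- (a1 * \<sigma>) - 2 < 2"
  proof (cases "\<sigma> \<ge> 0")
    case True
    thus ?thesis using a1 mult_nonneg_nonneg[of a1 \<sigma>] by linarith
  next
    case False
    have "a1 * (- \<sigma>) \<le> (2 * real d) * (- \<sigma>)" using a1 False by (intro mult_right_mono) auto
    thus ?thesis using d\<sigma> by (simp add: mult.assoc)
  qed
  hence y: "0 \<le> y" "y < 2" using d\<sigma> by (auto simp: y_def)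
 have dy: "- (real d * \<sigma>) \<le> y" by (simp add: y_def)
  define N where "N = max y (2 * real d * T + 2)"
  obtain C where C: "C > 0" "\<And>z e. norm z = 1 \<Longrightarrow> \<forall>i\<in>I. lform (c i) z \<noteq> 0 \<Longrightarrow> \<forall>i\<in>I. - y \<le> e i \<and> e i \<le> N \<Longrightarrow>
    (\<Prod>i\<in>I. cmod (lform (c i) z) powr e i) \<le> C * (\<Sum>i\<in>I. cmod (lform (c i) z) powr - y)"
    using sphere_bound[OF y(1), of N] by (auto simp: N_def)
  obtain \<kappa> C1 where \<kappa>: "\<kappa> > 0" "\<kappa> \<le> 1" and C1: "C1 > 0" "\<And>t z. cmod t \<le> T \<Longrightarrow> norm z = 1 \<Longrightarrow> cmod (lform (c i1) z) < \<kappa> \<Longrightarrow>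
    norm (G t z) \<le> C1 * (norm (abs_pow (lform (c i1) z) (of_nat (a i1) * t)) * (cmod (lform (c i1) z))\<^sup>2)"
    using G_near_line[OF T] by blast
  define A1 where "A1 = M powr (2 * real d * T) + \<kappa> powr - (2 * real d * T)"
  have A1: "A1 > 0" using M(1) \<kappa> by (simp add: A1_def add_pos_pos)
  obtain AK where AK: "AK > 0" "\<And>y. \<bar>y\<bar> \<le> 2 * T \<Longrightarrow> cmod K powr y \<le> AK"
    using real_powr_bound[of "cmod K" "2 * T"] K_nonzero by auto
  have "\<forall>i. \<exists>A>0. i \<in> I' \<longrightarrow> (\<forall>y. \<bar>y\<bar> \<le> real d * T \<longrightarrow> (1 / cmod (\<mu> i)) powr y \<le> A)"
    using real_powr_bound[of "1 / cmod (\<mu> i)" "real d * T" for i] \<mu>_nonzero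
    by (metis divide_pos_pos zero_less_norm_iff zero_less_one)
  then obtain A\<mu> where A\<mu>: "\<And>i. A\<mu> i > 0" "\<And>i y. i \<in> I' \<Longrightarrow> \<bar>y\<bar> \<le> real d * T \<Longrightarrow> (1 / cmod (\<mu> i)) powr y \<le> A\<mu> i"
    by metis
  define C2 where "C2 = (\<Sum>i\<in>I'. wt i * (A1 * (AK * (C * A\<mu> i)))) + A1 * C"
  have C2: "C2 \<ge> 0" unfolding C2_def using A1 AK C A\<mu> wt(1)
    by (intro add_nonneg_nonneg sum_nonneg mult_nonneg_nonneg) (auto intro: less_imp_le)
  have "norm (G t z) \<le> (C2 + C1 * C) * (\<Sum>i\<in>I. cmod (lform (c i) z) powr - y)"
    if t: "t \<in> ball s r" and z: "norm z = 1" "\<forall>i\<in>I. lform (c i) z \<noteq> 0" for t z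
  proof -
    define \<Sigma> where "\<Sigma> = (\<Sum>i\<in>I. cmod (lform (c i) z) powr - y)"
    have \<Sigma>: "\<Sigma> \<ge> 0" by (simp add: \<Sigma>_def sum_nonneg)
    have Ret: "\<sigma> < Re t" "\<bar>Re t\<bar> \<le> T" using Re_ball[OF t] by (auto simp: r_def T_def)
    have ct: "cmod t \<le> T" using t norm_triangle_ineq2[of t s] by (auto simp: T_def dist_norm norm_minus_commute)
    have ex: "- y \<le> k * Re t \<and> k * Re t \<le> N" if "0 \<le> k" "k \<le> real d" for k
    proof -
      have "- y \<le> k * Re t" "k * Re t \<le> real d * T"
        by (rule exponent_bounds[of k "real d" \<sigma> "Re t" T y]; use that Ret y dy in simp)+
      moreover have "2 * real d * T + 2 \<le> N" by (simp add: N_def)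
      moreover have "0 \<le> real d * T" using dp T by simp
      ultimately show ?thesis by linarith
    qed
    have absle: "\<bar>k * Re t\<bar> \<le> k' * T" if "0 \<le> k" "k \<le> k'" for k k'
      using mult_mono[OF that(2) Ret(2)] that by (simp add: abs_mult)
    have u0: "lform (c i1) z \<noteq> 0" using z i1 by blast
    show ?thesis
    proof (cases "cmod (lform (c i1) z) < \<kappa>")
      case True
      have "norm (abs_pow (lform (c i1) z) (of_nat (a i1) * t)) * (cmod (lform (c i1) z))\<^sup>2 = cmod (lform (c i1) z) powr (a1 * Re t + 2)"
        using u0 by (simp add: norm_abs_pow a1_def powr_add powr_realpow mult.assoc)
      also have "\<dots> = (\<Prod>l\<in>I. cmod (lform (c l) z) powr (if l \<in> {i1} then a1 * Re t + 2 else 0))"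
        using prod_supported_exponents[OF z(2), of "{i1}" "\<lambda>_. a1 * Re t + 2"] i1 by simp
      also have "\<dots> \<le> C * \<Sigma>" unfolding \<Sigma>_def
      proof (rule C(2)[OF z])
        have "a1 * Re t \<le> (2 * real d) * T" using absle[of a1 "2 * real d"] a1 by linarith
        moreover have "- y \<le> a1 * Re t + 2"
        proof (cases "Re t \<ge> 0")
          case True
          thus ?thesis using a1 mult_nonneg_nonneg[of a1 "Re t"] y by linarith
        next
          case False
          have "a1 * \<sigma> \<le> a1 * Re t" using a1 Ret by (intro mult_left_mono) auto
          thus ?thesis by (simp add: y_def)
        qed
        moreover have "0 \<le> N" using y by (simp add: N_def)
        ultimately show "\<forall>i\<in>I. - y \<le> (if i \<in> {i1} then a1 * Re t + 2 else 0) \<and> (if i \<in> {i1} then a1 * Re t + 2 else 0) \<le> N"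
          using y by (auto simp: N_def)
      qed
      finally have "norm (G t z) \<le> C1 * (C * \<Sigma>)"
        using C1(2)[OF ct z(1) True] C1(1) by (meson less_imp_le mult_left_mono order_trans)
      moreover have "0 \<le> C2 * \<Sigma>" using C2 \<Sigma> by simp
      ultimately show ?thesis unfolding \<Sigma>_def[symmetric] by (simp add: algebra_simps)
    next
      case False
      have u1: "norm (abs_pow (lform (c i1) z) (of_nat (a i1) * t)) \<le> A1" unfolding norm_abs_pow A1_def
      proof (rule powr_le_bound[OF \<kappa>])
        show "\<kappa> \<le> cmod (lform (c i1) z)" using False by simp
        show "cmod (lform (c i1) z) \<le> M" by (rule M(2)[OF i1 z(1)])
        show "\<bar>2 * Re (of_nat (a i1) * t)\<bar> \<le> 2 * real d * T"
          using absle[of a1 "2 * real d"] a1 by (simp add: a1_def mult.assoc)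
      qed (rule M(1))
      have Kb: "norm (abs_pow K t) \<le> AK" unfolding norm_abs_pow using Ret by (intro AK) auto
      have Hb: "norm (H i t z) \<le> A1 * (AK * (C * A\<mu> i)) * \<Sigma>" if i: "i \<in> I'" for i
      proof -
        have iI: "i \<in> I" using i I' by auto
        have "norm (abs_pow (x i z) (of_nat b * t)) = cmod (lform (c i) z) powr (2 * real b * Re t) * (1 / cmod (\<mu> i)) powr (2 * real b * Re t)"
          using \<mu>_nonzero[OF i] by (simp add: norm_abs_pow x_def norm_divide powr_mult[symmetric] mult.assoc)
        also have "\<dots> \<le> (C * \<Sigma>) * A\<mu> i"
        proof (intro mult_mono)
          have "cmod (lform (c i) z) powr (2 * real b * Re t) = (\<Prod>l\<in>I. cmod (lform (c l) z) powr (if l \<in> {i} then 2 * real b * Re t else 0))"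
            using prod_supported_exponents[OF z(2), of "{i}" "\<lambda>_. 2 * real b * Re t"] iI by simp
          also have "\<dots> \<le> C * \<Sigma>" unfolding \<Sigma>_def
          proof (rule C(2)[OF z])
            have "0 \<le> N" using y by (simp add: N_def)
            thus "\<forall>l\<in>I. - y \<le> (if l \<in> {i} then 2 * real b * Re t else 0) \<and> (if l \<in> {i} then 2 * real b * Re t else 0) \<le> N"
              using ex[of "2 * real b"] b_bounds(2) y by auto
          qed
          finally show "cmod (lform (c i) z) powr (2 * real b * Re t) \<le> C * \<Sigma>" .
          show "(1 / cmod (\<mu> i)) powr (2 * real b * Re t) \<le> A\<mu> i"
            by (rule A\<mu>(2)[OF i]) (use absle[of "2 * real b" "real d"] b_bounds(2) in auto)
        qed (use C \<Sigma> in auto)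
        finally have "norm (H i t z) \<le> A1 * (AK * ((C * \<Sigma>) * A\<mu> i))"
          unfolding H_def norm_mult using A1 AK by (intro mult_mono u1 Kb) auto
        thus ?thesis by (simp add: mult_ac)
      qed
      have Fb: "norm (F t z) \<le> A1 * C * \<Sigma>"
      proof -
        have "norm (F t z) = norm (abs_pow (lform (c i1) z) (of_nat (a i1) * t)) * (\<Prod>l\<in>I'. cmod (lform (c l) z) powr (2 * real (a l) * Re t))"
          unfolding norm_F norm_abs_pow using prod.remove[OF finI i1, of "\<lambda>l. cmod (lform (c l) z) powr (2 * (real (a l) * Re t))"]
          by (simp add: I'_def mult.assoc)
        also have "(\<Prod>l\<in>I'. cmod (lform (c l) z) powr (2 * real (a l) * Re t)) =
           (\<Prod>l\<in>I. cmod (lform (c l) z) powr (if l \<in> I' then 2 * real (a l) * Re t else 0))"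
          by (rule prod_supported_exponents[OF z(2) I'(4), symmetric])
        also have "norm (abs_pow (lform (c i1) z) (of_nat (a i1) * t)) * \<dots> \<le> A1 * (C * \<Sigma>)" unfolding \<Sigma>_def
        proof (intro mult_mono u1 C(2)[OF z])
          have "0 \<le> N" using y by (simp add: N_def)
          moreover have "2 * real (a l) \<le> real d" if "l \<in> I'" for l
            using b_bounds(2) b_bounds(3)[OF that] by linarith
          ultimately show "\<forall>l\<in>I. - y \<le> (if l \<in> I' then 2 * real (a l) * Re t else 0) \<and> (if l \<in> I' then 2 * real (a l) * Re t else 0) \<le> N"
            using ex y by auto
        qed (use A1 in \<open>auto intro!: prod_nonneg\<close>)
        finally show ?thesis by (simp add: mult_ac)
      qed
      have "norm (G t z) \<le> norm (\<Sum>i\<in>I'. of_real (wt i) * H i t z) + norm (F t z)"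
        unfolding G_def by (rule norm_triangle_ineq4)
      also have "norm (\<Sum>i\<in>I'. of_real (wt i) * H i t z) \<le> (\<Sum>i\<in>I'. wt i * (A1 * (AK * (C * A\<mu> i)) * \<Sigma>))"
      proof (rule order_trans[OF norm_sum sum_mono])
        fix i assume i: "i \<in> I'"
        show "norm (of_real (wt i) * H i t z) \<le> wt i * (A1 * (AK * (C * A\<mu> i)) * \<Sigma>)"
          using wt(1)[OF i] Hb[OF i] by (simp add: norm_mult mult_left_mono less_imp_le)
      qed
      also note Fb
      also have "(\<Sum>i\<in>I'. wt i * (A1 * (AK * (C * A\<mu> i)) * \<Sigma>)) + A1 * C * \<Sigma> = C2 * \<Sigma>"
        by (simp add: C2_def distrib_right sum_distrib_right mult.assoc)
      finally have "norm (G t z) \<le> C2 * \<Sigma>" by simp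
      moreover have "0 \<le> C1 * C * \<Sigma>" using C1 C \<Sigma> by simp
      ultimately show ?thesis unfolding \<Sigma>_def[symmetric] by (simp add: algebra_simps)
    qed
  qed
  thus ?thesis using r y by blast
qed

end

context lines_zeta
begin

text \<open>Every term of the second derivative contains a derivative of \<open>\<alpha>\<close> or
  of \<open>\<beta>\<close>, and these vanish where the cutoffs are constant. The direction
  \<open>e\<close> will be the kernel of one of the forms, so mixed terms occur.\<close>

lemma \<phi>_second_derivative:
  "\<exists>\<phi>1 \<phi>2 R. wirt_along e \<phi> \<phi>1 \<and> wirt_along e \<phi>1 \<phi>2 \<and> continuous_on UNIV \<phi>2 \<and> (\<forall>z. norm z > R \<longrightarrow> \<phi> z = 0 \<and> \<phi>1 z = 0 \<and> \<phi>2 z = 0)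
     \<and> (\<forall>z. norm z < \<rho> \<longrightarrow> \<phi>2 z = 0)"
proof -
  define A1 B1 where "A1 = wirt \<alpha>" and "B1 = wirt \<beta>"
  define A2 B2 where "A2 = wirt A1" and "B2 = wirt B1"
  have C: "A1 \<in> Cc_infinity" "B1 \<in> Cc_infinity" unfolding A1_def B1_def by (intro wirt_Cc_infinity test)+
  have C2: "A2 \<in> Cc_infinity" "B2 \<in> Cc_infinity" unfolding A2_def B2_def by (intro wirt_Cc_infinity C)+
  define P where "P A B z = A (z $ 1) * B (z $ 2)" for A B :: "complex \<Rightarrow> complex" and z :: "complex^2"
  have dzP: "wirt_along e (P A B) (\<lambda>z. e $ 1 * P (wirt A) B z + e $ 2 * P A (wirt B) z)"
    if "A \<in> Cc_infinity" "B \<in> Cc_infinity" for A B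
    using wirt_along_test_product[OF that, of e] by (simp add: P_def[abs_def])
  have cP: "continuous_on UNIV (P A B)" if "A \<in> Cc_infinity" "B \<in> Cc_infinity" for A B
    using continuous_test_product[OF that] by (simp add: P_def[abs_def])
  define u v where "u = e $ 1" and "v = e $ 2"
  define \<phi>1 where "\<phi>1 = (\<lambda>z. u * P A1 \<beta> z + v * P \<alpha> B1 z)"
  define \<phi>2 where "\<phi>2 = (\<lambda>z. u * (u * P A2 \<beta> z + v * P A1 B1 z) + v * (u * P A1 B1 z + v * P \<alpha> B2 z))"
  have \<phi>': "\<phi> = P \<alpha> \<beta>" using \<phi> by (intro ext) (simp add: P_def)
  have "wirt_along e \<phi> \<phi>1" unfolding \<phi>' \<phi>1_def u_def v_def A1_def B1_def by (rule dzP[OF test])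
  moreover have "wirt_along e \<phi>1 \<phi>2"
    using wirt_along_add[OF wirt_along_cmult[OF dzP[OF C(1) test(2)]] wirt_along_cmult[OF dzP[OF test(1) C(2)]], of u v]
    by (simp add: \<phi>1_def \<phi>2_def u_def v_def A1_def B1_def A2_def B2_def)
  moreover have "continuous_on UNIV \<phi>2" unfolding \<phi>2_def
    by (intro continuous_intros cP C C2 test)
  moreover obtain R1 R2 where R: "\<And>w. norm w > R1 \<Longrightarrow> \<alpha> w = 0" "\<And>w. norm w > R2 \<Longrightarrow> \<beta> w = 0"
    using test Cc_infinity_supportE by metis
  have RA: "\<alpha> w = 0 \<and> A1 w = 0 \<and> A2 w = 0" if "norm w > R1" for w
    using wirt_zero_outside[OF R(1)] wirt_zero_outside[of R1 A1 w] that R(1) by (simp add: A1_def A2_def)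
  have RB: "\<beta> w = 0 \<and> B1 w = 0 \<and> B2 w = 0" if "norm w > R2" for w
    using wirt_zero_outside[OF R(2)] wirt_zero_outside[of R2 B1 w] that R(2) by (simp add: B1_def B2_def)
  have "\<phi> z = 0 \<and> \<phi>1 z = 0 \<and> \<phi>2 z = 0" if "norm z > R1 + R2" for z
  proof -
    have "cmod (z $ 1) > R1 \<or> cmod (z $ 2) > R2" using norm_vec2_le[of z] that by linarith
    thus ?thesis using RA[of "z $ 1"] RB[of "z $ 2"] by (auto simp: \<phi>' \<phi>1_def \<phi>2_def P_def)
  qed
  moreover have "\<phi>2 z = 0" if "norm z < \<rho>" for z
  proof -
    have 1: "cmod (z $ 1) < \<rho>" "cmod (z $ 2) < \<rho>" using norm_nth_le_vec[of z 1] norm_nth_le_vec[of z 2] that by auto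
    have A1: "A1 w = 0" and B1: "B1 w = 0" if "norm w < \<rho>" for w
      unfolding A1_def B1_def using wirt_zero_inside[OF one(1) that] wirt_zero_inside[OF one(2) that] by auto
    have "A2 w = 0" and "B2 w = 0" if "norm w < \<rho>" for w
      unfolding A2_def B2_def using wirt_zero_inside[OF A1 that] wirt_zero_inside[OF B1 that] by auto
    thus ?thesis using A1 B1 1 by (simp add: \<phi>2_def P_def)
  qed
  ultimately show ?thesis by blast
qed

end

lemma integrable_continuous_support:
  fixes f :: "complex^2 \<Rightarrow> complex"
  assumes "continuous_on UNIV f" "\<And>z. norm z > R \<Longrightarrow> f z = 0"
  shows "integrable lborel f"
proof -
  obtain C where "\<And>z. norm (f z) \<le> C" using continuous_compact_support_bounded[OF assms] by blast
  thus ?thesis using assms by (intro integrable_bounded_support borel_measurable_continuous_onI) auto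
qed

lemma continuous_on_abs_pow_compose:
  assumes "Re \<sigma> > 0" "continuous_on S f"
  shows "continuous_on S (\<lambda>z. abs_pow (f z) \<sigma>)"
  by (rule continuous_on_compose2[OF continuous_abs_pow[OF assms(1)]]) (use assms in auto)

text \<open>\<open>V\<close> carries what is constant along \<open>e\<close>, so only the power of
  \<open>lform v\<close> and the test function are differentiated; the holomorphic exponent rises
  from \<open>m\<close> to \<open>Suc m\<close>.\<close>

lemma integrate_by_parts:
  assumes \<sigma>: "Re \<sigma> > 0" and V: "continuous_on UNIV V" "\<And>z w. V (z + w *s e) = V z"
    and \<psi>: "wirt_along e \<psi> \<psi>'" "continuous_on UNIV \<psi>'" "\<And>z. norm z > R \<Longrightarrow> \<psi> z = 0 \<and> \<psi>' z = 0"
  shows "(\<sigma> + of_nat (Suc m)) * lform v e * (\<integral>z. abs_pow (lform v z) \<sigma> * lform v z ^ m * (V z * \<psi> z) \<partial>lborel)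
     = - (\<integral>z. abs_pow (lform v z) \<sigma> * lform v z ^ Suc m * (V z * \<psi>' z) \<partial>lborel)"
proof -
  have c\<psi>: "continuous_on UNIV \<psi>" using \<psi>(1) by (simp add: wirt_along_def)
  have cl: "continuous_on UNIV (\<lambda>z. abs_pow (lform v z) \<sigma>)" by (intro continuous_on_abs_pow_compose \<sigma> continuous_intros)
  have i1: "integrable lborel (\<lambda>z. abs_pow (lform v z) \<sigma> * lform v z ^ m * (V z * \<psi> z))"
    by (rule integrable_continuous_support[where R=R]) (use \<psi>(3) in \<open>auto intro!: continuous_intros cl V c\<psi>\<close>)
  have i2: "integrable lborel (\<lambda>z. abs_pow (lform v z) \<sigma> * lform v z ^ Suc m * (V z * \<psi>' z))"
    by (rule integrable_continuous_support[where R=R], intro continuous_intros cl V \<psi>(2)) (use \<psi>(3) in auto)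
  have "wirt_along e (\<lambda>z. abs_pow (lform v z) \<sigma> * lform v z ^ Suc m * (V z * \<psi> z))
     (\<lambda>z. (\<sigma> + of_nat (Suc m)) * lform v e * (abs_pow (lform v z) \<sigma> * lform v z ^ m) * (V z * \<psi> z)
        + abs_pow (lform v z) \<sigma> * lform v z ^ Suc m * (0 * \<psi> z + V z * \<psi>' z))"
    by (intro wirt_along_mult wirt_along_abs_pow_power \<sigma> wirt_along_constant_along V \<psi>(1))
  from wirt_along_integral_eq_0(3)[OF this, of R]
  have "(\<integral>z. (\<sigma> + of_nat (Suc m)) * lform v e * (abs_pow (lform v z) \<sigma> * lform v z ^ m) * (V z * \<psi> z)
        + abs_pow (lform v z) \<sigma> * lform v z ^ Suc m * (0 * \<psi> z + V z * \<psi>' z) \<partial>lborel) = 0"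
    using \<psi>(3) by simp
  hence "(\<integral>z. (\<sigma> + of_nat (Suc m)) * lform v e * (abs_pow (lform v z) \<sigma> * lform v z ^ m * (V z * \<psi> z))
        + abs_pow (lform v z) \<sigma> * lform v z ^ Suc m * (V z * \<psi>' z) \<partial>lborel) = 0"
    by (simp only: mult_zero_left add_0_left mult.assoc)
  hence "(\<sigma> + of_nat (Suc m)) * lform v e * (\<integral>z. abs_pow (lform v z) \<sigma> * lform v z ^ m * (V z * \<psi> z) \<partial>lborel)
        + (\<integral>z. abs_pow (lform v z) \<sigma> * lform v z ^ Suc m * (V z * \<psi>' z) \<partial>lborel) = 0"
    by (subst (asm) Bochner_Integration.integral_add[OF integrable_mult_right[OF i1] i2])
      (simp only: integral_mult_right_zero)
  thus ?thesis by (simp only: add_eq_0_iff2)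
qed

context lines_dominant
begin

section \<open>Two-line comparison functions and the negative sign\<close>

definition Kp :: "complex \<Rightarrow> complex" where
  "Kp s = (of_nat (a i1) * s + 1) * (of_nat (a i1) * s + 2)"

lemma Kp_holomorphic: "Kp holomorphic_on S" unfolding Kp_def by (intro holomorphic_intros)

text \<open>At \<open>s = -2/d\<close> the number \<open>a i1 * s\<close> lies strictly between -2
  and -1: dominance gives the upper bound and \<open>a i1 < d\<close> the lower one.\<close>

lemma Kp_nonzero: "Kp (of_real (- 2 / real d)) \<noteq> 0"
proof -
  have d: "real d > 0" using d_pos by simp
  have 1: "real (a i1) * (- 2 / real d) + 1 < 0" using dominant d by (simp add: field_simps)
  have 2: "real (a i1) * (- 2 / real d) + 2 > 0" using a_less_d[OF i1] d by (simp add: field_simps)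
  have "Kp (of_real (- 2 / real d)) = of_real ((real (a i1) * (- 2 / real d) + 1) * (real (a i1) * (- 2 / real d) + 2))"
    by (simp add: Kp_def)
  also have "\<dots> \<noteq> 0" using 1 2 by (simp only: of_real_eq_0_iff mult_eq_0_iff) linarith
  finally show ?thesis .
qed

text \<open>With only two lines, integrating by parts twice in the variable \<open>lform (c i1) z\<close> gives finiteness at
  \<open>-2/d\<close>: the second derivative of \<open>\<phi>\<close> vanishes near the origin.\<close>

lemma H_extension:
  assumes i: "i \<in> I'"
  shows "\<exists>Y \<eta>. \<eta> > 0 \<and> Y holomorphic_on {s. Re s > - 2 / real d - \<eta>} \<and>
    (\<forall>s. Re s > 0 \<longrightarrow> Y s = Kp s * (\<integral>z. H i s z * \<phi> z \<partial>lborel))"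
proof -
  have iI: "i \<in> I" "i \<noteq> i1" using i by (auto simp: I'_def)
  \<comment> \<open>The kernel of the second form, so that differentiating along \<open>e\<close>
    leaves \<open>x i\<close> alone; \<open>\<epsilon>\<close>, the derivative of the dominant form,
    is nonzero because the two lines differ.\<close>
  define e where "e = vec2 (c i $ 2) (- (c i $ 1))"
  have lfe: "lform (c i) e = 0" by (simp add: e_def lform_def)
  define \<epsilon> where "\<epsilon> = lform (c i1) e"
  have \<epsilon>: "\<epsilon> \<noteq> 0" using indep[of i i1] iI i1 by (auto simp: \<epsilon>_def e_def lform_def mult.commute)
  obtain \<phi>1 \<phi>2 R where dz1: "wirt_along e \<phi> \<phi>1" and dz2: "wirt_along e \<phi>1 \<phi>2" and c2: "continuous_on UNIV \<phi>2"
    and R: "\<And>z. norm z > R \<Longrightarrow> \<phi> z = 0 \<and> \<phi>1 z = 0 \<and> \<phi>2 z = 0" and near: "\<And>z. norm z < \<rho> \<Longrightarrow> \<phi>2 z = 0"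
    using \<phi>_second_derivative[of e] by blast
  define Hh where "Hh s z = abs_pow (lform (c i1) z) (of_nat (a i1) * s) * lform (c i1) z ^ 2 * ((abs_pow K s * abs_pow (x i z) (of_nat b * s)) * \<phi>2 z)" for s z
  have dp: "real d > 0" using d_pos by simp
  \<comment> \<open>The two quantities are minus the exponents of \<open>lform (c i1)\<close> and
    \<open>lform (c i)\<close> in \<open>Hh\<close> at \<open>s = -2/d\<close>. Both are below 2, so
    \<open>y\<close> fits strictly between \<open>\<delta>\<close> and 2, and the gap
    \<open>y - \<delta>\<close> pays for the step \<open>\<eta>\<close> to the left of
    \<open>-2/d\<close>.\<close>
  define \<delta> where "\<delta> = max 0 (max (4 * real (a i1) / real d - 2) (4 * real b / real d))"
  have "4 * real (a i1) / real d - 2 < 2" using a_less_d[OF i1] dp by (simp add: field_simps)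
  moreover have "4 * real b / real d < 2" using b_bounds(2) dp by (simp add: field_simps)
  ultimately have \<delta>: "0 \<le> \<delta>" "\<delta> < 2" by (auto simp: \<delta>_def)
  define y where "y = (\<delta> + 2) / 2"
  have y: "0 \<le> y" "y < 2" "\<delta> < y" using \<delta> by (auto simp: y_def)
  define \<eta> where "\<eta> = (y - \<delta>) / (2 * real d)"
  have \<eta>: "\<eta> > 0" using y dp by (simp add: \<eta>_def)
  define \<sigma> where "\<sigma> = - 2 / real d - \<eta>"
  have k\<sigma>: "- (k * \<sigma>) \<le> 2 * k / real d + (y - \<delta>)" if "0 \<le> k" "k \<le> 2 * real d" for k
  proof -
    have "k * \<eta> \<le> (2 * real d) * \<eta>" using that \<eta> by (intro mult_right_mono) auto
    also have "\<dots> = y - \<delta>" using dp by (simp add: \<eta>_def)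
    finally show ?thesis by (simp add: \<sigma>_def algebra_simps)
  qed
  define a1 where "a1 = 2 * real (a i1)"
  have a1: "0 \<le> a1" "a1 \<le> 2 * real d" using a_less_d[OF i1] by (auto simp: a1_def)
  have b1: "0 \<le> 2 * real b" "2 * real b \<le> 2 * real d" using b_bounds(2) by auto
  have ya: "- (a1 * \<sigma>) - 2 \<le> y" using k\<sigma>[OF a1] by (auto simp: a1_def \<delta>_def)
  have yb: "- (2 * real b * \<sigma>) \<le> y" using k\<sigma>[OF b1] by (auto simp: \<delta>_def)
  define S where "S = {s::complex. Re s > \<sigma>}"
  have oS: "open S" unfolding S_def by (rule open_halfspace_Re_gt)
  have m2 [measurable]: "\<phi>2 \<in> borel_measurable borel" by (rule borel_measurable_continuous_onI[OF c2])
  obtain B where B: "\<And>z. norm (\<phi>2 z) \<le> B"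
    using continuous_compact_support_bounded[OF c2, of R] R by blast
  have "(\<lambda>s. \<integral>z. Hh s z \<partial>lborel) holomorphic_on S"
  proof (rule holomorphic_on_integral[OF oS])
    show "Hh s \<in> borel_measurable lborel" for s unfolding Hh_def by measurable
    show "(\<lambda>s. Hh s z) holomorphic_on S" for z unfolding Hh_def by (intro holomorphic_intros)
    fix s assume s: "s \<in> S"
    define T where "T = cmod s + 1"
    have T: "T > 0" by (simp add: T_def add_nonneg_pos)
    define N where "N = max y (2 * real d * T + 2)"
    obtain C where C: "C > 0" "\<And>z e. norm z = 1 \<Longrightarrow> \<forall>i\<in>I. lform (c i) z \<noteq> 0 \<Longrightarrow> \<forall>i\<in>I. - y \<le> e i \<and> e i \<le> N \<Longrightarrow>
      (\<Prod>i\<in>I. cmod (lform (c i) z) powr e i) \<le> C * (\<Sum>i\<in>I. cmod (lform (c i) z) powr - y)"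
      using sphere_bound[OF y(1), of N] by (auto simp: N_def)
    obtain AK where AK: "AK > 0" "\<And>y. \<bar>y\<bar> \<le> 2 * T \<Longrightarrow> cmod K powr y \<le> AK"
      using real_powr_bound[of "cmod K" "2 * T"] K_nonzero by auto
    obtain A\<mu> where A\<mu>: "A\<mu> > 0" "\<And>y. \<bar>y\<bar> \<le> 2 * real d * T \<Longrightarrow> (1 / cmod (\<mu> i)) powr y \<le> A\<mu>"
      using real_powr_bound[of "1 / cmod (\<mu> i)" "2 * real d * T"] \<mu>_nonzero[OF i] by auto
    define hi where "hi = max 1 R"
    define lo where "lo = min 1 \<rho>"
    have lohi: "lo > 0" "lo \<le> 1" "hi \<ge> 1" using \<rho> by (auto simp: lo_def hi_def)
    define A where "A = hi powr (2 * real d * T + 2) + lo powr - (2 * real d * T + 2)"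
    have A: "A > 0" using lohi by (simp add: A_def add_pos_pos)
    define C' where "C' = A * (C * hi powr y) * (AK * A\<mu>) * \<bar>B\<bar>"
    \<comment> \<open>The power of \<open>norm z\<close> is trivial: \<open>\<phi>2\<close> vanishes
      near the origin, and only the singularities along the lines have to be controlled.\<close>
    define g where "g z = C' * (\<Sum>l\<in>I. indicator (cball 0 R) z * (norm z powr - 0 * cmod (lform (c l) z) powr - y))" for z
    have gi: "integrable lborel g" unfolding g_def
      by (intro integrable_mult_right Bochner_Integration.integrable_sum integrable_lform_powr) (use c_nonzero y in auto)
    have "AE z in lborel. \<forall>l\<in>I. lform (c l) z \<noteq> 0"
      by (intro AE_finite_allI finI AE_lform_nonzero c_nonzero)
    hence "AE z in lborel. \<forall>t\<in>ball s 1 \<inter> S. norm (Hh t z) \<le> g z"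
    proof eventually_elim
      case (elim z)
      have C'0: "C' \<ge> 0" using A C AK A\<mu> by (simp add: C'_def)
      have g0: "g z \<ge> 0" unfolding g_def using C'0 by (intro mult_nonneg_nonneg sum_nonneg) auto
      show ?case
      proof
        fix t assume t: "t \<in> ball s 1 \<inter> S"
        show "norm (Hh t z) \<le> g z"
        proof (cases "norm z < \<rho> \<or> norm z > R")
          case True
          hence "\<phi>2 z = 0" using near R by blast
          thus ?thesis using g0 by (simp add: Hh_def)
        next
          case False
          hence zb: "\<rho> \<le> norm z" "norm z \<le> R" by auto
          have zpos: "norm z > 0" using zb \<rho> by linarith
          define u where "u = z /\<^sub>R norm z"
          have lfz: "cmod (lform (c l) z) = norm z * cmod (lform (c l) u)" for l
            using zpos by (simp add: u_def norm_mult norm_inverse)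
          have u1: "norm u = 1" using zpos by (simp add: u_def)
          have unz: "\<forall>l\<in>I. lform (c l) u \<noteq> 0" using elim lfz by (metis norm_eq_zero mult_zero_right)
          have Ret: "\<sigma> < Re t" "\<bar>Re t\<bar> \<le> T" using t Re_ball(2)[of t s 1] by (auto simp: S_def T_def)
          have absle: "\<bar>k * Re t\<bar> \<le> 2 * real d * T" if "0 \<le> k" "k \<le> 2 * real d" for k
            using mult_mono[OF that(2) Ret(2)] that by (simp add: abs_mult)
          define ea where "ea = a1 * Re t + 2"
          define eb where "eb = 2 * real b * Re t"
          have lower: "- y \<le> k * Re t + n" if "0 \<le> k" "- (k * \<sigma>) - n \<le> y" "0 \<le> n" for k n
          proof (cases "Re t \<ge> 0")
            case True
            thus ?thesis using that mult_nonneg_nonneg[of k "Re t"] y by linarith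
          next
            case False
            have "k * \<sigma> \<le> k * Re t" using that Ret by (intro mult_left_mono) auto
            thus ?thesis using that by linarith
          qed
          have ea: "- y \<le> ea" "ea \<le> 2 * real d * T + 2"
            using lower[OF a1(1) ya] absle[OF a1] by (auto simp: ea_def)
          have eb: "- y \<le> eb" "eb \<le> 2 * real d * T"
            using lower[OF b1(1), of 0] yb absle[OF b1] by (auto simp: eb_def)
          define LL where "LL = cmod (lform (c i1) z) powr ea * cmod (lform (c i) z) powr eb"
          have "norm (abs_pow (lform (c i1) z) (of_nat (a i1) * t) * lform (c i1) z ^ 2) = cmod (lform (c i1) z) powr ea"
            using elim i1 by (simp add: norm_mult norm_power norm_abs_pow a1_def ea_def powr_add powr_realpow mult.assoc)
          moreover have "norm (abs_pow (x i z) (of_nat b * t)) = cmod (lform (c i) z) powr eb * (1 / cmod (\<mu> i)) powr eb"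
            using \<mu>_nonzero[OF i] by (simp add: norm_abs_pow x_def norm_divide powr_mult[symmetric] eb_def mult.assoc)
          ultimately have "norm (Hh t z) = cmod (lform (c i1) z) powr ea * (norm (abs_pow K t) * (cmod (lform (c i) z) powr eb * (1 / cmod (\<mu> i)) powr eb) * norm (\<phi>2 z))"
            unfolding Hh_def by (simp only: norm_mult)
          also have "\<dots> = LL * (norm (abs_pow K t) * (1 / cmod (\<mu> i)) powr eb) * norm (\<phi>2 z)"
            by (simp add: LL_def mult_ac)
          also have "\<dots> \<le> (A * (C * hi powr y) * (\<Sum>l\<in>I. cmod (lform (c l) z) powr - y)) * (AK * A\<mu>) * \<bar>B\<bar>"
          proof (intro mult_mono)
            show "norm (abs_pow K t) \<le> AK" unfolding norm_abs_pow using Ret by (intro AK) auto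
            show "(1 / cmod (\<mu> i)) powr eb \<le> A\<mu>" by (rule A\<mu>(2)) (use absle[OF b1] in \<open>simp add: eb_def\<close>)
            show "norm (\<phi>2 z) \<le> \<bar>B\<bar>" using B[of z] by linarith
            have "LL =
              norm z powr (ea + eb) * (cmod (lform (c i1) u) powr ea * cmod (lform (c i) u) powr eb)"
              by (simp add: LL_def lfz powr_mult powr_add mult_ac)
            also have "cmod (lform (c i1) u) powr ea * cmod (lform (c i) u) powr eb =
              (\<Prod>l\<in>I. cmod (lform (c l) u) powr (if l \<in> {i1, i} then (if l = i1 then ea else eb) else 0))"
              using prod_supported_exponents[OF unz, of "{i1, i}" "\<lambda>l. if l = i1 then ea else eb"] iI i1 by simp
            also have "norm z powr (ea + eb) * \<dots> \<le> A * (C * (\<Sum>l\<in>I. cmod (lform (c l) u) powr - y))"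
            proof (intro mult_mono C(2)[OF u1 unz])
              show "norm z powr (ea + eb) \<le> A" unfolding A_def
              proof (rule powr_le_bound[OF lohi(1,2) _ _ lohi(3)])
                show "lo \<le> norm z" "norm z \<le> hi" using zb by (auto simp: lo_def hi_def)
                have "ea + eb = 2 * real d * Re t + 2"
                  unfolding ea_def eb_def a1_def sum_a(2)[symmetric] by (simp add: algebra_simps)
                thus "\<bar>ea + eb\<bar> \<le> 2 * real d * T + 2" using absle[of "2 * real d"] dp by linarith
              qed
              have "0 \<le> N" using y by (simp add: N_def)
              thus "\<forall>l\<in>I. - y \<le> (if l \<in> {i1, i} then if l = i1 then ea else eb else 0) \<and>
                  (if l \<in> {i1, i} then if l = i1 then ea else eb else 0) \<le> N"
                using ea eb y by (auto simp: N_def)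
            qed (use A in \<open>auto intro!: prod_nonneg\<close>)
            also have "\<dots> \<le> A * (C * (hi powr y * (\<Sum>l\<in>I. cmod (lform (c l) z) powr - y)))"
            proof (intro mult_left_mono)
              show "(\<Sum>l\<in>I. cmod (lform (c l) u) powr - y) \<le> hi powr y * (\<Sum>l\<in>I. cmod (lform (c l) z) powr - y)"
                unfolding sum_distrib_left
              proof (rule sum_mono)
                fix l assume l: "l \<in> I"
                have "cmod (lform (c l) u) powr - y = norm z powr y * cmod (lform (c l) z) powr - y"
                  using zpos by (simp add: lfz powr_mult powr_minus field_simps)
                also have "\<dots> \<le> hi powr y * cmod (lform (c l) z) powr - y"
                  by (intro mult_right_mono powr_mono2) (use zb y in \<open>auto simp: hi_def\<close>)
                finally show "cmod (lform (c l) u) powr - y \<le> hi powr y * cmod (lform (c l) z) powr - y" .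
              qed
            qed (use A C in auto)
            finally show "LL \<le> A * (C * hi powr y) * (\<Sum>l\<in>I. cmod (lform (c l) z) powr - y)"
              by (simp add: mult_ac)
          qed (use A C AK A\<mu> in \<open>auto intro!: mult_nonneg_nonneg sum_nonneg\<close>)
          also have "\<dots> = g z" using zb zpos by (simp add: g_def C'_def sum_distrib_left mult_ac)
          finally show ?thesis .
        qed
      qed
    qed
    thus "\<exists>r>0. \<exists>g. integrable lborel g \<and> (AE x in lborel. \<forall>t\<in>ball s r \<inter> S. norm (Hh t x) \<le> g x)"
      using gi by (intro exI[of _ 1] conjI exI[of _ g]) auto
  qed
  hence hol: "(\<lambda>s. (\<integral>z. Hh s z \<partial>lborel) / \<epsilon>\<^sup>2) holomorphic_on {s. Re s > - 2 / real d - \<eta>}"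
    unfolding S_def \<sigma>_def by (intro holomorphic_intros) (use \<epsilon> in auto)
  have "(\<integral>z. Hh s z \<partial>lborel) / \<epsilon>\<^sup>2 = Kp s * (\<integral>z. H i s z * \<phi> z \<partial>lborel)" if s: "Re s > 0" for s
  proof -
    define \<sigma>1 where "\<sigma>1 = of_nat (a i1) * s"
    have \<sigma>1: "Re \<sigma>1 > 0" using s a_pos[OF i1] by (simp add: \<sigma>1_def)
    define V where "V z = abs_pow K s * abs_pow (x i z) (of_nat b * s)" for z
    have Vc: "continuous_on UNIV V" unfolding V_def x_def
      by (intro continuous_intros continuous_on_abs_pow_compose) (use s b_bounds(1) \<mu>_nonzero[OF i] in auto)
    have Ve: "V (z + w *s e) = V z" for z w
    proof -
      have "lform (c i) (z + w *s e) = lform (c i) z + w * lform (c i) e" by (simp add: lform_def algebra_simps)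
      thus ?thesis by (simp add: V_def x_def lfe)
    qed
    have c1: "continuous_on UNIV \<phi>1" using dz2 by (simp add: wirt_along_def)
    \<comment> \<open>The integrations by parts with \<open>m = 0\<close> and \<open>m = 1\<close>
      give the two factors of \<open>Kp\<close>; their signs cancel and each contributes one
      \<open>\<epsilon>\<close>.\<close>
    have p1: "(\<sigma>1 + of_nat (Suc 0)) * \<epsilon> * (\<integral>z. abs_pow (lform (c i1) z) \<sigma>1 * lform (c i1) z ^ 0 * (V z * \<phi> z) \<partial>lborel)
       = - (\<integral>z. abs_pow (lform (c i1) z) \<sigma>1 * lform (c i1) z ^ Suc 0 * (V z * \<phi>1 z) \<partial>lborel)"
      unfolding \<epsilon>_def by (rule integrate_by_parts[OF \<sigma>1 Vc Ve dz1 c1]) (use R in blast)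
    have p2: "(\<sigma>1 + of_nat (Suc (Suc 0))) * \<epsilon> * (\<integral>z. abs_pow (lform (c i1) z) \<sigma>1 * lform (c i1) z ^ Suc 0 * (V z * \<phi>1 z) \<partial>lborel)
       = - (\<integral>z. abs_pow (lform (c i1) z) \<sigma>1 * lform (c i1) z ^ Suc (Suc 0) * (V z * \<phi>2 z) \<partial>lborel)"
      unfolding \<epsilon>_def by (rule integrate_by_parts[OF \<sigma>1 Vc Ve dz2 c2]) (use R in blast)
    define P where "P = (\<integral>z. abs_pow (lform (c i1) z) \<sigma>1 * lform (c i1) z ^ Suc 0 * (V z * \<phi>1 z) \<partial>lborel)"
    have H0: "(\<integral>z. abs_pow (lform (c i1) z) \<sigma>1 * lform (c i1) z ^ 0 * (V z * \<phi> z) \<partial>lborel) = (\<integral>z. H i s z * \<phi> z \<partial>lborel)"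
      by (simp add: H_def V_def \<sigma>1_def mult.assoc)
    have H2: "(\<integral>z. abs_pow (lform (c i1) z) \<sigma>1 * lform (c i1) z ^ Suc (Suc 0) * (V z * \<phi>2 z) \<partial>lborel) = (\<integral>z. Hh s z \<partial>lborel)"
      by (simp add: Hh_def V_def \<sigma>1_def power2_eq_square)
    have e1: "(\<sigma>1 + 1) * \<epsilon> * (\<integral>z. H i s z * \<phi> z \<partial>lborel) = - P" using p1 unfolding H0 P_def[symmetric] by simp
    have e2: "(\<integral>z. Hh s z \<partial>lborel) = - ((\<sigma>1 + 2) * \<epsilon> * P)" using p2 unfolding H2 P_def[symmetric] by simp
    have "P = - ((\<sigma>1 + 1) * \<epsilon> * (\<integral>z. H i s z * \<phi> z \<partial>lborel))" unfolding e1 by simp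
    thus ?thesis unfolding e2 Kp_def using \<epsilon> by (simp add: \<sigma>1_def power2_eq_square)
  qed
  thus ?thesis using hol \<eta> by blast
qed

text \<open>Near \<open>-2/d\<close> the continuation is \<open>YY / Kp\<close>, which is regular
  there, minus \<open>W\<close>. After multiplication by \<open>t - p\<close> the regular part tends
  to 0, so the leading behaviour is that of \<open>- W\<close>.\<close>

lemma sign_large:
  "\<exists>h c. c > 0 \<and> ((\<lambda>t. zeta_mero (of_real t) * of_real (t - (- 2 / real d)) - of_real (h t)) \<longlongrightarrow> 0) (at_right (- 2 / real d))
     \<and> (\<forall>\<^sub>F t in at_right (- 2 / real d). (- 1) * h t \<ge> c)"
proof -
  obtain R where R: "\<And>z. norm z > R \<Longrightarrow> \<phi> z = 0" using \<phi>_support by blast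
  obtain B where B: "\<And>z. norm (\<phi> z) \<le> B" using \<phi>_bounded by blast
  have dp: "real d > 0" using d_pos by simp
  define p where "p = - 2 / real d"
  note fam = G_measurable \<phi>_measurable G_holomorphic G_homogeneous G_bound B R
  define W where "W s = (\<integral>z. G s z * \<phi> z \<partial>lborel)" for s
  have holW: "W holomorphic_on {s. Re s > p}"
    unfolding W_def p_def by (rule homogeneous_family_holomorphic(1)[OF dp finI I_ne c_nonzero fam])
  have "\<forall>i\<in>I'. \<exists>r. snd r > 0 \<and> fst r holomorphic_on {s. Re s > p - snd r} \<and>
    (\<forall>s. Re s > 0 \<longrightarrow> fst r s = Kp s * (\<integral>z. H i s z * \<phi> z \<partial>lborel))"
  proof
    fix i assume i: "i \<in> I'"
    obtain Y \<eta> where "\<eta> > 0" "Y holomorphic_on {s. Re s > - 2 / real d - \<eta>}"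
      "\<And>s. Re s > 0 \<Longrightarrow> Y s = Kp s * (\<integral>z. H i s z * \<phi> z \<partial>lborel)"
      using H_extension[OF i] by blast
    thus "\<exists>r. snd r > 0 \<and> fst r holomorphic_on {s. Re s > p - snd r} \<and>
      (\<forall>s. Re s > 0 \<longrightarrow> fst r s = Kp s * (\<integral>z. H i s z * \<phi> z \<partial>lborel))"
      by (intro exI[of _ "(Y, \<eta>)"]) (simp add: p_def)
  qed
  from bchoice[OF this] obtain r where r: "\<And>i. i \<in> I' \<Longrightarrow> snd (r i) > 0 \<and> fst (r i) holomorphic_on {s. Re s > p - snd (r i)} \<and>
    (\<forall>s. Re s > 0 \<longrightarrow> fst (r i) s = Kp s * (\<integral>z. H i s z * \<phi> z \<partial>lborel))" by blast
  define Y \<eta> where "Y i = fst (r i)" and "\<eta> i = snd (r i)" for i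
  have Y: "\<eta> i > 0" "Y i holomorphic_on {s. Re s > p - \<eta> i}"
    "Re s > 0 \<Longrightarrow> Y i s = Kp s * (\<integral>z. H i s z * \<phi> z \<partial>lborel)" if "i \<in> I'" for i s
    using r[OF that] by (simp_all add: Y_def \<eta>_def)
  define YY where "YY s = (\<Sum>i\<in>I'. of_real (wt i) * Y i s)" for s
  define U where "U s = YY s - Kp s * W s" for s
  have holU: "U holomorphic_on {s. Re s > p}"
    unfolding U_def YY_def
  proof (intro holomorphic_intros holW Kp_holomorphic)
    fix i assume i: "i \<in> I'"
    show "Y i holomorphic_on {s. p < Re s}"
      using Y(1)[OF i] by (intro holomorphic_on_subset[OF Y(2)[OF i]]) auto
  qed
  have eqU: "Kp s * Z s = U s" if s: "Re s > 0" for s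
  proof -
    have iF: "integrable lborel (\<lambda>z. F s z * \<phi> z)"
      by (rule integrable_F_continuous[OF s \<phi>_continuous R])
    have iH: "integrable lborel (\<lambda>z. of_real (wt i) * (H i s z * \<phi> z))" if i: "i \<in> I'" for i
    proof (intro integrable_mult_right integrable_continuous_support[where R=R])
      show "continuous_on UNIV (\<lambda>z. H i s z * \<phi> z)" unfolding H_def x_def
        by (intro continuous_intros continuous_on_abs_pow_compose \<phi>_continuous)
          (use s b_bounds(1) \<mu>_nonzero[OF i] a_pos[OF i1] in auto)
    qed (use R in auto)
    have "G s z * \<phi> z = (\<Sum>i\<in>I'. of_real (wt i) * (H i s z * \<phi> z)) - F s z * \<phi> z" for z
      by (simp add: G_def left_diff_distrib sum_distrib_right mult.assoc)
    hence "W s = (\<integral>z. (\<Sum>i\<in>I'. of_real (wt i) * (H i s z * \<phi> z)) - F s z * \<phi> z \<partial>lborel)"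
      by (simp add: W_def)
    also have "\<dots> = (\<integral>z. (\<Sum>i\<in>I'. of_real (wt i) * (H i s z * \<phi> z)) \<partial>lborel) - Z s"
      unfolding Z_def by (rule Bochner_Integration.integral_diff[OF Bochner_Integration.integrable_sum[OF iH] iF])
    also have "(\<integral>z. (\<Sum>i\<in>I'. of_real (wt i) * (H i s z * \<phi> z)) \<partial>lborel) = (\<Sum>i\<in>I'. of_real (wt i) * (\<integral>z. H i s z * \<phi> z \<partial>lborel))"
      by (subst Bochner_Integration.integral_sum[OF iH]) (simp_all only: integral_mult_right_zero)
    finally have "Kp s * W s = (\<Sum>i\<in>I'. of_real (wt i) * Y i s) - Kp s * Z s"
      by (simp add: right_diff_distrib sum_distrib_left Y(3)[OF _ s] mult_ac)
    thus ?thesis by (simp add: U_def YY_def)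
  qed
  have fl: "filterlim (\<lambda>t. complex_of_real t) (at (of_real p)) (at_right p)"
    unfolding filterlim_at by (auto intro!: tendsto_intros simp: eventually_at_filter)
  have limK: "(Kp \<longlongrightarrow> Kp (of_real p)) (at (of_real p))"
    using Kp_holomorphic[of UNIV] by (metis UNIV_I holomorphic_on_imp_continuous_on continuous_on_def at_within_open open_UNIV)
  have Kne: "Kp (of_real p) \<noteq> 0" using Kp_nonzero by (simp add: p_def)
  have evK: "\<forall>\<^sub>F t in at_right p. Kp (of_real t) \<noteq> 0"
    by (rule eventually_at_right_of_real[OF tendsto_imp_eventually_ne[OF limK Kne]])
  have evZ: "\<forall>\<^sub>F t in at_right p. zeta_mero (of_real t) = U (of_real t) / Kp (of_real t)"
    unfolding p_def by (rule zeta_mero_eq_by_continuation[OF holU[unfolded p_def] Kp_holomorphic eqU evK[unfolded p_def]])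
  have limY: "(YY \<longlongrightarrow> YY (of_real p)) (at (of_real p))"
    unfolding YY_def
  proof (intro tendsto_intros)
    fix i assume i: "i \<in> I'"
    have "continuous_on {s. Re s > p - \<eta> i} (Y i)" by (rule holomorphic_on_imp_continuous_on[OF Y(2)[OF i]])
    hence "isCont (Y i) (of_real p)"
      using Y(1)[OF i] by (intro continuous_on_interior) (auto simp: interior_open open_halfspace_Re_gt)
    thus "(Y i \<longlongrightarrow> Y i (of_real p)) (at (of_real p))" by (simp add: isCont_def)
  qed
  obtain z0 where z0: "z0 \<noteq> 0" "\<forall>i\<in>I. lform (c i) z0 \<noteq> 0" "Re (G (of_real (- 2 / real d)) z0) > 0"
    using G_positive by blast
  obtain c0 where c0: "c0 > 0" "\<forall>\<^sub>F t in at_right p. W (of_real t) \<in> \<real> \<and> (2 + real d * t) * Re (W (of_real t)) \<ge> c0"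
    using homogeneous_family_lower_bound[OF dp finI I_ne c_nonzero fam \<phi>_nonneg \<rho> \<phi>_one G_nonneg isCont_G[OF z0(2)] z0(3,1)]
    unfolding W_def p_def by auto
  define h where "h t = - ((t - p) * Re (W (of_real t)))" for t
  have "((\<lambda>t. YY (of_real t) / Kp (of_real t) * of_real (t - p)) \<longlongrightarrow> YY (of_real p) / Kp (of_real p) * of_real (p - p)) (at_right p)"
    by (intro tendsto_intros filterlim_compose[OF limY fl] filterlim_compose[OF limK fl] Kne)
  hence lim0: "((\<lambda>t. YY (of_real t) / Kp (of_real t) * of_real (t - p)) \<longlongrightarrow> 0) (at_right p)" by simp
  have "((\<lambda>t. zeta_mero (of_real t) * of_real (t - p) - of_real (h t)) \<longlongrightarrow> 0) (at_right p)"
  proof (rule Lim_transform_eventually[OF lim0])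
    show "\<forall>\<^sub>F t in at_right p. YY (of_real t) / Kp (of_real t) * of_real (t - p) = zeta_mero (of_real t) * of_real (t - p) - of_real (h t)"
      using evZ evK c0(2)
    proof eventually_elim
      case (elim t)
      have "W (of_real t) = of_real (Re (W (of_real t)))" using elim by simp
      hence "of_real (h t) = - (of_real (t - p) * W (of_real t))" by (simp add: h_def)
      moreover have "zeta_mero (of_real t) = YY (of_real t) / Kp (of_real t) - W (of_real t)"
        using elim by (simp add: U_def diff_divide_distrib)
      ultimately show ?case by (simp only:) (simp add: algebra_simps)
    qed
  qed
  moreover have "\<forall>\<^sub>F t in at_right p. (- 1) * h t \<ge> c0 / real d"
    using c0(2) by eventually_elim (use dp in \<open>auto simp: h_def p_def field_simps\<close>)
  moreover have "c0 / real d > 0" using c0 dp by simp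
  ultimately show ?thesis unfolding p_def by blast
qed

end

section \<open>Arrangements given by polynomials\<close>

definition monom_eval :: "('n::finite \<Rightarrow>\<^sub>0 nat) \<Rightarrow> complex^'n \<Rightarrow> complex" where
  "monom_eval m z = (\<Prod>i\<in>UNIV. z $ i ^ Poly_Mapping.lookup m i)"

lemma mpoly_eval_monom_eval: "mpoly_eval p z = (\<Sum>m\<in>Poly_Mapping.keys p. Poly_Mapping.lookup p m * monom_eval m z)"
  by (simp add: mpoly_eval_def monom_eval_def)

lemma mpoly_eval_add: "mpoly_eval (p + q) z = mpoly_eval p z + mpoly_eval q z"
  unfolding mpoly_eval_monom_eval by (rule setsum_keys_plus_distrib) (auto simp: algebra_simps)

lemma mpoly_eval_zero: "mpoly_eval 0 z = 0"
  by (simp add: mpoly_eval_def)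

lemma mpoly_eval_single: "mpoly_eval (Poly_Mapping.single m k) z = k * monom_eval m z"
  by (cases "k = 0") (auto simp: mpoly_eval_monom_eval)

lemma mpoly_eval_sum: "mpoly_eval (\<Sum>i\<in>A. p i) z = (\<Sum>i\<in>A. mpoly_eval (p i) z)"
  by (induction A rule: infinite_finite_induct) (auto simp: mpoly_eval_zero mpoly_eval_add)

lemma poly_mapping_sum_singles:
  "p = (\<Sum>m\<in>Poly_Mapping.keys p. Poly_Mapping.single m (Poly_Mapping.lookup p m))"
proof (rule poly_mapping_eqI)
  fix k
  have "Poly_Mapping.lookup (\<Sum>m\<in>Poly_Mapping.keys p. Poly_Mapping.single m (Poly_Mapping.lookup p m)) k
    = (\<Sum>m\<in>Poly_Mapping.keys p. if m = k then Poly_Mapping.lookup p m else 0)"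
    by (simp add: lookup_sum lookup_single when_def)
  also have "\<dots> = Poly_Mapping.lookup p k"
    by (simp add: in_keys_iff)
  finally show "Poly_Mapping.lookup p k = Poly_Mapping.lookup (\<Sum>m\<in>Poly_Mapping.keys p. Poly_Mapping.single m (Poly_Mapping.lookup p m)) k"
    by simp
qed

lemma monom_eval_add: "monom_eval (m + n) z = monom_eval m z * monom_eval n z"
  by (simp add: monom_eval_def lookup_add power_add prod.distrib)

text \<open>Both factors are expanded into single monomials, for which the convolution product is
  addition of exponents.\<close>

lemma mpoly_eval_mult: "mpoly_eval (p * q) z = mpoly_eval p z * mpoly_eval q z"
proof -
  let ?l = "Poly_Mapping.lookup" and ?k = "Poly_Mapping.keys"
  have "p * q = (\<Sum>m\<in>?k p. Poly_Mapping.single m (?l p m)) * (\<Sum>n\<in>?k q. Poly_Mapping.single n (?l q n))"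
    using poly_mapping_sum_singles[of p] poly_mapping_sum_singles[of q] by simp
  also have "\<dots> = (\<Sum>m\<in>?k p. \<Sum>n\<in>?k q. Poly_Mapping.single (m + n) (?l p m * ?l q n))"
    by (simp add: sum_product mult_single)
  finally have "mpoly_eval (p * q) z = (\<Sum>m\<in>?k p. \<Sum>n\<in>?k q. (?l p m * monom_eval m z) * (?l q n * monom_eval n z))"
    by (simp add: mpoly_eval_sum mpoly_eval_single monom_eval_add mult_ac)
  also have "\<dots> = mpoly_eval p z * mpoly_eval q z"
    unfolding mpoly_eval_monom_eval sum_product ..
  finally show ?thesis .
qed

lemma mpoly_eval_one: "mpoly_eval 1 z = 1"
  using mpoly_eval_single[of 0 1 z] by (simp add: monom_eval_def)

lemma mpoly_eval_power: "mpoly_eval (p ^ n) z = mpoly_eval p z ^ n"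
  by (induction n) (auto simp: mpoly_eval_one mpoly_eval_mult)

lemma mpoly_eval_prod: "mpoly_eval (\<Prod>i\<in>A. p i) z = (\<Prod>i\<in>A. mpoly_eval (p i) z)"
  by (induction A rule: infinite_finite_induct) (auto simp: mpoly_eval_one mpoly_eval_mult)

lemma monom_eval_single: "monom_eval (Poly_Mapping.single i 1) z = z $ i"
proof -
  have "monom_eval (Poly_Mapping.single i 1) z = (\<Prod>l\<in>UNIV. if l = i then z $ l else 1)"
    unfolding monom_eval_def by (intro prod.cong refl) (simp add: lookup_single when_def)
  thus ?thesis by simp
qed

section \<open>Polynomials of degree one and lines through the origin\<close>

text \<open>In degree at most 1 only the monomials 1, \<open>z $ 1\<close> and \<open>z $ 2\<close>
  occur. The constant term is the value at the origin, and the linear part is nonzero because the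
  degree 1 is attained.\<close>

lemma degree_one_eval:
  fixes p :: "2 mpoly"
  assumes deg: "mpoly_total_degree p = 1" and p0: "mpoly_eval p 0 = 0"
  shows "\<exists>v. v \<noteq> 0 \<and> (\<forall>z. mpoly_eval p z = lform v z)"
proof -
  let ?l = "Poly_Mapping.lookup" and ?k = "Poly_Mapping.keys p"
  let ?s = "\<lambda>i::2. Poly_Mapping.single i (1::nat)"
  have fin: "finite (insert 0 ((\<lambda>m. \<Sum>i\<in>UNIV. ?l m i) ` ?k))" by simp
  have key: "m = 0 \<or> m = ?s 1 \<or> m = ?s 2" if "m \<in> ?k" for m
  proof -
    have "(\<Sum>i\<in>UNIV. ?l m i) \<le> Max (insert 0 ((\<lambda>m. \<Sum>i\<in>UNIV. ?l m i) ` ?k))"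
      by (rule Max_ge[OF fin]) (use that in auto)
    hence "(\<Sum>i\<in>UNIV. ?l m i) \<le> 1" using deg unfolding mpoly_total_degree_def by metis
    hence "?l m 1 + ?l m 2 \<le> 1" by (simp add: UNIV_2)
    then consider "?l m 1 = 0" "?l m 2 = 0" | "?l m 1 = 1" "?l m 2 = 0" | "?l m 1 = 0" "?l m 2 = 1" by linarith
    thus ?thesis
    proof cases
      case 1
      hence "m = 0" by (intro poly_mapping_eqI) (metis exhaust_2 lookup_zero)
      thus ?thesis by simp
    next
      case 2
      have "?l m i = ?l (?s 1) i" for i using 2 exhaust_2[of i] by (auto simp: lookup_single)
      thus ?thesis by (metis poly_mapping_eqI)
    next
      case 3
      have "?l m i = ?l (?s 2) i" for i using 3 exhaust_2[of i] by (auto simp: lookup_single)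
      thus ?thesis by (metis poly_mapping_eqI)
    qed
  qed
  have ne: "?s 1 \<noteq> 0" "?s 2 \<noteq> 0" "?s 1 \<noteq> ?s 2"
  proof -
    have l: "?l (?s 1) 1 = 1" "?l (?s 1) 2 = 0" "?l (?s 2) 2 = 1" by (simp_all add: lookup_single)
    show "?s 1 \<noteq> 0" "?s 2 \<noteq> 0" "?s 1 \<noteq> ?s 2" using l by (metis lookup_zero zero_neq_one)+
  qed
  have "mpoly_eval p z = (\<Sum>m\<in>{0, ?s 1, ?s 2}. ?l p m * monom_eval m z)" for z
    unfolding mpoly_eval_monom_eval by (rule sum.mono_neutral_left) (use key in \<open>auto simp: in_keys_iff\<close>)
  hence ev: "mpoly_eval p z = ?l p 0 + ?l p (?s 1) * z $ 1 + ?l p (?s 2) * z $ 2" for z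
    using ne by (simp add: monom_eval_single[simplified] monom_eval_def[of 0])
  have l0: "?l p 0 = 0" using ev[of 0] p0 by simp
  define v where "v = vec2 (?l p (?s 1)) (?l p (?s 2))"
  have "Max (insert 0 ((\<lambda>m. \<Sum>i\<in>UNIV. ?l m i) ` ?k)) \<in> insert 0 ((\<lambda>m. \<Sum>i\<in>UNIV. ?l m i) ` ?k)"
    by (rule Max_in[OF fin]) simp
  then obtain m where m: "m \<in> ?k" "(\<Sum>i\<in>UNIV. ?l m i) = 1" using deg by (auto simp: mpoly_total_degree_def)
  have "m \<noteq> 0" using m(2) by auto
  hence "?s 1 \<in> ?k \<or> ?s 2 \<in> ?k" using key[OF m(1)] m(1) by auto
  hence "v \<noteq> 0" by (auto simp: v_def vec2_eq_iff in_keys_iff)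
  moreover have "mpoly_eval p z = lform v z" for z using ev[of z] l0 by (simp add: v_def lform_def)
  ultimately show ?thesis by blast
qed

text \<open>Used in contraposition: distinct lines have independent coefficient vectors.\<close>

lemma proportional_zero_sets:
  assumes "v \<noteq> 0" "w \<noteq> 0" "v $ 1 * w $ 2 = v $ 2 * w $ 1"
  shows "{z. lform v z = 0} = {z. lform w z = 0}"
proof -
  have "\<exists>k. k \<noteq> 0 \<and> w $ 1 = k * v $ 1 \<and> w $ 2 = k * v $ 2"
  proof (cases "v $ 1 = 0")
    case False
    thus ?thesis using assms by (intro exI[of _ "w $ 1 / v $ 1"]) (auto simp: field_simps vec2_eq_iff)
  next
    case True
    hence "v $ 2 \<noteq> 0" using assms(1) by (auto simp: vec2_eq_iff)
    thus ?thesis using assms True by (intro exI[of _ "w $ 2 / v $ 2"]) (auto simp: vec2_eq_iff)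
  qed
  then obtain k where k: "k \<noteq> 0" "w $ 1 = k * v $ 1" "w $ 2 = k * v $ 2" by blast
  have "lform w z = k * lform v z" for z by (simp add: lform_def k(2,3) algebra_simps)
  thus ?thesis using k(1) by simp
qed

lemma decomposable_two_lines:
  fixes f g :: "2 mpoly"
  assumes f: "\<And>z. mpoly_eval f z = lform v z" and g: "\<And>z. mpoly_eval g z = lform w z"
    and indep: "v $ 1 * w $ 2 \<noteq> v $ 2 * w $ 1"
  shows "decomposable (f * g)"
proof -
  define D where "D = v $ 1 * w $ 2 - v $ 2 * w $ 1"
  have D: "D \<noteq> 0" using indep by (simp add: D_def)
  \<comment> \<open>The inverse of the matrix with rows \<open>v\<close> and \<open>w\<close>: in
    the new coordinates the two forms become the coordinate functions.\<close>
  define M :: "complex^2^2" where "M = (\<chi> i j. if i = 1 then (if j = 1 then w $ 2 / D else - v $ 2 / D)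
     else (if j = 1 then - w $ 1 / D else v $ 1 / D))"
  have M: "M $ 1 $ 1 = w $ 2 / D" "M $ 1 $ 2 = - v $ 2 / D" "M $ 2 $ 1 = - w $ 1 / D" "M $ 2 $ 2 = v $ 1 / D"
    by (auto simp: M_def)
  have "det M = (v $ 1 * w $ 2 - v $ 2 * w $ 1) / (D * D)"
    using D by (simp add: det_2 M field_simps)
  hence "det M \<noteq> 0" using D by (simp add: D_def)
  hence inv: "invertible M" by (simp add: invertible_det_nz)
  have Mv: "(M *v u) $ 1 = (w $ 2 * u $ 1 - v $ 2 * u $ 2) / D" "(M *v u) $ 2 = (v $ 1 * u $ 2 - w $ 1 * u $ 1) / D" for u
    by (simp_all add: matrix_vector_mult_def UNIV_2 M diff_divide_distrib)
  have "lform v (M *v u) * D = u $ 1 * D" "lform w (M *v u) * D = u $ 2 * D" for u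
    using D by (simp_all add: lform_def Mv distrib_right) (simp_all add: D_def algebra_simps)
  hence lM: "lform v (M *v u) = u $ 1" "lform w (M *v u) = u $ 2" for u using D by auto
  define x y :: "2 mpoly" where "x = Poly_Mapping.single (Poly_Mapping.single 1 1) 1"
    and "y = Poly_Mapping.single (Poly_Mapping.single 2 1) 1"
  have deg: "mpoly_total_degree x > 0" "mpoly_total_degree y > 0"
    by (simp_all add: mpoly_total_degree_def x_def y_def UNIV_2 lookup_single when_def)
  have vars: "mpoly_vars x \<inter> mpoly_vars y = {}"
    by (simp add: mpoly_vars_def x_def y_def)
  have "mpoly_eval (f * g) (M *v u) = mpoly_eval (x * y) u" for u
    by (simp add: mpoly_eval_mult f g lM x_def y_def mpoly_eval_single monom_eval_single[simplified])
  thus ?thesis unfolding decomposable_def using inv deg vars by blast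
qed

theorem theorem1p10:
  fixes f :: "nat \<Rightarrow> 2 mpoly" and r :: nat
    and \<alpha> \<beta> :: "complex \<Rightarrow> complex" and D :: "complex set"
    and \<phi> :: "complex^2 \<Rightarrow> complex"
    and a :: "nat \<Rightarrow> nat" and d :: nat
  assumes degree_one: "\<And>i. i \<in> {1..r} \<Longrightarrow> mpoly_total_degree (f i) = 1"
    and distinct_lines: "inj_on (\<lambda>i. zero_locus (f i)) {1..r}"
    and central: "central_arrangement ((\<lambda>i. zero_locus (f i)) ` {1..r})"
    and essential: "essential_arrangement ((\<lambda>i. zero_locus (f i)) ` {1..r})"
    and indecomposable: "\<not> decomposable (\<Prod>i\<in>{1..r}. f i)"
    and test_functions: "\<alpha> \<in> Cc_infinity" "\<beta> \<in> Cc_infinity"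
    and nonneg: "\<And>z. \<alpha> z \<in> \<real>\<^sub>\<ge>\<^sub>0" "\<And>z. \<beta> z \<in> \<real>\<^sub>\<ge>\<^sub>0"
    and neighbourhood: "0 \<in> interior D"
    and one_on_D: "\<And>z. z \<in> D \<Longrightarrow> \<alpha> z = 1" "\<And>z. z \<in> D \<Longrightarrow> \<beta> z = 1"
    and phi: "\<And>z. \<phi> z = \<alpha> (z $ 1) * \<beta> (z $ 2)"
    and a_pos: "\<And>i. i \<in> {1..r} \<Longrightarrow> a i > 0"
    and d: "d = (\<Sum>i\<in>{1..r}. a i)"
  shows
    "let Z = arch_zeta (\<Prod>i\<in>{1..r}. f i ^ a i) \<phi>;
         p = - 2 / of_nat d :: complex
     in pole_order Z p \<le> 2 \<and>
        (pole_order Z p \<noteq> 2 \<longrightarrow>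
           pole_order Z p = 1 \<and>
           (real (Max (a ` {1..r})) \<le> real d / 2 \<longrightarrow>
              residue Z p \<in> \<real> \<and> Re (residue Z p) > 0) \<and>
           (real (Max (a ` {1..r})) > real d / 2 \<longrightarrow>
              residue Z p \<in> \<real> \<and> Re (residue Z p) < 0))"
proof -
  have "\<forall>i\<in>{1..r}. \<exists>v. v \<noteq> 0 \<and> (\<forall>z. mpoly_eval (f i) z = lform v z)"
  proof
    fix i assume i: "i \<in> {1..r}"
    have "mpoly_eval (f i) 0 = 0" using central i by (auto simp: central_arrangement_def zero_locus_def)
    with degree_one[OF i] show "\<exists>v. v \<noteq> 0 \<and> (\<forall>z. mpoly_eval (f i) z = lform v z)" by (rule degree_one_eval)
  qed
  from bchoice[OF this] obtain c where c: "\<And>i. i \<in> {1..r} \<Longrightarrow> c i \<noteq> 0"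
    and ev: "\<And>i z. i \<in> {1..r} \<Longrightarrow> mpoly_eval (f i) z = lform (c i) z" by blast
  have locus: "zero_locus (f i) = {z. lform (c i) z = 0}" if "i \<in> {1..r}" for i
    using ev[OF that] by (simp add: zero_locus_def)
  have indep: "c i $ 1 * c j $ 2 \<noteq> c i $ 2 * c j $ 1" if "i \<in> {1..r}" "j \<in> {1..r}" "i \<noteq> j" for i j
    using proportional_zero_sets[OF c[OF that(1)] c[OF that(2)]] inj_onD[OF distinct_lines _ that(1,2)] that(3)
    by (auto simp: locus[OF that(1)] locus[OF that(2)])
  \<comment> \<open>The empty intersection is the whole space, and one line through the origin is
    more than a point, so essentiality excludes \<open>r = 0\<close> and \<open>r = 1\<close>. Two
    lines are essential but decomposable. Three lines remain as the least case.\<close>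
  have "r \<noteq> 0" using essential by (auto simp: essential_arrangement_def)
  moreover have "r \<noteq> 1"
  proof
    assume r: "r = 1"
    hence "{z. lform (c 1) z = 0} = {0}" using essential locus[of 1] by (simp add: essential_arrangement_def)
    moreover have "lform (c 1) (vec2 (c 1 $ 2) (- (c 1 $ 1))) = 0" by (simp add: lform_def)
    ultimately have "vec2 (c 1 $ 2) (- (c 1 $ 1)) = 0" by blast
    thus False using c[of 1] r by (auto simp: vec2_eq_iff)
  qed
  moreover have "r \<noteq> 2"
  proof
    assume r: "r = 2"
    hence "{1..r} = {1, 2}" by auto
    hence "(\<Prod>i\<in>{1..r}. f i) = f 1 * f 2" by simp
    moreover have "decomposable (f 1 * f 2)"
      by (rule decomposable_two_lines[of _ "c 1" _ "c 2"]) (use ev indep r in auto)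
    ultimately show False using indecomposable by simp
  qed
  ultimately have "card {1..r} \<ge> 3" by simp
  moreover obtain \<rho> where \<rho>: "\<rho> > 0" "ball 0 \<rho> \<subseteq> D" using neighbourhood mem_interior by blast
  have "\<alpha> z = 1" "\<beta> z = 1" if "cmod z < \<rho>" for z using that \<rho>(2) one_on_D[of z] by (auto simp: subset_iff)
  ultimately interpret A: lines_zeta "{1..r}" c a \<alpha> \<beta> \<phi> \<rho>
    using a_pos indep test_functions nonneg \<rho>(1) phi by unfold_locales auto
  have Ad: "A.d = d" unfolding A.d_def d ..
  have zeta: "zeta_integral (\<Prod>i\<in>{1..r}. f i ^ a i) \<phi> s = A.Z s" for s
  proof -
    have "of_real (cmod (mpoly_eval (\<Prod>i\<in>{1..r}. f i ^ a i) z)) powr (2 * s) = A.F s z" for z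
    proof -
      \<comment> \<open>Positivity of \<open>a i\<close> matters on the lines themselves, where both
        sides are 0; exponent 0 would give the factor 1 on the right.\<close>
      have "A.F s z = (\<Prod>i\<in>{1..r}. abs_pow (lform (c i) z ^ a i) s)"
        unfolding A.F_def by (intro prod.cong refl) (simp add: abs_pow_power a_pos)
      also have "\<dots> = abs_pow (mpoly_eval (\<Prod>i\<in>{1..r}. f i ^ a i) z) s"
        unfolding mpoly_eval_prod mpoly_eval_power abs_pow_prod by (intro prod.cong refl) (simp add: ev)
      finally show ?thesis by (simp add: abs_pow_def)
    qed
    thus ?thesis unfolding zeta_integral_def A.Z_def by (simp only:)
  qed
  have Z: "arch_zeta (\<Prod>i\<in>{1..r}. f i ^ a i) \<phi> = A.zeta_mero"
    by (rule arch_zeta_eqI[OF A.zeta_mero_nicely]) (simp only: zeta A.zeta_mero_Re_pos)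
  have p: "- 2 / of_nat d = complex_of_real (- 2 / real d)" by simp
  obtain L where L: "((\<lambda>s. (s - of_real (- 2 / real d))^2 * A.zeta_mero s) \<longlongrightarrow> L) (at (of_real (- 2 / real d)))"
    using A.near_pole(2) unfolding Ad by blast
  have fin: "finite (a ` {1..r})" "a ` {1..r} \<noteq> {}" using A.I_ne by auto
  show ?thesis
  proof (cases "real (Max (a ` {1..r})) \<le> real d / 2")
    case True
    have "real (a i) \<le> real A.d / 2" if "i \<in> {1..r}" for i
    proof -
      have "a i \<le> Max (a ` {1..r})" using fin that by simp
      hence "real (a i) \<le> real (Max (a ` {1..r}))" by simp
      thus ?thesis using True unfolding Ad by linarith
    qed
    from A.sign_small[OF this] obtain h k where "k > 0"
      "((\<lambda>t. A.zeta_mero (of_real t) * of_real (t - (- 2 / real d)) - of_real (h t)) \<longlongrightarrow> 0) (at_right (- 2 / real d))"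
      "\<forall>\<^sub>F t in at_right (- 2 / real d). 1 * h t \<ge> k"
      unfolding Ad by blast
    note pc = pole_conclusion[OF A.zeta_mero_nicely L this]
    show ?thesis unfolding Let_def Z p using pc True by auto
  next
    case False
    obtain i1 where i1: "i1 \<in> {1..r}" "a i1 = Max (a ` {1..r})" using Max_in[OF fin] by auto
    have "real d < 2 * real (a i1)" using False i1(2) by simp
    hence "2 * a i1 > d" by linarith
    then interpret B: lines_dominant "{1..r}" c a \<alpha> \<beta> \<phi> \<rho> i1
      using i1(1) by unfold_locales (simp_all only: Ad)
    from B.sign_large obtain h k where "k > 0"
      "((\<lambda>t. A.zeta_mero (of_real t) * of_real (t - (- 2 / real d)) - of_real (h t)) \<longlongrightarrow> 0) (at_right (- 2 / real d))"
      "\<forall>\<^sub>F t in at_right (- 2 / real d). (- 1) * h t \<ge> k"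
      unfolding Ad by blast
    note pc = pole_conclusion[OF A.zeta_mero_nicely L this]
    show ?thesis unfolding Let_def Z p using pc False by auto
  qed
qed

end
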